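(* Let $X$ be a diffeological space that is compact under the $D$-topology, and let $N$ be a smooth manifold (finite-dimensional, Hausdorff, second countable and without boundary). Then $C^\infty(X,N)$ is a fibrant diffeological space. Moreover, if $x_0\in X$ and $n_0\in N$ are chosen points, then the pointed mapping space $C^\infty((X,x_0),(N,n_0))=\{f\in C^\infty(X,N)\mid f(x_0)=n_0\}$ is fibrant when given the sub-diffeology from $C^\infty(X,N)$.
   Context: A diffeological space is a set $X$ together with, for each $n\in\mathbb{N}$ and each open $U\subseteq\mathbb{R}^n$, a specified set of functions $U\to X$ called plots, such that: every constant map is a plot; if $U\to X$ is a plot and $V\to U$ is a smooth map between open subsets of Euclidean spaces then the composite $V\to X$ is a plot; and a function $U\to X$ whose restriction to each member of some open cover of $U$ is a plot is itself a plot. A map $f:X\to Y$ is smooth if $f\circ p$ is a plot of $Y$ for every plot $p$ of $X$. A smooth manifold has the standard diffeology, whose plots are the usual smooth maps from open subsets of Euclidean spaces. A subset $A\subseteq X$ has the sub-diffeology: $U\to A$ is a plot iff $U\to A\hookrightarrow X$ is. The set $C^\infty(X,Y)$ of smooth maps carries the diffeology whose plots are the functions $U\to C^\infty(X,Y)$ for which the adjoint $U\times X\to Y$ is smooth (products have plots with both components plots). The $D$-topology on $X$ is the final topology induced by its plots (domains with their usual topology). Let $\mathbb{A}^n=\{(x_0,\dots,x_n)\in\mathbb{R}^{n+1}\mid\sum x_i=1\}$ with the sub-diffeology from $\mathbb{R}^{n+1}$. A map $f:\{0,\dots,n\}\to\{0,\dots,m\}$ in the simplicial category induces $f_*:\mathbb{A}^n\to\mathbb{A}^m$,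 $f_*(x)_j=\sum_{i\in f^{-1}(j)}x_i$. $S^D(X)$ is the simplicial set with $S^D_n(X)=C^\infty(\mathbb{A}^n,X)$ and structure maps given by precomposition. A diffeological space $X$ is fibrant if $S^D(X)$ is a Kan complex. *)

theory Defs
  imports "HOL-Analysis.Analysis" "HOL-Library.FuncSet"
begin

section \<open>Smooth maps between open subsets of Euclidean spaces\<close>

text \<open>
  The dimension of a plot domain is a bound variable, so \<open>\<real>\<^sup>n\<close> is the topology
  \<^const>\<open>Euclidean_space\<close> \<open>n\<close> on the functions \<open>x :: nat \<Rightarrow> real\<close> with \<open>x i = 0\<close> for all \<open>i \<ge> n\<close>;
  the coordinates are \<open>x 0, \<dots>, x (n - 1)\<close>.  The domain \<open>U\<close> below is always open in
  \<open>\<real>\<^sup>n\<close>, so partial derivatives at points of \<open>U\<close> do not depend on values outside \<open>U\<close>.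
\<close>

definition has_partial :: "nat \<Rightarrow> ((nat \<Rightarrow> real) \<Rightarrow> real) \<Rightarrow> (nat \<Rightarrow> real) \<Rightarrow> bool" where
  "has_partial i f x \<longleftrightarrow> (\<lambda>t. f (x(i := t))) differentiable (at (x i))"

definition partial :: "nat \<Rightarrow> ((nat \<Rightarrow> real) \<Rightarrow> real) \<Rightarrow> (nat \<Rightarrow> real) \<Rightarrow> real" where
  "partial i f x = deriv (\<lambda>t. f (x(i := t))) (x i)"

fun Ck_on :: "nat \<Rightarrow> nat \<Rightarrow> (nat \<Rightarrow> real) set \<Rightarrow> ((nat \<Rightarrow> real) \<Rightarrow> real) \<Rightarrow> bool" where
  "Ck_on 0 n U f \<longleftrightarrow> continuous_map (subtopology (Euclidean_space n) U) euclideanreal f"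
| "Ck_on (Suc k) n U f \<longleftrightarrow>
     continuous_map (subtopology (Euclidean_space n) U) euclideanreal f \<and>
     (\<forall>i<n. (\<forall>x\<in>U. has_partial i f x) \<and> Ck_on k n U (partial i f))"

definition smooth_map :: "nat \<Rightarrow> (nat \<Rightarrow> real) set \<Rightarrow> nat \<Rightarrow> (nat \<Rightarrow> real) set
    \<Rightarrow> ((nat \<Rightarrow> real) \<Rightarrow> (nat \<Rightarrow> real)) \<Rightarrow> bool" where
  "smooth_map m V n U f \<longleftrightarrow> f \<in> V \<rightarrow> U \<and> (\<forall>j<n. \<forall>k. Ck_on k m V (\<lambda>x. f x j))"


section \<open>Diffeological spaces\<close>

text \<open>
  Functions between sets are extensional (\<open>A \<rightarrow>\<^sub>E B\<close>), so that sets of functions, and in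
  particular mapping spaces, consist of genuine functions on \<open>A\<close>.  Only the values of
  \<open>plots X n U\<close> for \<open>U\<close> open in \<open>\<real>\<^sup>n\<close> are meaningful.
\<close>

record 'a diffeology =
  points :: "'a set"
  plots :: "nat \<Rightarrow> (nat \<Rightarrow> real) set \<Rightarrow> ((nat \<Rightarrow> real) \<Rightarrow> 'a) set"

locale diffeological_space =
  fixes X :: "'a diffeology"
  assumes plots_subset:
      "openin (Euclidean_space n) U \<Longrightarrow> plots X n U \<subseteq> U \<rightarrow>\<^sub>E points X"
    and const_plot:
      "openin (Euclidean_space n) U \<Longrightarrow> x \<in> points X \<Longrightarrow> (\<lambda>u\<in>U. x) \<in> plots X n U"
    and plot_compose:
      "openin (Euclidean_space n) U \<Longrightarrow> openin (Euclidean_space m) V \<Longrightarrow> p \<in> plots X n U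
        \<Longrightarrow> smooth_map m V n U f \<Longrightarrow> compose V p f \<in> plots X m V"
    and plot_local:
      "openin (Euclidean_space n) U \<Longrightarrow> p \<in> U \<rightarrow>\<^sub>E points X
        \<Longrightarrow> (\<And>V. V \<in> \<V> \<Longrightarrow> openin (Euclidean_space n) V) \<Longrightarrow> \<Union>\<V> = U
        \<Longrightarrow> (\<And>V. V \<in> \<V> \<Longrightarrow> restrict p V \<in> plots X n V)
        \<Longrightarrow> p \<in> plots X n U"

definition smooth_maps :: "'a diffeology \<Rightarrow> 'b diffeology \<Rightarrow> ('a \<Rightarrow> 'b) set" where
  "smooth_maps X Y = {f \<in> points X \<rightarrow>\<^sub>E points Y.
     \<forall>n U. openin (Euclidean_space n) U \<longrightarrow> (\<forall>p \<in> plots X n U. compose U f p \<in> plots Y n U)}"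

definition euclidean_diffeology :: "nat \<Rightarrow> (nat \<Rightarrow> real) diffeology" where
  "euclidean_diffeology n = \<lparr>points = topspace (Euclidean_space n),
     plots = (\<lambda>m V. {p \<in> V \<rightarrow>\<^sub>E topspace (Euclidean_space n).
                       smooth_map m V n (topspace (Euclidean_space n)) p})\<rparr>"

definition sub_diffeology :: "'a diffeology \<Rightarrow> 'a set \<Rightarrow> 'a diffeology" where
  "sub_diffeology X A = \<lparr>points = points X \<inter> A,
     plots = (\<lambda>n U. {p \<in> plots X n U. p ` U \<subseteq> A})\<rparr>"

definition prod_diffeology :: "'a diffeology \<Rightarrow> 'b diffeology \<Rightarrow> ('a \<times> 'b) diffeology" where
  "prod_diffeology X Y = \<lparr>points = points X \<times> points Y,
     plots = (\<lambda>n U. {p \<in> U \<rightarrow>\<^sub>E points X \<times> points Y.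
                       compose U fst p \<in> plots X n U \<and> compose U snd p \<in> plots Y n U})\<rparr>"

definition mapping_space :: "'a diffeology \<Rightarrow> 'b diffeology \<Rightarrow> ('a \<Rightarrow> 'b) diffeology" where
  "mapping_space X Y = \<lparr>points = smooth_maps X Y,
     plots = (\<lambda>n U. {p \<in> U \<rightarrow>\<^sub>E smooth_maps X Y.
        restrict (\<lambda>(u, x). p u x) (U \<times> points X)
          \<in> smooth_maps (prod_diffeology (sub_diffeology (euclidean_diffeology n) U) X) Y})\<rparr>"

definition D_topology :: "'a diffeology \<Rightarrow> 'a topology" where
  "D_topology X = topology (\<lambda>A. A \<subseteq> points X \<and>
     (\<forall>n U. openin (Euclidean_space n) U \<longrightarrow>
        (\<forall>p \<in> plots X n U. openin (Euclidean_space n) {u \<in> U. p u \<in> A})))"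

lemma openin_D_topology:
  "openin (D_topology X) A \<longleftrightarrow> A \<subseteq> points X \<and>
     (\<forall>n U. openin (Euclidean_space n) U \<longrightarrow>
        (\<forall>p \<in> plots X n U. openin (Euclidean_space n) {u \<in> U. p u \<in> A}))"
proof -
  let ?P = "\<lambda>A. A \<subseteq> points X \<and>
     (\<forall>n U. openin (Euclidean_space n) U \<longrightarrow>
        (\<forall>p \<in> plots X n U. openin (Euclidean_space n) {u \<in> U. p u \<in> A}))"
  have "istopology ?P"
    unfolding istopology_def
  proof (rule conjI; intro allI impI)
    fix S T assume S: "?P S" and T: "?P T"
    have "{u \<in> U. p u \<in> S \<inter> T} = {u \<in> U. p u \<in> S} \<inter> {u \<in> U. p u \<in> T}"
      for U and p :: "(nat \<Rightarrow> real) \<Rightarrow> 'a"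
      by auto
    with S T show "?P (S \<inter> T)"
      by (auto intro: openin_Int)
  next
    fix \<K> assume K: "\<forall>K\<in>\<K>. ?P K"
    have "{u \<in> U. p u \<in> \<Union>\<K>} = (\<Union>K\<in>\<K>. {u \<in> U. p u \<in> K})"
      for U and p :: "(nat \<Rightarrow> real) \<Rightarrow> 'a"
      by auto
    with K show "?P (\<Union>\<K>)"
      by (auto intro!: openin_Union)
  qed
  then show ?thesis
    by (simp add: D_topology_def topology_inverse')
qed


section \<open>Smooth manifolds\<close>

text \<open>
  A smooth manifold of dimension \<open>d\<close> is a Hausdorff, second countable space \<open>T\<close> with a
  smooth atlas \<open>\<A>\<close> of charts \<open>(W, \<phi>)\<close>, where \<open>\<phi>\<close> maps the open set \<open>W\<close> homeomorphically onto
  an open subset of \<open>\<real>\<^sup>d\<close>.  The atlas need not be maximal.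
\<close>

locale smooth_manifold =
  fixes d :: nat
    and T :: "'b topology"
    and \<A> :: "('b set \<times> ('b \<Rightarrow> nat \<Rightarrow> real)) set"
  assumes Hausdorff: "Hausdorff_space T"
    and second_countable: "second_countable T"
    and chart_domain: "(W, \<phi>) \<in> \<A> \<Longrightarrow> openin T W"
    and chart_image: "(W, \<phi>) \<in> \<A> \<Longrightarrow> openin (Euclidean_space d) (\<phi> ` W)"
    and chart_homeo: "(W, \<phi>) \<in> \<A> \<Longrightarrow>
      homeomorphic_map (subtopology T W) (subtopology (Euclidean_space d) (\<phi> ` W)) \<phi>"
    and charts_cover: "(\<Union>(W, \<phi>)\<in>\<A>. W) = topspace T"
    and transition_smooth: "(W, \<phi>) \<in> \<A> \<Longrightarrow> (W', \<psi>) \<in> \<A> \<Longrightarrow>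
      smooth_map d (\<phi> ` (W \<inter> W')) d (\<psi> ` (W \<inter> W')) (\<lambda>x. \<psi> (inv_into W \<phi> x))"

definition manifold_diffeology ::
    "nat \<Rightarrow> 'b topology \<Rightarrow> ('b set \<times> ('b \<Rightarrow> nat \<Rightarrow> real)) set \<Rightarrow> 'b diffeology" where
  "manifold_diffeology d T \<A> = \<lparr>points = topspace T,
     plots = (\<lambda>m V. {p \<in> V \<rightarrow>\<^sub>E topspace T.
        continuous_map (subtopology (Euclidean_space m) V) T p \<and>
        (\<forall>(W, \<phi>)\<in>\<A>. smooth_map m {v \<in> V. p v \<in> W} d (\<phi> ` W) (\<lambda>v. \<phi> (p v)))})\<rparr>"


section \<open>Simplicial sets and Kan complexes\<close>

text \<open>
  \<open>\<Delta> n m\<close> is the set of morphisms \<open>[n] \<rightarrow> [m]\<close> of the simplicial category.  For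
  \<open>f : [n] \<rightarrow> [m]\<close>, \<open>act S n m f\<close> is the induced map from \<open>m\<close>-simplices to \<open>n\<close>-simplices.
\<close>

definition \<Delta> :: "nat \<Rightarrow> nat \<Rightarrow> (nat \<Rightarrow> nat) set" where
  "\<Delta> n m = {f \<in> {..n} \<rightarrow>\<^sub>E {..m}. mono_on {..n} f}"

record 's simplicial =
  simplices :: "nat \<Rightarrow> 's set"
  act :: "nat \<Rightarrow> nat \<Rightarrow> (nat \<Rightarrow> nat) \<Rightarrow> 's \<Rightarrow> 's"

locale simplicial_set =
  fixes S :: "'s simplicial"
  assumes act_closed: "f \<in> \<Delta> n m \<Longrightarrow> s \<in> simplices S m \<Longrightarrow> act S n m f s \<in> simplices S n"
    and act_id: "s \<in> simplices S n \<Longrightarrow> act S n n (\<lambda>i\<in>{..n}. i) s = s"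
    and act_compose: "f \<in> \<Delta> l n \<Longrightarrow> g \<in> \<Delta> n m \<Longrightarrow> s \<in> simplices S m
      \<Longrightarrow> act S l m (compose {..l} g f) s = act S l n f (act S n m g s)"

definition simplicial_maps :: "'s simplicial \<Rightarrow> 't simplicial \<Rightarrow> (nat \<Rightarrow> 's \<Rightarrow> 't) set" where
  "simplicial_maps S T = {\<phi>. (\<forall>n. \<phi> n \<in> simplices S n \<rightarrow> simplices T n) \<and>
     (\<forall>n m. \<forall>f \<in> \<Delta> n m. \<forall>s \<in> simplices S m. \<phi> n (act S n m f s) = act T n m f (\<phi> m s))}"

definition standard_simplex :: "nat \<Rightarrow> (nat \<Rightarrow> nat) simplicial" where
  "standard_simplex n = \<lparr>simplices = (\<lambda>m. \<Delta> m n), act = (\<lambda>l m f s. compose {..l} s f)\<rparr>"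

text \<open>The \<open>k\<close>-th horn is the union of the faces opposite to the vertices \<open>i \<noteq> k\<close>.\<close>

definition horn :: "nat \<Rightarrow> nat \<Rightarrow> (nat \<Rightarrow> nat) simplicial" where
  "horn n k = \<lparr>simplices = (\<lambda>m. {s \<in> \<Delta> m n. \<exists>i\<le>n. i \<noteq> k \<and> i \<notin> s ` {..m}}),
               act = act (standard_simplex n)\<rparr>"

definition Kan_complex :: "'s simplicial \<Rightarrow> bool" where
  "Kan_complex S \<longleftrightarrow> simplicial_set S \<and>
     (\<forall>n\<ge>1. \<forall>k\<le>n. \<forall>\<phi> \<in> simplicial_maps (horn n k) S.
        \<exists>\<psi> \<in> simplicial_maps (standard_simplex n) S.
          \<forall>m. \<forall>s \<in> simplices (horn n k) m. \<psi> m s = \<phi> m s)"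


section \<open>The smooth singular simplicial set and fibrant diffeological spaces\<close>

definition affine_simplex :: "nat \<Rightarrow> (nat \<Rightarrow> real) diffeology" where
  "affine_simplex n =
     sub_diffeology (euclidean_diffeology (Suc n))
       {x \<in> topspace (Euclidean_space (Suc n)). (\<Sum>i\<le>n. x i) = 1}"

definition affine_push :: "nat \<Rightarrow> (nat \<Rightarrow> nat) \<Rightarrow> (nat \<Rightarrow> real) \<Rightarrow> (nat \<Rightarrow> real)" where
  "affine_push n f x = (\<lambda>j. \<Sum>i | i \<le> n \<and> f i = j. x i)"

definition smooth_singular :: "'a diffeology \<Rightarrow> ((nat \<Rightarrow> real) \<Rightarrow> 'a) simplicial" where
  "smooth_singular X = \<lparr>simplices = (\<lambda>n. smooth_maps (affine_simplex n) X),
     act = (\<lambda>n m f \<sigma>. compose (points (affine_simplex n)) \<sigma> (affine_push n f))\<rparr>"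

definition fibrant :: "'a diffeology \<Rightarrow> bool" where
  "fibrant X \<longleftrightarrow> diffeological_space X \<and> Kan_complex (smooth_singular X)"

end

theory Submission
  imports Defs
begin

text \<open>
  A map out of a horn amounts to compatible smooth families over the coordinate hyperplanes \<open>x i = 0\<close>
  (\<open>i \<noteq> k\<close>) of an affine space.  With values in a vector space such families extend one hyperplane at a
  time: replace \<open>G x\<close> by \<open>G x + f\<^sub>i (x(i := 0)) - G (x(i := 0))\<close>.

  To make this work for values in a manifold \<open>N\<close>, map \<open>N\<close> into \<open>\<real>\<^sup>\<infinity>\<close> by a locally finite family of bump
  functions and their products with chart coordinates.  A neighbourhood of the image retracts smoothly
  onto \<open>N\<close>: treat the charts one after the other and, in each, interpolate between the point found so far
  and the point read off from the coordinates of that chart.  On a point of \<open>N\<close> itself all these agree.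
  This replaces the Whitney embedding and a tubular neighbourhood.

  By the tube lemma and compactness of \<open>X\<close>, the linear extension lies in the domain of the retraction
  over a neighbourhood of the hyperplanes that is star-shaped about \<open>0\<close>.  The map \<open>x \<mapsto> g x * x\<close> with
  \<open>g = 1 / (1 + p\<^sup>2 E)\<close>, where \<open>p\<close> is the product of the coordinates and \<open>E\<close> grows fast enough, moves the
  whole space into that neighbourhood and fixes the hyperplanes.  The construction is pointwise in \<open>X\<close>
  and keeps constant families constant, which gives the pointed case.
\<close>

text \<open>\<open>X\<close> is an arbitrary diffeological space, possibly without charts,
  partitions of unity or a Hausdorff D-topology. So every choice is made in the simplex coordinates
  \<open>x\<close> or in the target; \<open>z\<close> in \<open>X\<close> is a mere parameter, and
  smoothness in \<open>z\<close> is tested along plots only. Compactness enters once: the linear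
  extension must be retractable over a neighbourhood of the hyperplanes whose size does not depend
  on \<open>z\<close>.

  The hyperplanes \<open>x i = 0\<close> all pass through 0 and are stable under scaling, so the
  segment from 0 to a point of one of them stays in it. That is why a region star-shaped about 0 can
  be had, and why multiplication by one smooth scalar \<open>g x\<close> suffices to move the whole
  space into it.

  Interpolating inside a convex chart image gives a point of the manifold at once, whereas an
  average in the ambient vector space would have to be projected back. The price is that the point
  found so far exists only where an earlier bump function is large; the growing thresholds
  \<open>thr\<close> control this.\<close>

abbreviation Esp :: "nat \<Rightarrow> (nat \<Rightarrow> real) set" where
  "Esp n \<equiv> topspace (Euclidean_space n)"

abbreviation eopen :: "nat \<Rightarrow> (nat \<Rightarrow> real) set \<Rightarrow> bool" where
  "eopen n U \<equiv> openin (Euclidean_space n) U"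

abbreviation nbhd :: "nat \<Rightarrow> (nat \<Rightarrow> real) set \<Rightarrow> (nat \<Rightarrow> real) \<Rightarrow> (nat \<Rightarrow> real) set \<Rightarrow> bool" where
  "nbhd n U x V \<equiv> eopen n V \<and> x \<in> V \<and> V \<subseteq> U"

section \<open>Smooth real functions on open subsets of Euclidean spaces\<close>

lemma Esp_iff: "x \<in> Esp n \<longleftrightarrow> (\<forall>i\<ge>n. x i = 0)"
  by (simp add: topspace_Euclidean_space)

lemma Euclidean_space_eq: "Euclidean_space n = top_of_set (Esp n)"
  by (simp add: Euclidean_space_def euclidean_product_topology)

lemma eopen_open: "eopen n U \<longleftrightarrow> (\<exists>T. open T \<and> U = Esp n \<inter> T)"
  by (subst Euclidean_space_eq) (rule openin_open)

lemma eopen_subset: "eopen n U \<Longrightarrow> U \<subseteq> Esp n"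
  by (rule openin_subset)

lemma subtopology_Esp: "U \<subseteq> Esp n \<Longrightarrow> subtopology (Euclidean_space n) U = top_of_set U"
  by (subst Euclidean_space_eq) (simp add: subtopology_subtopology Int_absorb1)

lemma continuous_map_Esp:
  "U \<subseteq> Esp n \<Longrightarrow> continuous_map (subtopology (Euclidean_space n) U) euclideanreal f \<longleftrightarrow> continuous_on U f"
  by (simp add: subtopology_Esp)

text \<open>The common radius is a minimum of finitely many; asking for \<open>P i\<close> at all
  smaller radii makes this minimum work for each \<open>i\<close>.\<close>

lemma uniform_pos:
  fixes m :: nat
  assumes "\<And>i. i < m \<Longrightarrow> \<exists>e>0. \<forall>e'. 0 < e' \<and> e' \<le> e \<longrightarrow> P i (e'::real)"
  shows "\<exists>e>0. \<forall>i<m. P i e"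
proof -
  obtain e where e: "\<And>i. i < m \<Longrightarrow> e i > 0 \<and> (\<forall>e'. 0 < e' \<and> e' \<le> e i \<longrightarrow> P i e')"
    using assms by metis
  define d where "d = Min (insert 1 (e ` {..<m}))"
  have "d > 0" unfolding d_def using e by (subst Min_gr_iff) auto
  moreover have "P i d" if "i < m" for i
  proof -
    have "d \<le> e i" unfolding d_def using that by (intro Min_le) auto
    with e[OF that] \<open>d > 0\<close> show ?thesis by blast
  qed
  ultimately show ?thesis by blast
qed

text \<open>The product topology constrains only finitely many coordinates, and on
  \<open>Esp m\<close> the coordinates from \<open>m\<close> on are all zero, so cubes in the first
  \<open>m\<close> coordinates form a neighbourhood basis.\<close>

lemma eopen_iff:
  "eopen m U \<longleftrightarrow> U \<subseteq> Esp m \<and> (\<forall>x\<in>U. \<exists>e>0. \<forall>y\<in>Esp m. (\<forall>i<m. \<bar>y i - x i\<bar> < e) \<longrightarrow> y \<in> U)"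
proof (intro iffI conjI ballI)
  assume U: "eopen m U"
  then show "U \<subseteq> Esp m" by (rule eopen_subset)
  fix x assume x: "x \<in> U"
  obtain T where T: "open T" "U = Esp m \<inter> T"
    using U unfolding eopen_open by auto
  obtain B where B: "x \<in> Pi\<^sub>E UNIV B" "\<And>i. open (B i)" "Pi\<^sub>E UNIV B \<subseteq> T"
  proof -
    have "\<exists>X. x \<in> (\<Pi>\<^sub>E i\<in>UNIV. X i) \<and> (\<forall>i. openin euclidean (X i)) \<and>
      finite {i. X i \<noteq> topspace euclidean} \<and> (\<Pi>\<^sub>E i\<in>UNIV. X i) \<subseteq> T"
      using T x by (intro product_topology_open_contains_basis) (auto simp: open_fun_def)
    then show ?thesis using that by auto
  qed
  have "\<exists>e>0. \<forall>i<m. ball (x i) e \<subseteq> B i"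
  proof (rule uniform_pos)
    fix i
    have "x i \<in> B i" using B(1) by auto
    then obtain e where "e > 0" "ball (x i) e \<subseteq> B i" using B(2) openE by blast
    then show "\<exists>e>0. \<forall>e'. 0 < e' \<and> e' \<le> e \<longrightarrow> ball (x i) e' \<subseteq> B i"
      by (intro exI[of _ e]) (auto intro: order_trans[OF subset_ball])
  qed
  then obtain e where e: "e > 0" "\<And>i. i < m \<Longrightarrow> ball (x i) e \<subseteq> B i" by auto
  have "y \<in> U" if y: "y \<in> Esp m" "\<forall>i<m. \<bar>y i - x i\<bar> < e" for y
  proof -
    have "y i \<in> B i" for i
    proof (cases "i < m")
      case True
      with y e show ?thesis by (auto simp: dist_real_def abs_minus_commute intro!: subsetD[OF e(2)])
    next
      case False
      then have "y i = x i" using y x \<open>U \<subseteq> Esp m\<close> by (auto simp: Esp_iff subset_iff)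
      with B(1) show ?thesis by auto
    qed
    then have "y \<in> T" using B(3) by auto
    with T y show ?thesis by auto
  qed
  with e show "\<exists>e>0. \<forall>y\<in>Esp m. (\<forall>i<m. \<bar>y i - x i\<bar> < e) \<longrightarrow> y \<in> U" by blast
next
  assume R: "U \<subseteq> Esp m \<and> (\<forall>x\<in>U. \<exists>e>0. \<forall>y\<in>Esp m. (\<forall>i<m. \<bar>y i - x i\<bar> < e) \<longrightarrow> y \<in> U)"
  show "eopen m U"
  proof (subst openin_subopen, intro ballI)
    fix x assume x: "x \<in> U"
    with R obtain e where e: "e > 0" "\<forall>y\<in>Esp m. (\<forall>i<m. \<bar>y i - x i\<bar> < e) \<longrightarrow> y \<in> U" by blast
    let ?S = "{y. \<forall>i\<in>{..<m}. y i \<in> ball (x i) e}"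
    have "open ?S" by (rule product_topology_basis') auto
    then have "eopen m (Esp m \<inter> ?S)" unfolding eopen_open by auto
    moreover have "x \<in> Esp m \<inter> ?S" using x R e by auto
    moreover have "Esp m \<inter> ?S \<subseteq> U" using e by (auto simp: dist_real_def abs_minus_commute)
    ultimately show "\<exists>T. nbhd m U x T" by blast
  qed
qed

lemma eopenE:
  assumes "eopen m U" "x \<in> U"
  obtains e where "e > 0" "\<And>y. y \<in> Esp m \<Longrightarrow> (\<And>i. i < m \<Longrightarrow> \<bar>y i - x i\<bar> < e) \<Longrightarrow> y \<in> U"
  using assms unfolding eopen_iff by meson

lemma eopen_preimage:
  assumes "eopen m U" "continuous_on U f" "open S"
  shows "eopen m {x \<in> U. f x \<in> S}"
proof -
  have "openin (top_of_set U) (U \<inter> f -` S)"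
    using assms(2,3) by (rule continuous_openin_preimage_gen)
  moreover have "U \<inter> f -` S = {x \<in> U. f x \<in> S}" by auto
  ultimately show ?thesis
    using assms(1) eopen_subset[OF assms(1)] by (metis openin_trans_full subtopology_Esp)
qed

lemma Esp_upd: "x \<in> Esp m \<Longrightarrow> i < m \<Longrightarrow> x(i := t) \<in> Esp m"
  by (auto simp: Esp_iff)

lemma eventually_line:
  assumes "eopen m U" "x \<in> U" "i < m"
  shows "\<forall>\<^sub>F t in nhds (x i). x(i := t) \<in> U"
proof -
  obtain e where e: "e > 0" "\<And>y. y \<in> Esp m \<Longrightarrow> (\<And>i. i < m \<Longrightarrow> \<bar>y i - x i\<bar> < e) \<Longrightarrow> y \<in> U"
    using eopenE[OF assms(1,2)] by metis
  have "x \<in> Esp m" using assms eopen_subset by blast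
  then have "x(i := t) \<in> U" if "dist t (x i) < e" for t
    using that assms e(1) by (intro e(2) Esp_upd) (auto simp: dist_real_def)
  with e(1) show ?thesis unfolding eventually_nhds_metric by blast
qed

section \<open>Partial derivatives and functions of class C^k\<close>

definition has_pd :: "nat \<Rightarrow> ((nat \<Rightarrow> real) \<Rightarrow> real) \<Rightarrow> (nat \<Rightarrow> real) \<Rightarrow> real \<Rightarrow> bool" where
  "has_pd i f x D \<longleftrightarrow> ((\<lambda>t. f (x(i := t))) has_field_derivative D) (at (x i))"

lemma has_partial_iff: "has_partial i f x \<longleftrightarrow> has_pd i f x (partial i f x)"
  by (simp add: has_pd_def has_partial_def partial_def DERIV_deriv_iff_real_differentiable)

lemma has_pdD: "has_pd i f x D \<Longrightarrow> has_partial i f x \<and> partial i f x = D"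
  by (auto simp: has_pd_def has_partial_def partial_def DERIV_imp_deriv real_differentiable_def)

lemma has_pd_cong:
  assumes "eopen m U" "x \<in> U" "i < m" "\<And>y. y \<in> U \<Longrightarrow> f y = g y"
  shows "has_pd i f x D \<longleftrightarrow> has_pd i g x D"
  unfolding has_pd_def
  using eventually_line[OF assms(1-3)] assms(4)
  by (intro DERIV_cong_ev) (auto elim!: eventually_mono)

lemma Ck_on_imp_continuous: "Ck_on k n U f \<Longrightarrow> U \<subseteq> Esp n \<Longrightarrow> continuous_on U f"
  by (cases k) (auto simp: continuous_map_Esp)

lemma Ck_on_cong:
  assumes "eopen m U" "\<And>y. y \<in> U \<Longrightarrow> f y = g y"
  shows "Ck_on k m U f \<longleftrightarrow> Ck_on k m U g"
  using assms(2)
proof (induction k arbitrary: f g)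
  case 0
  then show ?case using eopen_subset[OF assms(1)]
    by (simp add: continuous_map_Esp cong: continuous_on_cong)
next
  case (Suc k)
  have *: "has_partial i f x \<longleftrightarrow> has_partial i g x" "partial i f x = partial i g x"
    if "x \<in> U" "i < m" for x i
  proof -
    have pc: "has_pd i f x D \<longleftrightarrow> has_pd i g x D" for D using has_pd_cong[OF assms(1) that Suc.prems] .
    then show "has_partial i f x \<longleftrightarrow> has_partial i g x"
      by (metis has_pdD has_partial_iff)
    show "partial i f x = partial i g x"
      using pc unfolding partial_def deriv_def has_pd_def by simp
  qed
  have "Ck_on k m U (partial i f) \<longleftrightarrow> Ck_on k m U (partial i g)" if "i < m" for i
    by (rule Suc.IH) (use * that in auto)
  moreover have "continuous_on U f \<longleftrightarrow> continuous_on U g"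
    using Suc.prems by (simp cong: continuous_on_cong)
  ultimately show ?case using * eopen_subset[OF assms(1)] by (auto simp: continuous_map_Esp)
qed

text \<open>Lets derivatives be given by formulas, so that the closure proofs below need not compute
  \<open>partial\<close> of a compound function.\<close>

lemma Ck_on_SucI:
  assumes "eopen m U" "continuous_on U f"
    and "\<And>i x. i < m \<Longrightarrow> x \<in> U \<Longrightarrow> has_pd i f x (D i x)"
    and "\<And>i. i < m \<Longrightarrow> Ck_on k m U (D i)"
  shows "Ck_on (Suc k) m U f"
proof -
  have "has_partial i f x" "partial i f x = D i x" if "i < m" "x \<in> U" for i x
    using assms(3) has_pdD that by blast+
  moreover from this have "Ck_on k m U (partial i f)" if "i < m" for i
    using assms(4)[OF that] Ck_on_cong[OF assms(1)] that by metis
  ultimately show ?thesis using assms eopen_subset[OF assms(1)] by (simp add: continuous_map_Esp)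
qed

lemma Ck_on_has_pd: "Ck_on (Suc k) m U f \<Longrightarrow> i < m \<Longrightarrow> x \<in> U \<Longrightarrow> has_pd i f x (partial i f x)"
  by (simp add: has_partial_iff)

lemma Ck_on_Suc_imp: "Ck_on (Suc k) m U f \<Longrightarrow> Ck_on k m U f"
proof (induction k arbitrary: f)
  case (Suc k)
  then show ?case by (auto simp del: Ck_on.simps(2) simp: Ck_on.simps(2)[of "Suc k"] Ck_on.simps(2)[of k])
qed auto

lemma Ck_on_subset:
  "Ck_on k m U f \<Longrightarrow> U \<subseteq> Esp m \<Longrightarrow> V \<subseteq> U \<Longrightarrow> Ck_on k m V f"
proof (induction k arbitrary: f)
  case 0
  then show ?case by (metis Ck_on.simps(1) continuous_map_Esp continuous_on_subset order_trans)
next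
  case (Suc k)
  then show ?case by (auto simp: continuous_map_Esp intro: continuous_on_subset)
qed

lemma continuous_on_local:
  fixes f :: "(nat \<Rightarrow> real) \<Rightarrow> real"
  assumes "eopen m U" "\<And>x. x \<in> U \<Longrightarrow> \<exists>V. nbhd m U x V \<and> continuous_on V f"
  shows "continuous_on U f"
proof -
  have "eopen m {x \<in> U. f x \<in> B}" if B: "open B" for B
  proof (subst openin_subopen, intro ballI)
    fix x assume "x \<in> {x \<in> U. f x \<in> B}"
    then obtain V where V: "eopen m V" "x \<in> V" "V \<subseteq> U" "continuous_on V f" "f x \<in> B"
      using assms(2) by blast
    then have "eopen m {x \<in> V. f x \<in> B}" using eopen_preimage B by blast
    with V show "\<exists>T. nbhd m {x \<in> U. f x \<in> B} x T" by blast
  qed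
  then have "continuous_map (subtopology (Euclidean_space m) U) euclideanreal f"
    using eopen_subset[OF assms(1)] assms(1)
    by (auto simp: continuous_map_def openin_open_subtopology Int_absorb1)
  then show ?thesis using eopen_subset[OF assms(1)] by (simp add: continuous_map_Esp)
qed

lemma Ck_on_local:
  assumes "eopen m U" "\<And>x. x \<in> U \<Longrightarrow> \<exists>V. nbhd m U x V \<and> Ck_on k m V f"
  shows "Ck_on k m U f"
  using assms(2)
proof (induction k arbitrary: f)
  case 0
  have "continuous_on U f"
    by (rule continuous_on_local[OF assms(1)]) (metis "0" Ck_on_imp_continuous eopen_subset)
  then show ?case using eopen_subset[OF assms(1)] by (simp add: continuous_map_Esp)
next
  case (Suc k)
  have "continuous_on U f"
    by (rule continuous_on_local[OF assms(1)]) (metis Suc.prems Ck_on_imp_continuous eopen_subset)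
  moreover have "has_partial i f x" if "i < m" "x \<in> U" for i x
    using Suc.prems that by fastforce
  moreover have "Ck_on k m U (partial i f)" if "i < m" for i
    by (rule Suc.IH) (use Suc.prems that in fastforce)
  ultimately show ?case using eopen_subset[OF assms(1)] by (simp add: continuous_map_Esp)
qed

lemma Ck_on_const: "eopen m U \<Longrightarrow> Ck_on k m U (\<lambda>x. c)"
proof (induction k arbitrary: c)
  case 0
  then show ?case by (simp add: continuous_map_Esp eopen_subset)
next
  case (Suc k)
  then show ?case by (intro Ck_on_SucI[where D = "\<lambda>i x. 0"]) (auto simp: has_pd_def)
qed

lemma Ck_on_coord: "eopen m U \<Longrightarrow> Ck_on k m U (\<lambda>x. x j)"
proof (cases k)
  case 0
  assume "eopen m U"
  then show ?thesis using 0 eopen_subset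
    by (simp add: continuous_map_Esp)
      (rule continuous_on_subset[OF continuous_on_product_coordinates subset_UNIV])
next
  case (Suc k')
  assume U: "eopen m U"
  show ?thesis unfolding Suc
  proof (rule Ck_on_SucI[where D = "\<lambda>i x. if i = j then 1 else 0"])
    show "continuous_on U (\<lambda>x. x j)"
      by (rule continuous_on_subset[OF continuous_on_product_coordinates subset_UNIV])
    show "has_pd i (\<lambda>x. x j) x (if i = j then 1 else 0)" for i x
      by (auto simp: has_pd_def)
  qed (use U Ck_on_const in auto)
qed

lemma Ck_on_add:
  assumes "eopen m U"
  shows "Ck_on k m U f \<Longrightarrow> Ck_on k m U g \<Longrightarrow> Ck_on k m U (\<lambda>x. f x + g x)"
proof (induction k arbitrary: f g)
  case 0
  then show ?case using eopen_subset[OF assms] by (simp add: continuous_map_Esp continuous_on_add)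
next
  case (Suc k)
  show ?case
  proof (rule Ck_on_SucI[OF assms, where D = "\<lambda>i x. partial i f x + partial i g x"])
    show "continuous_on U (\<lambda>x. f x + g x)"
      using Ck_on_imp_continuous[OF _ eopen_subset[OF assms]] Suc.prems by (intro continuous_on_add) blast+
    show "has_pd i (\<lambda>x. f x + g x) x (partial i f x + partial i g x)" if "i < m" "x \<in> U" for i x
      using Ck_on_has_pd[OF Suc.prems(1) that] Ck_on_has_pd[OF Suc.prems(2) that]
      unfolding has_pd_def by (rule DERIV_add)
    show "Ck_on k m U (\<lambda>x. partial i f x + partial i g x)" if "i < m" for i
      using Suc.prems that by (intro Suc.IH) auto
  qed
qed

lemma Ck_on_mult:
  assumes "eopen m U"
  shows "Ck_on k m U f \<Longrightarrow> Ck_on k m U g \<Longrightarrow> Ck_on k m U (\<lambda>x. f x * g x)"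
proof (induction k arbitrary: f g)
  case 0
  then show ?case using eopen_subset[OF assms] by (simp add: continuous_map_Esp continuous_on_mult)
next
  case (Suc k)
  show ?case
  proof (rule Ck_on_SucI[OF assms, where D = "\<lambda>i x. partial i f x * g x + partial i g x * f x"])
    show "continuous_on U (\<lambda>x. f x * g x)"
      using Ck_on_imp_continuous[OF _ eopen_subset[OF assms]] Suc.prems by (intro continuous_on_mult) blast+
    show "has_pd i (\<lambda>x. f x * g x) x (partial i f x * g x + partial i g x * f x)" if "i < m" "x \<in> U" for i x
      using DERIV_mult[OF Ck_on_has_pd[OF Suc.prems(1) that, unfolded has_pd_def]
          Ck_on_has_pd[OF Suc.prems(2) that, unfolded has_pd_def]]
      unfolding has_pd_def by simp
    show "Ck_on k m U (\<lambda>x. partial i f x * g x + partial i g x * f x)" if "i < m" for i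
    proof -
      have "Ck_on k m U (partial i f)" "Ck_on k m U (partial i g)" using Suc.prems that by auto
      moreover have "Ck_on k m U f" "Ck_on k m U g" using Suc.prems Ck_on_Suc_imp by blast+
      ultimately show ?thesis by (intro Ck_on_add[OF assms] Suc.IH)
    qed
  qed
qed

lemma Ck_on_sum:
  assumes "eopen m U" "finite A" "\<And>a. a \<in> A \<Longrightarrow> Ck_on k m U (f a)"
  shows "Ck_on k m U (\<lambda>x. \<Sum>a\<in>A. f a x)"
  using assms(2,3) by (induction A) (auto intro: Ck_on_add Ck_on_const assms(1))

text \<open>\<open>Ck_on\<close> speaks of derivatives along coordinate lines only, so the chain
  rule needs this total, indeed strict, differentiability. Pass from \<open>w\<close> to
  \<open>w'\<close> by changing one coordinate at a time and apply the mean value inequality on each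
  leg to \<open>g\<close> minus its linear part, whose derivative is at most \<open>e\<close> near
  \<open>y\<close>.\<close>

lemma C1_strict:
  fixes e :: real
  assumes W: "eopen n W" "y \<in> W"
    and G: "\<And>j x. j < n \<Longrightarrow> x \<in> W \<Longrightarrow> has_pd j g x (G j x)"
    and Gc: "\<And>j. j < n \<Longrightarrow> continuous_on W (G j)"
    and "e > 0"
  shows "\<exists>\<delta>>0. \<forall>w\<in>Esp n. \<forall>w'\<in>Esp n. (\<forall>i<n. \<bar>w i - y i\<bar> < \<delta> \<and> \<bar>w' i - y i\<bar> < \<delta>) \<longrightarrow>
     \<bar>g w' - g w - (\<Sum>j<n. G j y * (w' j - w j))\<bar> \<le> e * (\<Sum>j<n. \<bar>w' j - w j\<bar>)"
proof -
  define S where "S = {x \<in> W. \<forall>j<n. \<bar>G j x - G j y\<bar> < e}"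
  have "eopen n {x \<in> W. \<bar>G j x - G j y\<bar> < e}" if "j < n" for j
    using eopen_preimage[OF W(1) Gc[OF that], of "ball (G j y) e"]
    by (simp add: dist_real_def abs_minus_commute)
  then have "eopen n (W \<inter> (\<Inter>j\<in>{..<n}. {x \<in> W. \<bar>G j x - G j y\<bar> < e}))" if "n > 0"
    using W(1) that by (intro openin_Int openin_INT2) auto
  moreover have "S = W \<inter> (\<Inter>j\<in>{..<n}. {x \<in> W. \<bar>G j x - G j y\<bar> < e})" by (auto simp: S_def)
  moreover have "S = W" if "n = 0" using that by (auto simp: S_def)
  ultimately have "eopen n S" using W(1) by (cases "n = 0") auto
  moreover have "y \<in> S" using W assms(5) by (auto simp: S_def)
  ultimately obtain \<delta> where \<delta>: "\<delta> > 0"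
    "\<And>x. x \<in> Esp n \<Longrightarrow> (\<And>i. i < n \<Longrightarrow> \<bar>x i - y i\<bar> < \<delta>) \<Longrightarrow> x \<in> S"
    using eopenE by metis
  have "\<bar>g w' - g w - (\<Sum>j<n. G j y * (w' j - w j))\<bar> \<le> e * (\<Sum>j<n. \<bar>w' j - w j\<bar>)"
    if w: "w \<in> Esp n" "w' \<in> Esp n" "\<And>i. i < n \<Longrightarrow> \<bar>w i - y i\<bar> < \<delta>" "\<And>i. i < n \<Longrightarrow> \<bar>w' i - y i\<bar> < \<delta>"
    for w w'
  proof -
    \<comment> \<open>\<open>h k\<close> takes its first \<open>k\<close> coordinates from
      \<open>w'\<close> and the others from \<open>w\<close>; these corners and the legs between
      them stay in the cube around \<open>y\<close>.\<close>
    define h where "h k = (\<lambda>i. if i < k then w' i else w i)" for k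
    have h0: "h 0 = w" by (auto simp: h_def)
    have hn: "h n = w'" using w by (auto simp: h_def Esp_iff)
    have step: "\<bar>g (h (Suc k)) - g (h k) - G k y * (w' k - w k)\<bar> \<le> e * \<bar>w' k - w k\<bar>" if k: "k < n" for k
    proof -
      define \<phi> where "\<phi> t = g ((h k)(k := t)) - G k y * t" for t
      have inS: "(h k)(k := t) \<in> S" if "t \<in> ball (y k) \<delta>" for t
        using that w k by (intro \<delta>(2)) (auto simp: h_def Esp_iff dist_real_def abs_minus_commute)
      have "norm (\<phi> (w' k) - \<phi> (w k)) \<le> e * norm (w' k - w k)"
      proof (rule field_differentiable_bound[where S = "ball (y k) \<delta>" and f' = "\<lambda>t. G k ((h k)(k := t)) - G k y"])
        fix t assume t: "t \<in> ball (y k) \<delta>"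
        have "has_pd k g ((h k)(k := t)) (G k ((h k)(k := t)))"
          using inS[OF t] k by (intro G) (auto simp: S_def)
        then have "((\<lambda>t. g ((h k)(k := t))) has_field_derivative G k ((h k)(k := t))) (at t)"
          by (simp add: has_pd_def)
        then have "(\<phi> has_field_derivative G k ((h k)(k := t)) - G k y) (at t)"
          unfolding \<phi>_def by (auto intro!: derivative_eq_intros)
        then show "(\<phi> has_field_derivative G k ((h k)(k := t)) - G k y) (at t within ball (y k) \<delta>)"
          by (rule has_field_derivative_at_within)
        show "norm (G k ((h k)(k := t)) - G k y) \<le> e"
          using inS[OF t] k by (auto simp: S_def less_imp_le)
      qed (use w k in \<open>auto simp: dist_real_def abs_minus_commute\<close>)
      moreover have "(h k)(k := w' k) = h (Suc k)" "(h k)(k := w k) = h k"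
        by (auto simp: h_def fun_eq_iff)
      ultimately show ?thesis by (simp add: \<phi>_def algebra_simps)
    qed
    have "g w' - g w - (\<Sum>j<n. G j y * (w' j - w j))
        = (\<Sum>k<n. g (h (Suc k)) - g (h k) - G k y * (w' k - w k))"
      using sum_lessThan_telescope[of "\<lambda>k. g (h k)" n] by (simp add: sum_subtractf h0 hn)
    also have "\<bar>\<dots>\<bar> \<le> (\<Sum>k<n. e * \<bar>w' k - w k\<bar>)"
      by (rule order_trans[OF sum_abs]) (intro sum_mono step, auto)
    finally show ?thesis by (simp add: sum_distrib_left)
  qed
  with \<delta>(1) show ?thesis by blast
qed

text \<open>Along the coordinate line, \<open>g (f x)\<close> is split into its linearisation
  \<open>L\<close>, differentiated termwise, and a remainder \<open>R\<close>, whose derivative is 0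
  by \<open>C1_strict\<close>.\<close>

lemma has_pd_chain:
  assumes V: "eopen m V" "x \<in> V" "i < m"
    and W: "eopen n W" "\<And>x. x \<in> V \<Longrightarrow> f x \<in> W"
    and G: "\<And>j x. j < n \<Longrightarrow> x \<in> W \<Longrightarrow> has_pd j g x (G j x)"
    and Gc: "\<And>j. j < n \<Longrightarrow> continuous_on W (G j)"
    and F: "\<And>j. j < n \<Longrightarrow> has_pd i (\<lambda>x. f x j) x (F j)"
  shows "has_pd i (\<lambda>x. g (f x)) x (\<Sum>j<n. G j (f x) * F j)"
proof -
  let ?a = "x i"
  define \<gamma> where "\<gamma> t = f (x(i := t))" for t
  have \<gamma>a: "\<gamma> ?a = f x" by (simp add: \<gamma>_def)
  \<comment> \<open>Near \<open>?a\<close> the change of component \<open>j\<close> of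
    \<open>\<gamma>\<close> is at most \<open>\<bar>F j\<bar> + 1\<close> times the change of
    \<open>t\<close>. \<open>C\<close> exceeds the sum of these factors by 1, which makes it
    positive also for \<open>n = 0\<close>.\<close>
  define C where "C = (\<Sum>j<n. \<bar>F j\<bar> + 1) + 1"
  have C: "C > 0" unfolding C_def by (simp add: add.commute add_pos_nonneg sum_nonneg)
  have D: "((\<lambda>t. \<gamma> t j) has_field_derivative F j) (at ?a)" if "j < n" for j
    using F[OF that] by (simp add: has_pd_def \<gamma>_def)
  define L where "L t = (\<Sum>j<n. G j (f x) * \<gamma> t j)" for t
  have DL: "(L has_field_derivative (\<Sum>j<n. G j (f x) * F j)) (at ?a)"
    unfolding L_def by (rule DERIV_sum) (auto intro!: derivative_eq_intros D)
  define R where "R t = g (\<gamma> t) - L t" for t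
  have "(R has_field_derivative 0) (at ?a)"
    unfolding has_field_derivative_def has_derivative_at_alt
  proof (intro conjI allI impI)
    fix e :: real assume e: "e > 0"
    have "\<exists>\<delta>>0. \<forall>w\<in>Esp n. \<forall>w'\<in>Esp n. (\<forall>i<n. \<bar>w i - f x i\<bar> < \<delta> \<and> \<bar>w' i - f x i\<bar> < \<delta>) \<longrightarrow>
     \<bar>g w' - g w - (\<Sum>j<n. G j (f x) * (w' j - w j))\<bar> \<le> e / C * (\<Sum>j<n. \<bar>w' j - w j\<bar>)"
      by (rule C1_strict[OF W(1) W(2)[OF V(2)] G Gc]) (use e C in auto)
    then obtain \<delta> where \<delta>: "\<delta> > 0" "\<forall>w\<in>Esp n. \<forall>w'\<in>Esp n. (\<forall>i<n. \<bar>w i - f x i\<bar> < \<delta> \<and> \<bar>w' i - f x i\<bar> < \<delta>) \<longrightarrow>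
     \<bar>g w' - g w - (\<Sum>j<n. G j (f x) * (w' j - w j))\<bar> \<le> e / C * (\<Sum>j<n. \<bar>w' j - w j\<bar>)" by blast
    have ev1: "\<forall>\<^sub>F t in nhds ?a. \<gamma> t \<in> Esp n"
      using eventually_line[OF V] by (rule eventually_mono) (use W eopen_subset in \<open>auto simp: \<gamma>_def\<close>)
    have ev2: "\<forall>\<^sub>F t in nhds ?a. \<forall>j<n. \<bar>\<gamma> t j - f x j\<bar> < \<delta>"
    proof -
      have "\<forall>\<^sub>F t in nhds ?a. \<bar>\<gamma> t j - f x j\<bar> < \<delta>" if "j < n" for j
      proof -
        have "isCont (\<lambda>t. \<gamma> t j) ?a" using D[OF that] DERIV_isCont by blast
        then have "((\<lambda>t. \<gamma> t j) \<longlongrightarrow> \<gamma> ?a j) (nhds ?a)"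
          unfolding isCont_def by (rule iffD1[OF tendsto_at_iff_tendsto_nhds[of "\<lambda>t. \<gamma> t j"]])
        from tendstoD[OF this \<delta>(1)] show ?thesis by (simp add: dist_real_def \<gamma>a)
      qed
      then have "\<forall>\<^sub>F t in nhds ?a. \<forall>j\<in>{..<n}. \<bar>\<gamma> t j - f x j\<bar> < \<delta>"
        by (subst eventually_ball_finite_distrib) auto
      then show ?thesis by (simp add: Ball_def)
    qed
    have ev3: "\<forall>\<^sub>F t in nhds ?a. \<forall>j<n. \<bar>\<gamma> t j - f x j\<bar> \<le> (\<bar>F j\<bar> + 1) * \<bar>t - ?a\<bar>"
    proof -
      have "\<forall>\<^sub>F t in nhds ?a. \<bar>\<gamma> t j - f x j\<bar> \<le> (\<bar>F j\<bar> + 1) * \<bar>t - ?a\<bar>" if "j < n" for j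
      proof -
        have "\<forall>e>0. \<exists>d>0. \<forall>y. \<bar>y - ?a\<bar> < d \<longrightarrow> \<bar>\<gamma> y j - \<gamma> ?a j - F j * (y - ?a)\<bar> \<le> e * \<bar>y - ?a\<bar>"
          using D[OF that] unfolding has_field_derivative_def has_derivative_at_alt by simp
        then obtain d where d: "d > 0" "\<And>y. \<bar>y - ?a\<bar> < d \<Longrightarrow> \<bar>\<gamma> y j - \<gamma> ?a j - F j * (y - ?a)\<bar> \<le> 1 * \<bar>y - ?a\<bar>"
          by (meson zero_less_one)
        have "\<bar>\<gamma> t j - f x j\<bar> \<le> (\<bar>F j\<bar> + 1) * \<bar>t - ?a\<bar>" if "dist t ?a < d" for t
        proof -
          have "\<bar>\<gamma> t j - f x j\<bar> \<le> \<bar>F j * (t - ?a)\<bar> + 1 * \<bar>t - ?a\<bar>"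
            using d(2)[of t] that \<gamma>a by (simp add: dist_real_def)
          then show ?thesis by (simp add: abs_mult distrib_right)
        qed
        with d(1) show ?thesis unfolding eventually_nhds_metric by blast
      qed
      then have "\<forall>\<^sub>F t in nhds ?a. \<forall>j\<in>{..<n}. \<bar>\<gamma> t j - f x j\<bar> \<le> (\<bar>F j\<bar> + 1) * \<bar>t - ?a\<bar>"
        by (subst eventually_ball_finite_distrib) auto
      then show ?thesis by (simp add: Ball_def)
    qed
    have "\<forall>\<^sub>F t in nhds ?a. \<bar>R t - R ?a\<bar> \<le> e * \<bar>t - ?a\<bar>"
      using ev1 ev2 ev3
    proof eventually_elim
      case (elim t)
      have R: "R t - R ?a = g (\<gamma> t) - g (f x) - (\<Sum>j<n. G j (f x) * (\<gamma> t j - f x j))"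
        by (simp add: R_def L_def \<gamma>a sum_subtractf right_diff_distrib)
      have "f x \<in> Esp n" using W(2)[OF V(2)] eopen_subset[OF W(1)] by blast
      moreover have "\<forall>i<n. \<bar>f x i - f x i\<bar> < \<delta> \<and> \<bar>\<gamma> t i - f x i\<bar> < \<delta>"
        using elim(2) \<delta>(1) by simp
      ultimately have "\<bar>R t - R ?a\<bar> \<le> e / C * (\<Sum>j<n. \<bar>\<gamma> t j - f x j\<bar>)"
        using \<delta>(2)[THEN bspec[of _ _ "f x"], THEN bspec[of _ _ "\<gamma> t"]] elim(1) unfolding R by blast
      also have "\<dots> \<le> e / C * (\<Sum>j<n. (\<bar>F j\<bar> + 1) * \<bar>t - ?a\<bar>)"
        using e C elim by (intro mult_left_mono sum_mono) auto
      also have "\<dots> = e / C * ((C - 1) * \<bar>t - ?a\<bar>)" by (simp add: C_def sum_distrib_right)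
      also have "\<dots> \<le> e / C * (C * \<bar>t - ?a\<bar>)"
        using e C by (intro mult_left_mono mult_right_mono) auto
      also have "\<dots> = e * \<bar>t - ?a\<bar>" using C by simp
      finally show ?case .
    qed
    then show "\<exists>d>0. \<forall>y. norm (y - x i) < d \<longrightarrow> norm (R y - R (x i) - 0 * (y - x i)) \<le> e * norm (y - x i)"
      unfolding eventually_nhds_metric by (simp add: dist_real_def)
  qed (rule bounded_linear_mult_right)
  from DERIV_add[OF this DL] show ?thesis by (simp add: has_pd_def R_def \<gamma>_def)
qed

lemma continuous_on_into_Esp:
  assumes "\<And>x. x \<in> V \<Longrightarrow> f x \<in> Esp n" "\<And>j. j < n \<Longrightarrow> continuous_on V (\<lambda>x. f x j)"
  shows "continuous_on V f"
proof (rule continuous_on_coordinatewise_then_product)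
  fix i show "continuous_on V (\<lambda>x. f x i)"
  proof (cases "i < n")
    case False
    have "f x i = 0" if "x \<in> V" for x
      using assms(1)[OF that] False by (simp add: Esp_iff)
    then have "continuous_on V (\<lambda>x. f x i) \<longleftrightarrow> continuous_on V (\<lambda>x. 0::real)"
      by (intro continuous_on_cong) auto
    then show ?thesis by simp
  qed (rule assms(2))
qed

lemma continuous_on_Esp_comp:
  assumes fW: "\<And>x. x \<in> V \<Longrightarrow> f x \<in> W" "W \<subseteq> Esp n" and g: "continuous_on W g"
    and f: "\<And>j. j < n \<Longrightarrow> continuous_on V (\<lambda>x. f x j)"
  shows "continuous_on V (\<lambda>x. g (f x))"
proof -
  have "continuous_on V f"
    by (rule continuous_on_into_Esp[OF subsetD[OF fW(2) fW(1)] f])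
  then show ?thesis by (rule continuous_on_compose2[OF g]) (use fW(1) in blast)
qed

lemma Ck_on_comp:
  assumes "eopen m V" "eopen n W" "\<And>x. x \<in> V \<Longrightarrow> f x \<in> W"
  shows "Ck_on k n W g \<Longrightarrow> (\<And>j. j < n \<Longrightarrow> Ck_on k m V (\<lambda>x. f x j)) \<Longrightarrow> Ck_on k m V (\<lambda>x. g (f x))"
proof (induction k arbitrary: g)
  case 0
  have "continuous_on V (\<lambda>x. g (f x))"
    by (rule continuous_on_Esp_comp[OF assms(3) eopen_subset[OF assms(2)]
      Ck_on_imp_continuous[OF 0(1) eopen_subset[OF assms(2)]]
      Ck_on_imp_continuous[OF 0(2) eopen_subset[OF assms(1)]]])
  then show ?case using assms eopen_subset by (simp add: continuous_map_Esp)
next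
  case (Suc k)
  show ?case
  proof (rule Ck_on_SucI[OF assms(1), where D = "\<lambda>i x. \<Sum>j<n. partial j g (f x) * partial i (\<lambda>x. f x j) x"])
    show "continuous_on V (\<lambda>x. g (f x))"
      by (rule continuous_on_Esp_comp[OF assms(3) eopen_subset[OF assms(2)]
        Ck_on_imp_continuous[OF Suc.prems(1) eopen_subset[OF assms(2)]]
        Ck_on_imp_continuous[OF Suc.prems(2) eopen_subset[OF assms(1)]]])
    show "has_pd i (\<lambda>x. g (f x)) x (\<Sum>j<n. partial j g (f x) * partial i (\<lambda>x. f x j) x)" if "i < m" "x \<in> V" for i x
    proof (rule has_pd_chain[OF assms(1) that(2,1) assms(2,3)])
      show "has_pd j g x (partial j g x)" if "j < n" "x \<in> W" for j x using Ck_on_has_pd[OF Suc.prems(1)] that .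
      show "continuous_on W (partial j g)" if "j < n" for j
        using Suc.prems(1) that by (intro Ck_on_imp_continuous[OF _ eopen_subset[OF assms(2)], of k]) simp
      show "has_pd i (\<lambda>x. f x j) x (partial i (\<lambda>x. f x j) x)" if "j < n" for j
        by (rule Ck_on_has_pd[OF Suc.prems(2)[OF that] \<open>i < m\<close> \<open>x \<in> V\<close>])
    qed
    show "Ck_on k m V (\<lambda>x. \<Sum>j<n. partial j g (f x) * partial i (\<lambda>x. f x j) x)" if i: "i < m" for i
    proof (intro Ck_on_sum[OF assms(1)] Ck_on_mult[OF assms(1)])
      fix j assume "j \<in> {..<n}"
      then have j: "j < n" by simp
      show "Ck_on k m V (\<lambda>x. partial j g (f x))"
      proof (rule Suc.IH)
        show "Ck_on k n W (partial j g)" using Suc.prems(1) j by simp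
        show "Ck_on k m V (\<lambda>x. f x i)" if "i < n" for i
          by (rule Ck_on_Suc_imp[OF Suc.prems(2)[OF that]])
      qed
      show "Ck_on k m V (partial i (\<lambda>x. f x j))" using Suc.prems(2)[OF j] i by simp
    qed simp
  qed
qed

section \<open>Closure properties of smooth functions\<close>

definition smooth_on :: "nat \<Rightarrow> (nat \<Rightarrow> real) set \<Rightarrow> ((nat \<Rightarrow> real) \<Rightarrow> real) \<Rightarrow> bool" where
  "smooth_on m U f \<longleftrightarrow> (\<forall>k. Ck_on k m U f)"

lemma smooth_map_iff: "smooth_map m V n U f \<longleftrightarrow> f \<in> V \<rightarrow> U \<and> (\<forall>j<n. smooth_on m V (\<lambda>x. f x j))"
  by (simp add: smooth_map_def smooth_on_def)

lemma smooth_on_const: "eopen m U \<Longrightarrow> smooth_on m U (\<lambda>x. c)"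
  by (simp add: smooth_on_def Ck_on_const)

lemma smooth_on_coord: "eopen m U \<Longrightarrow> smooth_on m U (\<lambda>x. x j)"
  by (simp add: smooth_on_def Ck_on_coord)

lemma smooth_on_add: "eopen m U \<Longrightarrow> smooth_on m U f \<Longrightarrow> smooth_on m U g \<Longrightarrow> smooth_on m U (\<lambda>x. f x + g x)"
  by (simp add: smooth_on_def Ck_on_add)

lemma smooth_on_mult: "eopen m U \<Longrightarrow> smooth_on m U f \<Longrightarrow> smooth_on m U g \<Longrightarrow> smooth_on m U (\<lambda>x. f x * g x)"
  by (simp add: smooth_on_def Ck_on_mult)

lemma smooth_on_diff: "eopen m U \<Longrightarrow> smooth_on m U f \<Longrightarrow> smooth_on m U g \<Longrightarrow> smooth_on m U (\<lambda>x. f x - g x)"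
  using smooth_on_add[OF _ _ smooth_on_mult[OF _ smooth_on_const[of _ _ "-1"]], of m U f g] by simp

lemma smooth_on_sum:
  "eopen m U \<Longrightarrow> finite A \<Longrightarrow> (\<And>a. a \<in> A \<Longrightarrow> smooth_on m U (f a)) \<Longrightarrow> smooth_on m U (\<lambda>x. \<Sum>a\<in>A. f a x)"
  by (simp add: smooth_on_def Ck_on_sum)

lemma smooth_on_prod:
  assumes "eopen m U" "finite A" "\<And>a. a \<in> A \<Longrightarrow> smooth_on m U (f a)"
  shows "smooth_on m U (\<lambda>x. \<Prod>a\<in>A. f a x)"
  using assms(2,3) by (induction A) (auto intro: smooth_on_mult smooth_on_const assms(1))

lemma smooth_on_power: "eopen m U \<Longrightarrow> smooth_on m U f \<Longrightarrow> smooth_on m U (\<lambda>x. f x ^ n)"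
  by (induction n) (auto intro: smooth_on_mult smooth_on_const)

lemma smooth_on_comp:
  assumes "eopen m V" "eopen n W" "\<And>x. x \<in> V \<Longrightarrow> f x \<in> W"
    and "smooth_on n W g" "\<And>j. j < n \<Longrightarrow> smooth_on m V (\<lambda>x. f x j)"
  shows "smooth_on m V (\<lambda>x. g (f x))"
  unfolding smooth_on_def
proof
  fix k show "Ck_on k m V (\<lambda>x. g (f x))"
    by (rule Ck_on_comp[OF assms(1-3)]) (use assms(4,5) in \<open>simp_all add: smooth_on_def\<close>)
qed

lemma smooth_on_cong:
  "eopen m U \<Longrightarrow> (\<And>y. y \<in> U \<Longrightarrow> f y = g y) \<Longrightarrow> smooth_on m U f \<longleftrightarrow> smooth_on m U g"
  unfolding smooth_on_def using Ck_on_cong by blast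

lemma smooth_on_subset: "smooth_on m U f \<Longrightarrow> eopen m U \<Longrightarrow> V \<subseteq> U \<Longrightarrow> smooth_on m V f"
  unfolding smooth_on_def using Ck_on_subset eopen_subset by blast

lemma smooth_on_local:
  assumes "eopen m U" "\<And>x. x \<in> U \<Longrightarrow> \<exists>V. nbhd m U x V \<and> smooth_on m V f"
  shows "smooth_on m U f"
  unfolding smooth_on_def
proof
  fix k show "Ck_on k m U f"
    by (rule Ck_on_local[OF assms(1)]) (use assms(2) in \<open>fastforce simp: smooth_on_def\<close>)
qed

lemma smooth_on_continuous: "smooth_on m U f \<Longrightarrow> eopen m U \<Longrightarrow> continuous_on U f"
  unfolding smooth_on_def using Ck_on_imp_continuous eopen_subset by blast

lemma Ck_on_inverse:
  assumes U: "eopen m U" and nz: "\<And>x. x \<in> U \<Longrightarrow> f x \<noteq> 0"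
  shows "Ck_on k m U f \<Longrightarrow> Ck_on k m U (\<lambda>x. inverse (f x))"
proof (induction k)
  case 0
  then show ?case using eopen_subset[OF U] nz by (simp add: continuous_map_Esp continuous_on_inverse)
next
  case (Suc k)
  have k: "Ck_on k m U f" by (rule Ck_on_Suc_imp[OF Suc.prems])
  show ?case
  proof (rule Ck_on_SucI[OF U, where D = "\<lambda>i x. (- 1) * (partial i f x * (inverse (f x) * inverse (f x)))"])
    show "continuous_on U (\<lambda>x. inverse (f x))"
      using Ck_on_imp_continuous[OF Suc.prems eopen_subset[OF U]] nz by (simp add: continuous_on_inverse)
    show "has_pd i (\<lambda>x. inverse (f x)) x ((- 1) * (partial i f x * (inverse (f x) * inverse (f x))))"
      if "i < m" "x \<in> U" for i x
      using DERIV_inverse_fun[OF Ck_on_has_pd[OF Suc.prems that, unfolded has_pd_def]] nz[OF that(2)]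
      unfolding has_pd_def by (simp add: algebra_simps power2_eq_square)
    show "Ck_on k m U (\<lambda>x. (- 1) * (partial i f x * (inverse (f x) * inverse (f x))))" if "i < m" for i
    proof (intro Ck_on_mult[OF U] Ck_on_const[OF U] Suc.IH k)
      show "Ck_on k m U (partial i f)" using Suc.prems that by simp
    qed
  qed
qed

lemma smooth_on_divide:
  assumes "eopen m U" "smooth_on m U f" "smooth_on m U g" "\<And>x. x \<in> U \<Longrightarrow> g x \<noteq> 0"
  shows "smooth_on m U (\<lambda>x. f x / g x)"
proof -
  have "smooth_on m U (\<lambda>x. inverse (g x))"
    using assms(3) Ck_on_inverse[OF assms(1,4)] by (simp add: smooth_on_def)
  from smooth_on_mult[OF assms(1,2) this] show ?thesis by (simp add: divide_inverse)
qed

section \<open>Cut-off functions\<close>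

text \<open>The powers of \<open>1/t\<close> are included to close the family under differentiation:
  the derivative of member \<open>n\<close> is a combination of members \<open>n + 1\<close> and
  \<open>n + 2\<close>. Hence \<open>Ck_on_bump_term\<close> can go by induction on \<open>k\<close>
  with \<open>n\<close> arbitrary.\<close>

definition bump_term :: "nat \<Rightarrow> real \<Rightarrow> real" where
  "bump_term n t = (if t > 0 then (1/t) ^ n * exp (- (1/t)) else 0)"

lemma bump_term_tendsto_0: "bump_term n \<midarrow>0\<rightarrow> 0"
proof -
  have "((\<lambda>x::real. x ^ n / exp x) \<longlongrightarrow> 0) at_top" by (rule tendsto_power_div_exp_0)
  moreover have "filterlim (\<lambda>t::real. inverse t) at_top (at_right 0)" by (rule filterlim_inverse_at_top_right)
  ultimately have "((\<lambda>t::real. inverse t ^ n / exp (inverse t)) \<longlongrightarrow> 0) (at_right 0)"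
    by (rule filterlim_compose)
  then have r: "(bump_term n \<longlongrightarrow> 0) (at_right 0)"
    by (rule Lim_transform_eventually)
      (auto simp: eventually_at_filter bump_term_def exp_minus divide_inverse)
  have l: "(bump_term n \<longlongrightarrow> 0) (at_left 0)"
    by (rule Lim_transform_eventually[OF tendsto_const]) (auto simp: eventually_at_filter bump_term_def)
  show ?thesis using l r by (simp add: filterlim_at_split)
qed

text \<open>The critical point is 0. There the difference quotient of member \<open>n\<close> is
  exactly member \<open>n + 1\<close>, which tends to 0.\<close>

lemma DERIV_bump_term: "(bump_term n has_field_derivative (- real n * bump_term (Suc n) t + bump_term (Suc (Suc n)) t)) (at t)"
proof (cases t "0::real" rule: linorder_cases)
  case less
  have "\<forall>\<^sub>F s in nhds t. (0::real) = bump_term n s"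
    using eventually_nhds_in_open[of "{..<0}" t] less by (auto simp: bump_term_def elim!: eventually_mono)
  moreover have "((\<lambda>s. 0) has_field_derivative 0) (at t)" by simp
  ultimately have "(bump_term n has_field_derivative 0) (at t)"
    using DERIV_cong_ev[OF refl, of "\<lambda>s. 0" "bump_term n" t 0 0] by simp
  then show ?thesis using less by (simp add: bump_term_def)
next
  case equal
  have "(\<lambda>h. (bump_term n (0 + h) - bump_term n 0) / h) = bump_term (Suc n)"
    by (auto simp: bump_term_def fun_eq_iff)
  then have "(bump_term n has_field_derivative 0) (at 0)"
    using bump_term_tendsto_0[of "Suc n"] by (simp add: DERIV_def)
  then show ?thesis using equal by (simp add: bump_term_def)
next
  case greater
  have "\<forall>\<^sub>F s in nhds t. (1/s) ^ n * exp (- (1/s)) = bump_term n s"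
    using eventually_nhds_in_open[of "{0<..}" t] greater by (auto simp: bump_term_def elim!: eventually_mono)
  moreover have "((\<lambda>s. (1/s) ^ n * exp (- (1/s))) has_field_derivative
      (- real n * bump_term (Suc n) t + bump_term (Suc (Suc n)) t)) (at t)"
  proof -
    have d: "((\<lambda>s. 1/s) has_field_derivative - (1 / t\<^sup>2)) (at t)"
      using greater by (auto intro!: derivative_eq_intros simp: power2_eq_square)
    have e: "((\<lambda>s. exp (- (1/s))) has_field_derivative exp (- (1/t)) * (1 / t\<^sup>2)) (at t)"
      using greater by (auto intro!: derivative_eq_intros simp: power2_eq_square)
    have "real n * (- (1 / t\<^sup>2) * (1/t) ^ (n - Suc 0)) * exp (- (1/t)) + exp (- (1/t)) * (1 / t\<^sup>2) * (1/t) ^ n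
       = - real n * bump_term (Suc n) t + bump_term (Suc (Suc n)) t"
      using greater by (cases n) (auto simp: bump_term_def field_simps power2_eq_square)
    with DERIV_mult[OF DERIV_power[OF d, of n] e] show ?thesis by simp
  qed
  ultimately show ?thesis
    using DERIV_cong_ev[OF refl, of "\<lambda>s. (1/s) ^ n * exp (- (1/s))" "bump_term n" t _ _] by simp
qed

lemma Ck_on_bump_term:
  assumes U: "eopen m U"
  shows "Ck_on k m U f \<Longrightarrow> Ck_on k m U (\<lambda>x. bump_term n (f x))"
proof (induction k arbitrary: n)
  have c: "continuous_on U (\<lambda>x. bump_term n (f x))" if "continuous_on U f" for n
    by (rule continuous_on_compose2[OF _ that, of UNIV])
      (auto intro!: DERIV_continuous_on DERIV_bump_term)
  {
    case 0
    then show ?case using eopen_subset[OF U] c by (simp add: continuous_map_Esp)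
  next
    case (Suc k)
    have k: "Ck_on k m U f" by (rule Ck_on_Suc_imp[OF Suc.prems])
    show ?case
    proof (rule Ck_on_SucI[OF U, where D = "\<lambda>i x. (- real n * bump_term (Suc n) (f x) + bump_term (Suc (Suc n)) (f x)) * partial i f x"])
      show "continuous_on U (\<lambda>x. bump_term n (f x))"
        by (rule c[OF Ck_on_imp_continuous[OF Suc.prems eopen_subset[OF U]]])
      show "has_pd i (\<lambda>x. bump_term n (f x)) x ((- real n * bump_term (Suc n) (f x) + bump_term (Suc (Suc n)) (f x)) * partial i f x)"
        if "i < m" "x \<in> U" for i x
        using DERIV_chain2[of "bump_term n", OF DERIV_bump_term Ck_on_has_pd[OF Suc.prems that, unfolded has_pd_def]]
        unfolding has_pd_def by simp
      show "Ck_on k m U (\<lambda>x. (- real n * bump_term (Suc n) (f x) + bump_term (Suc (Suc n)) (f x)) * partial i f x)" if "i < m" for i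
      proof (intro Ck_on_mult[OF U] Ck_on_add[OF U] Ck_on_const[OF U] Suc.IH k)
        show "Ck_on k m U (partial i f)" using Suc.prems that by simp
      qed
    qed
  }
qed

definition bump :: "real \<Rightarrow> real" where "bump = bump_term 0"

lemma smooth_on_bump: "eopen m U \<Longrightarrow> smooth_on m U f \<Longrightarrow> smooth_on m U (\<lambda>x. bump (f x))"
  by (simp add: smooth_on_def bump_def Ck_on_bump_term)

lemma bump_pos [simp]: "0 < bump t \<longleftrightarrow> 0 < t"
  by (simp add: bump_def bump_term_def)

lemma bump_eq_0 [simp]: "bump t = 0 \<longleftrightarrow> t \<le> 0"
  by (simp add: bump_def bump_term_def)

lemma bump_nonneg [simp]: "0 \<le> bump t"
  by (simp add: bump_def bump_term_def)

lemma bump_mono: "s \<le> t \<Longrightarrow> bump s \<le> bump t"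
  by (auto simp: bump_def bump_term_def field_simps)

lemma eopen_preimage_Esp:
  assumes V: "eopen m V" and f: "\<And>v. v \<in> V \<Longrightarrow> f v \<in> Esp n"
    and c: "\<And>j. j < n \<Longrightarrow> continuous_on V (\<lambda>v. f v j)" and S: "eopen n S"
  shows "eopen m {v \<in> V. f v \<in> S}"
proof -
  obtain B where B: "open B" "S = Esp n \<inter> B" using S unfolding eopen_open by blast
  have "continuous_on V f" by (rule continuous_on_into_Esp[OF f c])
  from eopen_preimage[OF V this B(1)] have "eopen m {v \<in> V. f v \<in> B}" .
  moreover have "{v \<in> V. f v \<in> B} = {v \<in> V. f v \<in> S}" using f B(2) by blast
  ultimately show ?thesis by simp
qed

section \<open>Smooth maps into a manifold\<close>

context smooth_manifold
begin

abbreviation "\<N> \<equiv> manifold_diffeology d T \<A>"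

abbreviation near_chart :: "nat \<Rightarrow> (nat \<Rightarrow> real) set \<Rightarrow> (nat \<Rightarrow> real) \<Rightarrow> ((nat \<Rightarrow> real) \<Rightarrow> 'b) \<Rightarrow> bool" where
  "near_chart m V v p \<equiv> \<exists>W \<phi> V0. (W, \<phi>) \<in> \<A> \<and> nbhd m V v V0 \<and> p ` V0 \<subseteq> W \<and>
     (\<forall>j<d. smooth_on m V0 (\<lambda>v. \<phi> (p v) j))"

text \<open>Membership in the diffeology in terms of one suitable chart around each point.\<close>

definition mplot :: "nat \<Rightarrow> (nat \<Rightarrow> real) set \<Rightarrow> ((nat \<Rightarrow> real) \<Rightarrow> 'b) \<Rightarrow> bool" where
  "mplot m V p \<longleftrightarrow> (\<forall>v\<in>V. near_chart m V v p)"

lemma chart_subset: "(W, \<phi>) \<in> \<A> \<Longrightarrow> W \<subseteq> topspace T"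
  using chart_domain openin_subset by blast

lemma chart_inj: "(W, \<phi>) \<in> \<A> \<Longrightarrow> inj_on \<phi> W"
  using homeomorphic_imp_injective_map[OF chart_homeo] chart_subset
  by (simp add: Int_absorb1)

lemma chart_Esp: "(W, \<phi>) \<in> \<A> \<Longrightarrow> b \<in> W \<Longrightarrow> \<phi> b \<in> Esp d"
  using eopen_subset[OF chart_image] by blast

lemma chart_open_image:
  assumes "(W, \<phi>) \<in> \<A>" "openin T S" "S \<subseteq> W"
  shows "eopen d (\<phi> ` S)"
proof -
  have "openin (subtopology T W) S"
    using assms chart_domain by (simp add: openin_open_subtopology)
  then have "openin (subtopology (Euclidean_space d) (\<phi> ` W)) (\<phi> ` S)"
    using homeomorphic_imp_open_map[OF chart_homeo[OF assms(1)]] by (simp add: open_map_def)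
  then show ?thesis using chart_image[OF assms(1)] openin_trans_full by blast
qed

lemma chart_open_preimage:
  assumes "(W, \<phi>) \<in> \<A>" "eopen d S"
  shows "openin T {b \<in> W. \<phi> b \<in> S}"
proof -
  have "openin (subtopology (Euclidean_space d) (\<phi> ` W)) (\<phi> ` W \<inter> S)"
    using assms chart_image by (simp add: openin_open_subtopology openin_Int)
  then have "openin (subtopology T W) {x \<in> topspace (subtopology T W). \<phi> x \<in> \<phi> ` W \<inter> S}"
    by (rule openin_continuous_map_preimage[OF homeomorphic_imp_continuous_map[OF chart_homeo[OF assms(1)]]])
  moreover have "{x \<in> topspace (subtopology T W). \<phi> x \<in> \<phi> ` W \<inter> S} = {b \<in> W. \<phi> b \<in> S}"
    using chart_subset[OF assms(1)] by auto
  ultimately show ?thesis using chart_domain[OF assms(1)] openin_trans_full by metis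
qed

lemma mplot_topspace: "mplot m V p \<Longrightarrow> v \<in> V \<Longrightarrow> p v \<in> topspace T"
  unfolding mplot_def using chart_subset by blast

lemma mplot_open_preimage:
  assumes p: "mplot m V p" and S: "openin T S"
  shows "eopen m {v \<in> V. p v \<in> S}"
proof (subst openin_subopen, intro ballI)
  fix v assume "v \<in> {v \<in> V. p v \<in> S}"
  then have v: "v \<in> V" "p v \<in> S" by auto
  obtain W \<phi> V0 where W: "(W, \<phi>) \<in> \<A>" "eopen m V0" "v \<in> V0" "V0 \<subseteq> V" "\<And>u. u \<in> V0 \<Longrightarrow> p u \<in> W"
     "\<And>j. j < d \<Longrightarrow> smooth_on m V0 (\<lambda>v. \<phi> (p v) j)"
    using p v(1) unfolding mplot_def image_subset_iff by meson
  have "openin T (S \<inter> W)" using S chart_domain[OF W(1)] by (rule openin_Int)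
  then have O: "eopen d (\<phi> ` (S \<inter> W))" by (rule chart_open_image[OF W(1)]) simp
  have "eopen m {u \<in> V0. \<phi> (p u) \<in> \<phi> ` (S \<inter> W)}"
    by (rule eopen_preimage_Esp[OF W(2) _ _ O])
      (simp_all add: W(5) chart_Esp[OF W(1)] smooth_on_continuous[OF W(6) W(2)])
  moreover have "{u \<in> V0. \<phi> (p u) \<in> \<phi> ` (S \<inter> W)} \<subseteq> {v \<in> V. p v \<in> S}"
    using W(4,5) inj_on_image_mem_iff[OF chart_inj[OF W(1)]] by blast
  moreover have "v \<in> {u \<in> V0. \<phi> (p u) \<in> \<phi> ` (S \<inter> W)}" using W(3,5) v by auto
  ultimately show "\<exists>U. nbhd m {v \<in> V. p v \<in> S} v U" by blast
qed

text \<open>Near each point the chart supplied by \<open>mplot\<close> is exchanged for the given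
  one by a transition map.\<close>

lemma mplot_chart:
  assumes p: "mplot m V p" and V': "eopen m V'" "V' \<subseteq> V" and W': "(W', \<psi>) \<in> \<A>" "\<And>v. v \<in> V' \<Longrightarrow> p v \<in> W'"
    and j: "j < d"
  shows "smooth_on m V' (\<lambda>v. \<psi> (p v) j)"
proof (rule smooth_on_local[OF V'(1)])
  fix v assume v: "v \<in> V'"
  then have "v \<in> V" using V' by blast
  obtain W \<phi> V0 where W: "(W, \<phi>) \<in> \<A>" "eopen m V0" "v \<in> V0" "V0 \<subseteq> V" "\<And>u. u \<in> V0 \<Longrightarrow> p u \<in> W"
     "\<And>j. j < d \<Longrightarrow> smooth_on m V0 (\<lambda>v. \<phi> (p v) j)"
    using p \<open>v \<in> V\<close> unfolding mplot_def image_subset_iff by meson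
  have op: "eopen m (V0 \<inter> V')" using W(2) V'(1) by (rule openin_Int)
  have O: "eopen d (\<phi> ` (W \<inter> W'))"
    by (rule chart_open_image[OF W(1)]) (auto intro: openin_Int chart_domain W(1) W'(1))
  have "smooth_on d (\<phi> ` (W \<inter> W')) (\<lambda>x. \<psi> (inv_into W \<phi> x) j)"
    using transition_smooth[OF W(1) W'(1)] j by (simp add: smooth_map_iff)
  then have "smooth_on m (V0 \<inter> V') (\<lambda>v. \<psi> (inv_into W \<phi> (\<phi> (p v))) j)"
    by (rule smooth_on_comp[OF op O, rotated])
      (use W(2,5,6) W'(2) op in \<open>auto intro: smooth_on_subset\<close>)
  moreover have "\<psi> (inv_into W \<phi> (\<phi> (p v))) j = \<psi> (p v) j" if "v \<in> V0 \<inter> V'" for v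
    using that W(5) chart_inj[OF W(1)] by simp
  ultimately have "smooth_on m (V0 \<inter> V') (\<lambda>v. \<psi> (p v) j)"
    using smooth_on_cong[OF op] by (metis (no_types, lifting))
  with op W(3) v show "\<exists>V0. nbhd m V' v V0 \<and> smooth_on m V0 (\<lambda>v. \<psi> (p v) j)"
    by blast
qed

lemma mplot_cong:
  assumes "\<And>v. v \<in> V \<Longrightarrow> p v = q v" "eopen m V"
  shows "mplot m V p \<longleftrightarrow> mplot m V q"
proof -
  have "mplot m V q" if pq: "\<And>v. v \<in> V \<Longrightarrow> p v = q v" and p: "mplot m V p" for p q
    unfolding mplot_def
  proof
    fix v assume "v \<in> V"
    obtain W \<phi> V0 where W: "(W, \<phi>) \<in> \<A>" "eopen m V0" "v \<in> V0" "V0 \<subseteq> V" "\<And>u. u \<in> V0 \<Longrightarrow> p u \<in> W"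
       "\<And>j. j < d \<Longrightarrow> smooth_on m V0 (\<lambda>v. \<phi> (p v) j)"
      using p \<open>v \<in> V\<close> unfolding mplot_def image_subset_iff by meson
    have eq: "p u = q u" if "u \<in> V0" for u using W(4) that pq by blast
    have "smooth_on m V0 (\<lambda>v. \<phi> (q v) j)" if "j < d" for j
      using W(6)[OF that] smooth_on_cong[OF W(2), of "\<lambda>v. \<phi> (p v) j" "\<lambda>v. \<phi> (q v) j"] eq by simp
    moreover have "q ` V0 \<subseteq> W" using W(5) eq by auto
    ultimately show "near_chart m V v q" using W(1-4) by blast
  qed
  from this[of p q] this[of q p] assms(1) show ?thesis by auto
qed

lemma mplot_local:
  assumes "\<And>v. v \<in> V \<Longrightarrow> \<exists>V0. v \<in> V0 \<and> V0 \<subseteq> V \<and> mplot m V0 p"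
  shows "mplot m V p"
  unfolding mplot_def
proof
  fix v assume "v \<in> V"
  then obtain V1 where V1: "v \<in> V1" "V1 \<subseteq> V" "mplot m V1 p" using assms by blast
  obtain W \<phi> V0 where W: "(W, \<phi>) \<in> \<A>" "eopen m V0" "v \<in> V0" "V0 \<subseteq> V1" "\<And>u. u \<in> V0 \<Longrightarrow> p u \<in> W"
     "\<And>j. j < d \<Longrightarrow> smooth_on m V0 (\<lambda>v. \<phi> (p v) j)"
    using V1(3,1) unfolding mplot_def image_subset_iff by meson
  then show "near_chart m V v p" using V1(2) by blast
qed

lemma mplot_comp:
  assumes p: "mplot n U p" and V: "eopen m V" and f: "\<And>v. v \<in> V \<Longrightarrow> f v \<in> U" "U \<subseteq> Esp n"
    and s: "\<And>j. j < n \<Longrightarrow> smooth_on m V (\<lambda>v. f v j)"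
  shows "mplot m V (\<lambda>v. p (f v))"
  unfolding mplot_def
proof
  fix v assume v: "v \<in> V"
  obtain W \<phi> V0 where W: "(W, \<phi>) \<in> \<A>" "eopen n V0" "f v \<in> V0" "V0 \<subseteq> U" "\<And>u. u \<in> V0 \<Longrightarrow> p u \<in> W"
     "\<And>j. j < d \<Longrightarrow> smooth_on n V0 (\<lambda>v. \<phi> (p v) j)"
    using p f(1)[OF v] unfolding mplot_def image_subset_iff by meson
  let ?V = "{v \<in> V. f v \<in> V0}"
  have op: "eopen m ?V"
    by (rule eopen_preimage_Esp[OF V _ _ W(2)]) (use f s V in \<open>auto intro: smooth_on_continuous\<close>)
  have "smooth_on m ?V (\<lambda>v. \<phi> (p (f v)) j)" if "j < d" for j
    by (rule smooth_on_comp[OF op W(2) _ W(6)[OF that]]) (auto intro: smooth_on_subset[OF s V])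
  moreover have "(\<lambda>v. p (f v)) ` ?V \<subseteq> W" using W(5) by auto
  ultimately show "near_chart m V v (\<lambda>v. p (f v))"
    using op W(1,3) v by (intro exI[of _ W] exI[of _ \<phi>] exI[of _ ?V]) auto
qed

lemma mplot_subset: "mplot m V p \<Longrightarrow> eopen m V' \<Longrightarrow> V' \<subseteq> V \<Longrightarrow> eopen m V \<Longrightarrow> mplot m V' p"
  using mplot_comp[of m V p m V' "\<lambda>v. v"] eopen_subset smooth_on_coord by blast

lemma mplot_const:
  assumes "b \<in> topspace T" "eopen m V"
  shows "mplot m V (\<lambda>v. b)"
proof -
  obtain W \<phi> where "(W, \<phi>) \<in> \<A>" "b \<in> W" using assms(1) charts_cover by blast
  then show ?thesis unfolding mplot_def
    using assms(2) by (intro ballI exI[of _ W] exI[of _ \<phi>] exI[of _ V]) (auto intro: smooth_on_const)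
qed

lemma mplot_chart_inv:
  assumes "(W, \<phi>) \<in> \<A>" "eopen m V" "\<And>v. v \<in> V \<Longrightarrow> q v \<in> \<phi> ` W" "\<And>j. j < d \<Longrightarrow> smooth_on m V (\<lambda>v. q v j)"
  shows "mplot m V (\<lambda>v. inv_into W \<phi> (q v))"
proof -
  have "smooth_on m V (\<lambda>v. \<phi> (inv_into W \<phi> (q v)) j)" if "j < d" for j
    using assms(4)[OF that] smooth_on_cong[OF assms(2), of "\<lambda>v. \<phi> (inv_into W \<phi> (q v)) j" "\<lambda>v. q v j"]
      f_inv_into_f[OF assms(3)] by simp
  then show ?thesis unfolding mplot_def
    using assms(1,2) inv_into_into[OF assms(3)]
    by (intro ballI exI[of _ W] exI[of _ \<phi>] exI[of _ V]) auto
qed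

text \<open>The diffeology demands continuity into \<open>T\<close> and smoothness in every chart.
  Given one chart near each point, the former follows from \<open>mplot_open_preimage\<close>, the
  latter from \<open>mplot_chart\<close>.\<close>

lemma plots_manifold:
  assumes V: "eopen m V"
  shows "p \<in> plots \<N> m V \<longleftrightarrow> p \<in> extensional V \<and> mplot m V p"
proof (intro iffI conjI)
  assume p: "p \<in> plots \<N> m V"
  then have p: "p \<in> V \<rightarrow>\<^sub>E topspace T" "continuous_map (subtopology (Euclidean_space m) V) T p"
    "\<And>W \<phi>. (W, \<phi>) \<in> \<A> \<Longrightarrow> smooth_map m {v \<in> V. p v \<in> W} d (\<phi> ` W) (\<lambda>v. \<phi> (p v))"
    by (auto simp: manifold_diffeology_def)
  then show "p \<in> extensional V" by (simp add: PiE_def)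
  show "mplot m V p" unfolding mplot_def
  proof
    fix v assume v: "v \<in> V"
    then have "p v \<in> topspace T" using p by auto
    then obtain W \<phi> where W: "(W, \<phi>) \<in> \<A>" "p v \<in> W" using charts_cover by blast
    have "openin (subtopology (Euclidean_space m) V) {x \<in> topspace (subtopology (Euclidean_space m) V). p x \<in> W}"
      by (rule openin_continuous_map_preimage[OF p(2) chart_domain[OF W(1)]])
    moreover have "{x \<in> topspace (subtopology (Euclidean_space m) V). p x \<in> W} = {v \<in> V. p v \<in> W}"
      using eopen_subset[OF V] by auto
    ultimately have "eopen m {v \<in> V. p v \<in> W}" using V openin_trans_full by metis
    moreover have "\<forall>j<d. smooth_on m {v \<in> V. p v \<in> W} (\<lambda>v. \<phi> (p v) j)"
      using p(3)[OF W(1)] by (simp add: smooth_map_iff)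
    ultimately show "near_chart m V v p"
      using W v by (intro exI[of _ W] exI[of _ \<phi>] exI[of _ "{v \<in> V. p v \<in> W}"]) auto
  qed
next
  assume p: "p \<in> extensional V \<and> mplot m V p"
  have 1: "p \<in> V \<rightarrow>\<^sub>E topspace T" using p mplot_topspace by (auto simp: PiE_def)
  have 2: "continuous_map (subtopology (Euclidean_space m) V) T p"
    unfolding continuous_map_def
  proof (intro conjI allI impI)
    show "p \<in> topspace (subtopology (Euclidean_space m) V) \<rightarrow> topspace T" using 1 by auto
    fix S assume "openin T S"
    then have "eopen m {v \<in> V. p v \<in> S}" using mplot_open_preimage p by blast
    moreover have "{x \<in> topspace (subtopology (Euclidean_space m) V). p x \<in> S} = {v \<in> V. p v \<in> S}"
      using eopen_subset[OF V] by auto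
    ultimately show "openin (subtopology (Euclidean_space m) V) {x \<in> topspace (subtopology (Euclidean_space m) V). p x \<in> S}"
      using V by (simp add: openin_open_subtopology)
  qed
  have "smooth_map m {v \<in> V. p v \<in> W} d (\<phi> ` W) (\<lambda>v. \<phi> (p v))" if W: "(W, \<phi>) \<in> \<A>" for W \<phi>
    unfolding smooth_map_iff
  proof (intro conjI allI impI)
    fix j assume "j < d"
    then show "smooth_on m {v \<in> V. p v \<in> W} (\<lambda>v. \<phi> (p v) j)"
      using p mplot_open_preimage chart_domain[OF W] by (intro mplot_chart[OF _ _ _ W]) auto
  qed auto
  with 1 2 show "p \<in> plots \<N> m V"
    by (auto simp: manifold_diffeology_def)
qed

lemma points_manifold [simp]: "points \<N> = topspace T"
  by (simp add: manifold_diffeology_def)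

lemma diffeological_manifold: "diffeological_space \<N>"
proof
  fix n U assume U: "eopen n U"
  show "plots \<N> n U \<subseteq> U \<rightarrow>\<^sub>E points \<N>"
    by (auto simp: manifold_diffeology_def)
  fix x assume "x \<in> points \<N>"
  then have "mplot n U (\<lambda>u. x)" using U by (simp add: mplot_const)
  then have "mplot n U (\<lambda>u\<in>U. x)" using mplot_cong[OF _ U, of "\<lambda>u. x" "\<lambda>u\<in>U. x"] by simp
  then show "(\<lambda>u\<in>U. x) \<in> plots \<N> n U" using U by (simp add: plots_manifold)
next
  fix n U m V p f
  assume U: "eopen n U" and V: "eopen m V" and p: "p \<in> plots \<N> n U"
    and f: "smooth_map m V n U f"
  have "mplot m V (\<lambda>v. p (f v))"
    by (rule mplot_comp[of n U, OF _ V _ eopen_subset[OF U]]) (use p f U in \<open>auto simp: plots_manifold smooth_map_iff\<close>)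
  then have "mplot m V (compose V p f)"
    using mplot_cong[OF _ V, of "\<lambda>v. p (f v)" "compose V p f"] by (simp add: compose_def)
  then show "compose V p f \<in> plots \<N> m V" using V by (simp add: plots_manifold)
next
  fix n U p \<V>
  assume U: "eopen n U" and p: "p \<in> U \<rightarrow>\<^sub>E points \<N>"
    and \<V>: "\<And>V. V \<in> \<V> \<Longrightarrow> eopen n V" "\<Union>\<V> = U"
    "\<And>V. V \<in> \<V> \<Longrightarrow> restrict p V \<in> plots \<N> n V"
  have "mplot n V p" if "V \<in> \<V>" for V
    using \<V>(3)[OF that] \<V>(1)[OF that] mplot_cong[OF _ \<V>(1)[OF that], of p "restrict p V"]
    by (simp add: plots_manifold)
  then have "mplot n U p" using \<V>(2) by (intro mplot_local) blast
  then show "p \<in> plots \<N> n U" using U p by (simp add: plots_manifold PiE_def)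
qed

end

section \<open>Bump functions on a manifold\<close>

lemma closed_Esp: "closed (Esp d)"
  using closedin_Euclidean_space[of d] by (simp add: euclidean_product_topology)

lemma compact_box: "compact {y :: nat \<Rightarrow> real. \<forall>i. y i \<in> {l i..u i}}"
proof -
  have "compactin (product_topology (\<lambda>i. euclidean) UNIV) (PiE UNIV (\<lambda>i. {l i..u i}))"
    by (subst compactin_PiE) auto
  moreover have "PiE UNIV (\<lambda>i. {l i..u i}) = {y. \<forall>i. y i \<in> {l i..u i}}" by (auto simp: PiE_iff)
  ultimately show ?thesis by (simp add: euclidean_product_topology)
qed

lemma continuous_on_coord [continuous_intros]: "continuous_on S (\<lambda>y :: nat \<Rightarrow> real. y i)"
  by (rule continuous_on_subset[OF continuous_on_product_coordinates subset_UNIV])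

lemma eopen_box:
  assumes "\<rho> > 0"
  shows "eopen d {y \<in> Esp d. \<forall>i<d. \<bar>y i - c i\<bar> < \<rho>}"
  unfolding eopen_open
proof (intro exI conjI)
  show "open {y. \<forall>i\<in>{..<d}. y i \<in> ball (c i) \<rho>}" by (rule product_topology_basis') auto
qed (auto simp: dist_real_def abs_minus_commute)

context smooth_manifold
begin

definition smooth_fun :: "('b \<Rightarrow> real) \<Rightarrow> bool" where
  "smooth_fun h \<longleftrightarrow> (\<forall>m V p. eopen m V \<longrightarrow> mplot m V p \<longrightarrow> smooth_on m V (\<lambda>v. h (p v)))"

lemma smooth_funD: "smooth_fun h \<Longrightarrow> eopen m V \<Longrightarrow> mplot m V p \<Longrightarrow> smooth_on m V (\<lambda>v. h (p v))"
  by (simp add: smooth_fun_def)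

lemma smooth_fun_mult: "smooth_fun f \<Longrightarrow> smooth_fun g \<Longrightarrow> smooth_fun (\<lambda>b. f b * g b)"
  by (simp add: smooth_fun_def smooth_on_mult)

lemma smooth_fun_prod: "finite A \<Longrightarrow> (\<And>a. a \<in> A \<Longrightarrow> smooth_fun (f a)) \<Longrightarrow> smooth_fun (\<lambda>b. \<Prod>a\<in>A. f a b)"
  by (simp add: smooth_fun_def smooth_on_prod)

text \<open>The Hausdorff axiom acts here: a compact set in one chart is compact in
  \<open>T\<close>, hence closed. On a line with two origins this fails, and extension by zero would
  not even be continuous.\<close>

lemma chart_compact_closed:
  assumes U: "(U, \<phi>) \<in> \<A>" and K: "compact K" "K \<subseteq> \<phi> ` U"
  shows "closedin T {b \<in> U. \<phi> b \<in> K}"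
proof -
  obtain g where "homeomorphic_maps (subtopology T U) (subtopology (Euclidean_space d) (\<phi> ` U)) \<phi> g"
    using chart_homeo[OF U] homeomorphic_map_maps by blast
  then have g: "continuous_map (subtopology (Euclidean_space d) (\<phi> ` U)) (subtopology T U) g"
    "\<And>b. b \<in> U \<Longrightarrow> g (\<phi> b) = b"
    using chart_subset[OF U] unfolding homeomorphic_maps_def by auto
  have "compactin (subtopology (Euclidean_space d) (\<phi> ` U)) K"
    using K eopen_subset[OF chart_image[OF U]] by (simp add: subtopology_Esp compactin_subtopology)
  from image_compactin[OF this g(1)] have "compactin T (g ` K)" by (simp add: compactin_subtopology)
  moreover have "g ` K = {b \<in> U. \<phi> b \<in> K}"
    using g(2) K(2) by (force simp: image_iff)
  ultimately show ?thesis using compactin_imp_closedin[OF Hausdorff] by simp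
qed

text \<open>Near a point with chart value in \<open>B\<close> the function is \<open>G\<close> of
  smooth coordinates. Any other point lies in the complement of the closed set over
  \<open>K\<close>, and on that open complement the function is 0.\<close>

lemma smooth_fun_extend_zero:
  assumes U: "(U, \<phi>) \<in> \<A>" and B: "eopen d B" "B \<subseteq> \<phi> ` U" and K: "compact K" "K \<subseteq> B"
    and G: "smooth_on d B G" "\<And>y. y \<in> B - K \<Longrightarrow> G y = 0"
  shows "smooth_fun (\<lambda>b. if b \<in> U \<and> \<phi> b \<in> B then G (\<phi> b) else 0)" (is "smooth_fun ?h")
  unfolding smooth_fun_def
proof (intro allI impI)
  fix m V p assume V: "eopen m V" and p: "mplot m V p"
  show "smooth_on m V (\<lambda>v. ?h (p v))"
  proof (rule smooth_on_local[OF V])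
    fix v assume v: "v \<in> V"
    show "\<exists>V0. nbhd m V v V0 \<and> smooth_on m V0 (\<lambda>v. ?h (p v))"
    proof (cases "p v \<in> U \<and> \<phi> (p v) \<in> B")
      case True
      define V0 where "V0 = {v \<in> V. p v \<in> {b \<in> U. \<phi> b \<in> B}}"
      have V0: "eopen m V0" unfolding V0_def
        by (rule mplot_open_preimage[OF p chart_open_preimage[OF U B(1)]])
      have "smooth_on m V0 (\<lambda>v. G (\<phi> (p v)))"
      proof (rule smooth_on_comp[OF V0 B(1) _ G(1)])
        show "smooth_on m V0 (\<lambda>v. \<phi> (p v) j)" if "j < d" for j
          by (rule mplot_chart[OF p V0 _ U _ that]) (auto simp: V0_def)
      qed (simp add: V0_def)
      moreover have "?h (p u) = G (\<phi> (p u))" if "u \<in> V0" for u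
        using that by (simp add: V0_def)
      ultimately have "smooth_on m V0 (\<lambda>v. ?h (p v))"
        using smooth_on_cong[OF V0, of "\<lambda>v. ?h (p v)" "\<lambda>v. G (\<phi> (p v))"] by blast
      moreover have "v \<in> V0" "V0 \<subseteq> V" using v True by (auto simp: V0_def)
      ultimately show ?thesis using V0 by blast
    next
      case False
      define C where "C = {b \<in> U. \<phi> b \<in> K}"
      have "closedin T C" unfolding C_def by (rule chart_compact_closed[OF U K(1)]) (use K B in blast)
      then have C: "openin T (topspace T - C)" by blast
      define V0 where "V0 = {v \<in> V. p v \<in> topspace T - C}"
      have V0: "eopen m V0" unfolding V0_def by (rule mplot_open_preimage[OF p C])
      have "?h (p u) = 0" if "u \<in> V0" for u
        using that G(2) by (auto simp: V0_def C_def)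
      then have "smooth_on m V0 (\<lambda>v. ?h (p v))"
        using smooth_on_cong[OF V0, of "\<lambda>v. ?h (p v)" "\<lambda>v. 0"] smooth_on_const[OF V0] by blast
      moreover have "v \<in> V0" "V0 \<subseteq> V" using v False K mplot_topspace[OF p v] by (auto simp: V0_def C_def)
      ultimately show ?thesis using V0 by blast
    qed
  qed
qed

text \<open>The chart image of \<open>W\<close> is a cube because the later interpolation needs
  convexity. The product of \<open>lam\<close> with a coordinate is smooth on the whole manifold,
  since it vanishes off a compact set inside the chart. The level 3 is where \<open>cutoff\<close>
  reaches 0.\<close>

lemma local_bump:
  assumes a: "a \<in> topspace T"
  obtains U \<phi> W lam where "(U, \<phi>) \<in> \<A>" "W \<subseteq> U" "openin T W" "eopen d (\<phi> ` W)"
    "\<And>x y s t. x \<in> \<phi> ` W \<Longrightarrow> y \<in> \<phi> ` W \<Longrightarrow> s \<ge> 0 \<Longrightarrow> t \<ge> 0 \<Longrightarrow> s + t = 1 \<Longrightarrow> (\<lambda>i. s * x i + t * y i) \<in> \<phi> ` W"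
    "smooth_fun lam" "\<And>i. smooth_fun (\<lambda>b. lam b * \<phi> b i)" "\<And>b. lam b > 0 \<Longrightarrow> b \<in> W"
    "openin T {b \<in> topspace T. lam b > 3}" "lam a > 3" "\<And>b. lam b \<ge> 0"
proof -
  obtain U \<phi> where U: "(U, \<phi>) \<in> \<A>" "a \<in> U" using a charts_cover by blast
  define c where "c = \<phi> a"
  have c: "c \<in> Esp d" unfolding c_def by (rule chart_Esp[OF U])
  obtain \<rho> where \<rho>: "\<rho> > 0" "\<And>y. y \<in> Esp d \<Longrightarrow> (\<And>i. i < d \<Longrightarrow> \<bar>y i - c i\<bar> < \<rho>) \<Longrightarrow> y \<in> \<phi> ` U"
    using eopenE[OF chart_image[OF U(1)], of c] U(2) by (auto simp: c_def)
  define B where "B = {y \<in> Esp d. \<forall>i<d. \<bar>y i - c i\<bar> < \<rho>}"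
  have B: "eopen d B" unfolding B_def by (rule eopen_box[OF \<rho>(1)])
  have BU: "B \<subseteq> \<phi> ` U" using \<rho>(2) by (auto simp: B_def)
  define Q where "Q y = (\<Sum>i<d. (y i - c i)\<^sup>2)" for y :: "nat \<Rightarrow> real"
  \<comment> \<open>A round ball of radius \<open>\<rho> / 2\<close> lies inside the open cube
    \<open>B\<close>, and its squared distance function \<open>Q\<close> is a polynomial, hence
    smooth.\<close>
  define K where "K = {y \<in> Esp d. Q y \<le> \<rho>\<^sup>2 / 4}"
  have coord: "\<bar>y i - c i\<bar> \<le> \<rho> / 2" if "Q y \<le> \<rho>\<^sup>2 / 4" "i < d" for y i
  proof -
    have "(y i - c i)\<^sup>2 \<le> Q y" unfolding Q_def using that(2) by (intro member_le_sum) auto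
    then have "(y i - c i)\<^sup>2 \<le> (\<rho> / 2)\<^sup>2" using that(1) by (simp add: power_divide)
    then show ?thesis using \<rho>(1) abs_le_square_iff[of "y i - c i" "\<rho> / 2"] by simp
  qed
  have KB: "K \<subseteq> B"
  proof
    fix y assume y: "y \<in> K"
    then have "\<bar>y i - c i\<bar> < \<rho>" if "i < d" for i using coord[of y i] that \<rho>(1) by (simp add: K_def)
    with y show "y \<in> B" by (simp add: K_def B_def)
  qed
  have "compact K"
  proof -
    have "closed {y. Q y \<le> \<rho>\<^sup>2 / 4}" unfolding Q_def
      by (intro closed_Collect_le continuous_intros)
    with closed_Esp[of d] have "closed (Esp d \<inter> {y. Q y \<le> \<rho>\<^sup>2 / 4})" by (rule closed_Int)
    moreover have "Esp d \<inter> {y. Q y \<le> \<rho>\<^sup>2 / 4} = K" by (auto simp: K_def)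
    ultimately have "closed K" by simp
    moreover have "K \<subseteq> {y. \<forall>i. y i \<in> {c i - \<rho>..c i + \<rho>}}"
    proof (intro subsetI CollectI allI)
      fix y i assume y: "y \<in> K"
      show "y i \<in> {c i - \<rho>..c i + \<rho>}"
      proof (cases "i < d")
        case True
        then have "\<bar>y i - c i\<bar> \<le> \<rho> / 2" using coord[of y i] y by (simp add: K_def)
        then have "\<bar>y i - c i\<bar> \<le> \<rho>" using \<rho>(1) by simp
        then show ?thesis by (simp only: atLeastAtMost_iff) linarith
      next
        case False
        then show ?thesis using y c \<rho>(1) by (simp add: K_def Esp_iff)
      qed
    qed
    ultimately show ?thesis
      using closed_Int_compact[OF _ compact_box[of "\<lambda>i. c i - \<rho>" "\<lambda>i. c i + \<rho>"], of K]
      by (simp only: Int_absorb2)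
  qed
  \<comment> \<open>Normalised to the value 4 at the centre, hence above level 3 on a neighbourhood
    of it.\<close>
  define G where "G y = 4 / bump (\<rho>\<^sup>2 / 4) * bump (\<rho>\<^sup>2 / 4 - Q y)" for y
  have cst: "bump (\<rho>\<^sup>2 / 4) > 0" using \<rho>(1) by simp
  have Gs: "smooth_on d B G" unfolding G_def Q_def
    by (intro smooth_on_mult smooth_on_bump smooth_on_diff smooth_on_sum smooth_on_power smooth_on_const smooth_on_coord B) auto
  have G0: "G y = 0" if "y \<in> B - K" for y using that by (auto simp: G_def K_def B_def)
  define lam where "lam b = (if b \<in> U \<and> \<phi> b \<in> B then G (\<phi> b) else 0)" for b
  define W where "W = {b \<in> U. \<phi> b \<in> B}"
  have W: "openin T W" unfolding W_def by (rule chart_open_preimage[OF U(1) B])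
  have \<phi>W: "\<phi> ` W = B" using BU by (auto simp: W_def)
  show ?thesis
  proof (rule that[of U \<phi> W lam])
    show "eopen d (\<phi> ` W)" using B \<phi>W by simp
    show "(\<lambda>i. s * x i + t * y i) \<in> \<phi> ` W" if xy: "x \<in> \<phi> ` W" "y \<in> \<phi> ` W" and st: "s \<ge> 0" "t \<ge> 0" "s + t = 1" for x y s t
    proof -
      have "\<bar>s * x i + t * y i - c i\<bar> < \<rho>" if "i < d" for i
      proof -
        have "\<bar>x i - c i\<bar> < \<rho>" "\<bar>y i - c i\<bar> < \<rho>" using xy that unfolding \<phi>W B_def by auto
        then have "s * x i + t * y i \<in> ball (c i) \<rho>"
          using convexD[OF convex_ball, of "x i" "c i" \<rho> "y i" s t] st
          by (auto simp: dist_real_def abs_minus_commute)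
        then show ?thesis by (simp add: dist_real_def abs_minus_commute)
      qed
      then show ?thesis using xy unfolding \<phi>W B_def by (auto simp: Esp_iff)
    qed
    show "smooth_fun lam" unfolding lam_def by (rule smooth_fun_extend_zero[OF U(1) B BU \<open>compact K\<close> KB Gs G0])
    show "smooth_fun (\<lambda>b. lam b * \<phi> b i)" for i
    proof -
      have "smooth_fun (\<lambda>b. if b \<in> U \<and> \<phi> b \<in> B then G (\<phi> b) * \<phi> b i else 0)"
        by (rule smooth_fun_extend_zero[OF U(1) B BU \<open>compact K\<close> KB smooth_on_mult[OF B Gs smooth_on_coord[OF B]]])
          (simp add: G0)
      then show ?thesis by (simp add: lam_def if_distrib[where f = "\<lambda>x. x * _"] cong: if_cong)
    qed
    show "b \<in> W" if "lam b > 0" for b using that by (auto simp: lam_def W_def split: if_splits)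
    show "lam b \<ge> 0" for b using cst by (auto simp: lam_def G_def)
    have "Q c = 0" by (simp add: Q_def)
    then have "G c = 4" using cst by (simp add: G_def)
    moreover have "c \<in> B" using c \<rho>(1) by (simp add: B_def)
    ultimately show "lam a > 3" using U(2) by (simp add: lam_def c_def)
    have "eopen d {y \<in> B. G y \<in> {3<..}}"
      by (rule eopen_preimage[OF B smooth_on_continuous[OF Gs B]]) simp
    from chart_open_preimage[OF U(1) this]
    have "openin T {b \<in> U. \<phi> b \<in> {y \<in> B. G y \<in> {3<..}}}" .
    moreover have "{b \<in> U. \<phi> b \<in> {y \<in> B. G y \<in> {3<..}}} = {b \<in> topspace T. lam b > 3}"
      using chart_subset[OF U(1)] by (auto simp: lam_def)
    ultimately show "openin T {b \<in> topspace T. lam b > 3}" by simp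
  qed (use U(1) W in \<open>auto simp: W_def\<close>)
qed

end

text \<open>The functions \<open>lam j\<close> and \<open>lam j * phi j\<close> together embed the manifold into \<open>\<real>\<^sup>\<infinity>\<close>.\<close>

locale chart_family = smooth_manifold d T \<A>
  for d :: nat and T :: "'b topology" and \<A> :: "('b set \<times> ('b \<Rightarrow> nat \<Rightarrow> real)) set" +
  fixes U W :: "nat \<Rightarrow> 'b set" and phi :: "nat \<Rightarrow> 'b \<Rightarrow> nat \<Rightarrow> real" and lam :: "nat \<Rightarrow> 'b \<Rightarrow> real"
  assumes chart: "(U j, phi j) \<in> \<A>"
    and W_subset: "W j \<subseteq> U j"
    and W_open: "openin T (W j)"
    and phi_W_open: "eopen d (phi j ` W j)"
    and phi_W_convex: "x \<in> phi j ` W j \<Longrightarrow> y \<in> phi j ` W j \<Longrightarrow> s \<ge> 0 \<Longrightarrow> t \<ge> 0 \<Longrightarrow> s + t = 1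
      \<Longrightarrow> (\<lambda>i. s * x i + t * y i) \<in> phi j ` W j"
    and lam_smooth: "smooth_fun (lam j)"
    and lam_phi_smooth: "smooth_fun (\<lambda>b. lam j b * phi j b i)"
    and lam_supp: "lam j b > 0 \<Longrightarrow> b \<in> W j"
    and lam_nonneg: "lam j b \<ge> 0"
    and lam_cover: "b \<in> topspace T \<Longrightarrow> \<exists>j. lam j b > 2"
    and lam_locally_finite: "b \<in> topspace T \<Longrightarrow>
      \<exists>S J. openin T S \<and> b \<in> S \<and> (\<forall>b'\<in>S. \<forall>j\<ge>J. lam j b' = 0)"

text \<open>The half-lines \<open>t > 2\<close> and \<open>t < 3\<close> cover the real line, so the
  denominator never vanishes; the quotient falls from 1 to 0 between 2 and 3.\<close>

definition cutoff :: "real \<Rightarrow> real" where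
  "cutoff t = bump (3 - t) / (bump (t - 2) + bump (3 - t))"

lemma cutoff_denom: "bump (t - 2) + bump (3 - t) > 0"
proof (cases "t > 2")
  case True
  then show ?thesis by (intro add_pos_nonneg) auto
qed (auto intro: add_nonneg_pos)

lemma cutoff_1: "t \<le> 2 \<Longrightarrow> cutoff t = 1"
  using cutoff_denom[of t] by (simp add: cutoff_def)

lemma cutoff_0: "t \<ge> 3 \<Longrightarrow> cutoff t = 0"
  by (simp add: cutoff_def)

lemma cutoff_nonneg: "cutoff t \<ge> 0"
  by (simp add: cutoff_def)

lemma (in smooth_manifold) smooth_fun_cutoff: "smooth_fun h \<Longrightarrow> smooth_fun (\<lambda>b. cutoff (h b))"
  unfolding smooth_fun_def cutoff_def
  by (intro allI impI smooth_on_divide smooth_on_add smooth_on_bump smooth_on_diff smooth_on_const)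
    (use cutoff_denom in \<open>auto simp: less_le\<close>)

text \<open>Second countability enters through a countable subcover. Multiplying each bump function
  by the cutoffs of all earlier ones makes the family locally finite: where function
  \<open>k\<close> exceeds 3, all later products vanish. The products still cover, because the
  earliest function that exceeds 2 at a point is multiplied by 1 there.\<close>

lemma (in smooth_manifold) ex_chart_family:
  assumes "topspace T \<noteq> {}"
  shows "\<exists>U W phi lam. chart_family d T \<A> U W phi lam"
proof -
  define P where "P a U \<phi> W lam \<longleftrightarrow> (U, \<phi>) \<in> \<A> \<and> W \<subseteq> U \<and> openin T W \<and> eopen d (\<phi> ` W) \<and>
    (\<forall>x y s t. x \<in> \<phi> ` W \<longrightarrow> y \<in> \<phi> ` W \<longrightarrow> s \<ge> 0 \<longrightarrow> t \<ge> 0 \<longrightarrow> s + t = 1 \<longrightarrow> (\<lambda>i. s * x i + t * y i) \<in> \<phi> ` W) \<and>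
    smooth_fun lam \<and> (\<forall>i. smooth_fun (\<lambda>b. lam b * \<phi> b i)) \<and> (\<forall>b. lam b > 0 \<longrightarrow> b \<in> W) \<and>
    openin T {b \<in> topspace T. lam b > 3} \<and> lam a > 3 \<and> (\<forall>b. lam b \<ge> 0)"
    for a U and \<phi> :: "'b \<Rightarrow> nat \<Rightarrow> real" and W lam
  have "\<exists>U \<phi> W lam. P a U \<phi> W lam" if a: "a \<in> topspace T" for a
    by (rule local_bump[OF a]) (unfold P_def, blast)
  then obtain U0 \<phi>0 W0 l0 where P0: "\<And>a. a \<in> topspace T \<Longrightarrow> P a (U0 a) (\<phi>0 a) (W0 a) (l0 a)"
    by metis
  define O0 where "O0 a = {b \<in> topspace T. l0 a b > 3}" for a
  have "Lindelof_space T" by (rule second_countable_imp_Lindelof_space[OF second_countable])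
  moreover have "\<forall>S \<in> O0 ` topspace T. openin T S" using P0 by (auto simp: P_def O0_def)
  moreover have "\<Union>(O0 ` topspace T) = topspace T" using P0 by (auto simp: P_def O0_def)
  ultimately obtain \<V> where \<V>: "countable \<V>" "\<V> \<subseteq> O0 ` topspace T" "\<Union>\<V> = topspace T"
    unfolding Lindelof_space_def by meson
  have "\<exists>D. countable D \<and> D \<subseteq> topspace T \<and> \<V> = O0 ` D"
    using \<V>(1,2) by (meson countable_subset_image)
  then obtain D where D: "countable D" "D \<subseteq> topspace T" "(\<Union>a\<in>D. O0 a) = topspace T"
    using \<V>(3) by blast
  have "D \<noteq> {}" using D(3) assms by (metis UN_empty)
  \<comment> \<open>If \<open>D\<close> is finite, the enumeration repeats points; the charts of a
    family may coincide.\<close>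
  define e where "e = from_nat_into D"
  have e: "range e = D" unfolding e_def by (rule range_from_nat_into[OF \<open>D \<noteq> {}\<close> D(1)])
  define l where "l j = l0 (e j)" for j
  have Pe: "P (e j) (U0 (e j)) (\<phi>0 (e j)) (W0 (e j)) (l j)" for j
  proof -
    have "e j \<in> topspace T" using e D(2) by blast
    then show ?thesis unfolding l_def by (rule P0)
  qed
  have cover: "\<exists>j. l j b > 3" if "b \<in> topspace T" for b
  proof -
    have "b \<in> (\<Union>a\<in>D. O0 a)" unfolding D(3) by (rule that)
    then obtain a where a: "a \<in> D" "b \<in> O0 a" by (rule UN_E)
    have "a \<in> range e" unfolding e by (rule a(1))
    then obtain j where "a = e j" by (rule rangeE)
    then have "l j b > 3" using a(2) by (simp add: l_def O0_def)
    then show ?thesis ..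
  qed
  define lam where "lam j b = l j b * (\<Prod>i<j. cutoff (l i b))" for j b
  have nl: "smooth_fun (l j)" "l j b \<ge> 0" for j b using Pe unfolding P_def by blast+
  have prod: "smooth_fun (\<lambda>b. \<Prod>i<j. cutoff (l i b))" for j by (intro smooth_fun_prod smooth_fun_cutoff nl) auto
  have pos: "(\<Prod>i<j. cutoff (l i b)) \<ge> 0" for j b by (intro prod_nonneg ballI cutoff_nonneg)
  have "chart_family d T \<A> (\<lambda>j. U0 (e j)) (\<lambda>j. W0 (e j)) (\<lambda>j. \<phi>0 (e j)) lam"
  proof unfold_locales
    fix j b i
    show "(U0 (e j), \<phi>0 (e j)) \<in> \<A>" "W0 (e j) \<subseteq> U0 (e j)" "openin T (W0 (e j))" "eopen d (\<phi>0 (e j) ` W0 (e j))"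
      using Pe[of j] unfolding P_def by blast+
    show "smooth_fun (lam j)" unfolding lam_def by (rule smooth_fun_mult[OF nl(1) prod])
    have "smooth_fun (\<lambda>b. l j b * \<phi>0 (e j) b i)" using Pe[of j] unfolding P_def by blast
    from smooth_fun_mult[OF this prod[of j]] show "smooth_fun (\<lambda>b. lam j b * \<phi>0 (e j) b i)"
      by (simp add: lam_def mult.commute mult.left_commute)
    show "lam j b \<ge> 0" unfolding lam_def using nl(2) pos by (rule mult_nonneg_nonneg)
    show "b \<in> W0 (e j)" if "lam j b > 0"
    proof -
      have "l j b \<noteq> 0" using that by (auto simp: lam_def)
      then have "l j b > 0" using nl(2)[where j = j and b = b] by simp
      then show ?thesis using Pe[of j] unfolding P_def by blast
    qed
  next
    fix x y :: "nat \<Rightarrow> real" and s t :: real and j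
    assume "x \<in> \<phi>0 (e j) ` W0 (e j)" "y \<in> \<phi>0 (e j) ` W0 (e j)" "s \<ge> 0" "t \<ge> 0" "s + t = 1"
    then show "(\<lambda>i. s * x i + t * y i) \<in> \<phi>0 (e j) ` W0 (e j)" using Pe[of j] unfolding P_def by blast
  next
    fix b assume b: "b \<in> topspace T"
    \<comment> \<open>The level is 2 and not 3: all earlier values are then at most 2, so their
      cutoffs are 1.\<close>
    define j where "j = (LEAST j. l j b > 2)"
    obtain k where k: "l k b > 3" using cover[OF b] by blast
    then have "l k b > 2" by simp
    then have "l j b > 2" unfolding j_def by (rule LeastI)
    moreover have "l i b \<le> 2" if "i < j" for i using that not_less_Least unfolding j_def by (metis not_le)
    then have "(\<Prod>i<j. cutoff (l i b)) = 1" by (intro prod.neutral) (auto intro: cutoff_1)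
    ultimately have "lam j b > 2" by (simp add: lam_def)
    then show "\<exists>j. lam j b > 2" ..
    show "\<exists>S J. openin T S \<and> b \<in> S \<and> (\<forall>b'\<in>S. \<forall>j\<ge>J. lam j b' = 0)"
    proof (intro exI conjI ballI allI impI)
      show "openin T {b \<in> topspace T. l k b > 3}" using Pe[of k] unfolding P_def by blast
      show "b \<in> {b \<in> topspace T. l k b > 3}" using b k by simp
      fix b' j assume "b' \<in> {b \<in> topspace T. l k b > 3}" and j: "j \<ge> Suc k"
      then have "cutoff (l k b') = 0" by (intro cutoff_0) simp
      then have "(\<Prod>i<j. cutoff (l i b')) = 0" using j by (intro prod_zero) auto
      then show "lam j b' = 0" by (simp add: lam_def)
    qed
  qed
  then show ?thesis by blast
qed

section \<open>A neighbourhood retraction onto the manifold\<close>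

lemma eopen_all_less:
  fixes j :: nat
  assumes "eopen m V" "\<And>i. i < j \<Longrightarrow> continuous_on V (\<lambda>v. f v i)"
  shows "eopen m {v \<in> V. \<forall>i<j. f v i < (r::real)}"
  using assms(2)
proof (induction j)
  case (Suc j)
  have "{v \<in> V. \<forall>i<Suc j. f v i < r} = {v \<in> V. \<forall>i<j. f v i < r} \<inter> {v \<in> V. f v j \<in> {..<r}}"
    by (auto simp: less_Suc_eq)
  moreover have "eopen m \<dots>"
    using Suc by (intro openin_Int eopen_preimage[OF assms(1)]) auto
  ultimately show ?case by simp
qed (simp add: assms(1))

text \<open>Points of the ambient space R^infinity are doubly indexed: entry \<open>(j, 0)\<close>
  stands for the \<open>j\<close>-th bump function, entry \<open>(j, Suc c)\<close> for its product
  with the \<open>c\<close>-th coordinate of the \<open>j\<close>-th chart.\<close>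

definition smooth_seq :: "nat \<Rightarrow> (nat \<Rightarrow> real) set \<Rightarrow> ((nat \<Rightarrow> real) \<Rightarrow> nat \<Rightarrow> nat \<Rightarrow> real) \<Rightarrow> bool" where
  "smooth_seq m V Y \<longleftrightarrow> (\<forall>j c. smooth_on m V (\<lambda>v. Y v j c))"

text \<open>Only the entries \<open>(j, 0)\<close> are tested, because the rest of block
  \<open>j\<close> is read only where entry \<open>(j, 0)\<close> reaches a positive
  threshold.\<close>

definition zero_from :: "nat \<Rightarrow> (nat \<Rightarrow> nat \<Rightarrow> real) \<Rightarrow> bool" where
  "zero_from J y \<longleftrightarrow> (\<forall>j\<ge>J. y j 0 = 0)"

text \<open>Increasing thresholds: what happens at stage \<open>Suc j\<close> only involves points at which stage \<open>j\<close> is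
  already defined on a neighbourhood.\<close>

definition thr :: "nat \<Rightarrow> real" where
  "thr j = 2 - 1 / (real j + 1)"

lemma thr_pos: "0 < thr j" by (simp add: thr_def field_simps)

lemma thr_less_2: "thr j < 2" by (simp add: thr_def)

lemma thr_Suc: "thr j < thr (Suc j)" by (simp add: thr_def field_simps)

text \<open>Total weight of the indices before \<open>j\<close>. Where it is positive, one of their
  charts has already supplied a point, so that stage \<open>j\<close> is meaningful.\<close>

definition weight :: "nat \<Rightarrow> (nat \<Rightarrow> nat \<Rightarrow> real) \<Rightarrow> real" where
  "weight j y = (\<Sum>i<j. bump (y i 0 - thr j))"

lemma weight_pos_iff: "0 < weight j y \<longleftrightarrow> (\<exists>i<j. thr j < y i 0)"
proof
  assume "0 < weight j y"
  then have "weight j y \<noteq> 0" by simp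
  then obtain i where "i < j" "bump (y i 0 - thr j) \<noteq> 0"
    unfolding weight_def by (meson lessThan_iff sum.not_neutral_contains_not_neutral)
  then show "\<exists>i<j. thr j < y i 0" by auto
next
  assume "\<exists>i<j. thr j < y i 0"
  then obtain i where "i < j" "thr j < y i 0" by blast
  then show "0 < weight j y" unfolding weight_def by (intro sum_pos2[of _ i]) auto
qed

lemma (in smooth_manifold) mplot_cong_imp:
  "mplot m V q \<Longrightarrow> eopen m V \<Longrightarrow> (\<And>v. v \<in> V \<Longrightarrow> p v = q v) \<Longrightarrow> mplot m V p"
  using mplot_cong[of V p q m] by simp

context chart_family
begin

text \<open>Division undoes the multiplication by the bump function: for an embedded point with
  positive entry \<open>(j, 0)\<close> the result is its coordinate vector in chart
  \<open>j\<close>. The zeros from \<open>d\<close> on put it into \<open>Esp d\<close>.\<close>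

definition chart_vec :: "nat \<Rightarrow> (nat \<Rightarrow> nat \<Rightarrow> real) \<Rightarrow> nat \<Rightarrow> real" where
  "chart_vec j y = (\<lambda>c. if c < d then y j (Suc c) / y j 0 else 0)"

definition psi :: "nat \<Rightarrow> (nat \<Rightarrow> real) \<Rightarrow> 'b" where
  "psi j = inv_into (U j) (phi j)"

text \<open>Stage \<open>Suc j\<close> interpolates, in the chart \<open>phi j\<close>, between the point found so far and the point
  encoded in the components \<open>y j\<close>.  The weights vanish wherever one of them may be undefined.\<close>

primrec stage :: "nat \<Rightarrow> (nat \<Rightarrow> nat \<Rightarrow> real) \<Rightarrow> 'b" where
  "stage 0 y = undefined"
| "stage (Suc j) y =
    (let A = bump (y j 0 - thr (Suc j)); B = (\<Sum>i<j. bump (y i 0 - thr (Suc j))) in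
     if A = 0 then stage j y
     else if B = 0 then psi j (chart_vec j y)
     else psi j (\<lambda>c. B / (A + B) * phi j (stage j y) c + A / (A + B) * chart_vec j y c))"

text \<open>The clauses use \<open>\<le>\<close> although a weight is positive only for
  \<open><\<close>. Where an entry equals the threshold its weight is 0 but may be positive nearby,
  so the formula used there has to make sense already. Moreover the negation of a closed condition
  is open: a branch that is inactive at a point stays inactive on a neighbourhood.\<close>

primrec valid :: "nat \<Rightarrow> (nat \<Rightarrow> nat \<Rightarrow> real) \<Rightarrow> bool" where
  "valid 0 y \<longleftrightarrow> True"
| "valid (Suc j) y \<longleftrightarrow>
     ((\<exists>i<j. thr (Suc j) \<le> y i 0) \<longrightarrow> valid j y) \<and>
     (thr (Suc j) \<le> y j 0 \<longrightarrow> chart_vec j y \<in> phi j ` W j) \<and>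
     ((\<exists>i<j. thr (Suc j) \<le> y i 0) \<and> thr (Suc j) \<le> y j 0 \<longrightarrow> stage j y \<in> W j)"

abbreviation "stage_dom j V Y \<equiv> {v \<in> V. 0 < weight j (Y v) \<and> valid j (Y v)}"

lemma psi_phi: "b \<in> U j \<Longrightarrow> psi j (phi j b) = b"
  unfolding psi_def by (rule inv_into_f_f[OF chart_inj[OF chart]])

lemma psi_phi_W: "b \<in> W j \<Longrightarrow> psi j (phi j b) = b"
  using psi_phi W_subset by blast

lemma phi_W_U: "x \<in> phi j ` W j \<Longrightarrow> x \<in> phi j ` U j"
  using W_subset by blast

text \<open>The cases depend on which entries reach the threshold. If entry \<open>j\<close> and an
  earlier one both do, the interpolation formula is valid on a whole neighbourhood. If only one kind
  does, the weight of the other kind vanishes nearby and a single branch of \<open>stage\<close>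
  applies.\<close>

lemma stage_smooth_step:
  assumes V: "eopen m V" and Y: "smooth_seq m V Y"
    and O: "eopen m (stage_dom j V Y)"
    and s: "mplot m (stage_dom j V Y) (\<lambda>v. stage j (Y v))"
    and v: "v \<in> V" "0 < weight (Suc j) (Y v)" "valid (Suc j) (Y v)"
  shows "\<exists>V0. nbhd m (stage_dom (Suc j) V Y) v V0 \<and>
    mplot m V0 (\<lambda>v. stage (Suc j) (Y v))"
proof -
  let ?t = "thr (Suc j)"
  let ?O = "stage_dom j V Y"
  define A where "A v = bump (Y v j 0 - ?t)" for v
  define B where "B v = (\<Sum>i<j. bump (Y v i 0 - ?t))" for v
  have weight: "weight (Suc j) (Y v) = A v + B v" for v by (simp add: weight_def A_def B_def)
  have stage: "stage (Suc j) (Y v) = (if A v = 0 then stage j (Y v)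
     else if B v = 0 then psi j (chart_vec j (Y v))
     else psi j (\<lambda>c. B v / (A v + B v) * phi j (stage j (Y v)) c + A v / (A v + B v) * chart_vec j (Y v) c))" for v
    by (simp only: stage.simps Let_def A_def B_def)
  have Ys: "smooth_on m V (\<lambda>v. Y v i c)" for i c using Y by (simp add: smooth_seq_def)
  have Yc: "continuous_on V (\<lambda>v. Y v i c)" for i c by (rule smooth_on_continuous[OF Ys V])
  have AB: "smooth_on m V A" "smooth_on m V B" unfolding A_def B_def
    by (intro smooth_on_sum smooth_on_bump smooth_on_diff smooth_on_const Ys V; simp)+
  have nn: "A v \<ge> 0" "B v \<ge> 0" for v by (auto simp: A_def B_def intro: sum_nonneg)
  \<comment> \<open>Here the growth of the thresholds is used: an entry that reaches the higher one
    lies strictly above the lower one, so the previous stage has positive weight.\<close>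
  have B_pos: "0 < weight j (Y v)" if "\<exists>i<j. ?t \<le> Y v i 0" for v
    using that thr_Suc[of j] unfolding weight_pos_iff by (meson less_le_trans)
  have Vw: "eopen m {v \<in> V. A v + B v \<in> {0<..}}"
    by (rule eopen_preimage[OF V smooth_on_continuous[OF smooth_on_add[OF V AB] V]]) simp
  define V1 where "V1 = {v \<in> V. Y v j 0 \<in> {0<..}}"
  have V1: "eopen m V1" unfolding V1_def by (rule eopen_preimage[OF V Yc]) simp
  have pvs: "smooth_on m V1 (\<lambda>v. chart_vec j (Y v) c)" for c
  proof (cases "c < d")
    case True
    have "smooth_on m V1 (\<lambda>v. Y v j (Suc c) / Y v j 0)"
      by (rule smooth_on_divide[OF V1]) (auto simp: V1_def intro: smooth_on_subset[OF Ys V])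
    then show ?thesis using True by (simp add: chart_vec_def)
  qed (simp add: chart_vec_def smooth_on_const V1)
  define V2 where "V2 = {v \<in> V1. chart_vec j (Y v) \<in> phi j ` W j}"
  have V2: "eopen m V2" unfolding V2_def
    by (rule eopen_preimage_Esp[OF V1 _ smooth_on_continuous[OF pvs V1] phi_W_open])
      (simp add: chart_vec_def Esp_iff)
  show ?thesis
  proof (cases "?t \<le> Y v j 0")
    case top: True
    then have pv: "chart_vec j (Y v) \<in> phi j ` W j" using v(3) by simp
    have vV2: "v \<in> V2" using top thr_pos[of "Suc j"] v(1) pv by (simp add: V2_def V1_def)
    show ?thesis
    proof (cases "\<exists>i<j. ?t \<le> Y v i 0")
      case low: True
      define V3 where "V3 = {v \<in> ?O. stage j (Y v) \<in> W j}"
      have V3: "eopen m V3" unfolding V3_def by (rule mplot_open_preimage[OF s W_open])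
      define V0 where "V0 = V2 \<inter> V3 \<inter> {v \<in> V. A v + B v \<in> {0<..}}"
      have V0: "eopen m V0" unfolding V0_def by (intro openin_Int V2 V3 Vw)
      have V0V: "V0 \<subseteq> V" by (auto simp: V0_def)
      have "v \<in> V0" using vV2 low top v B_pos[OF low] weight by (auto simp: V0_def V3_def)
      moreover have "V0 \<subseteq> stage_dom (Suc j) V Y"
        by (auto simp: V0_def V2_def V3_def weight)
      moreover have "mplot m V0 (\<lambda>v. stage (Suc j) (Y v))"
      proof -
        define f where "f v = (\<lambda>c. B v / (A v + B v) * phi j (stage j (Y v)) c + A v / (A v + B v) * chart_vec j (Y v) c)" for v
        have pos: "A u + B u > 0" and stW: "stage j (Y u) \<in> W j" and pvW: "chart_vec j (Y u) \<in> phi j ` W j" if "u \<in> V0" for u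
          using that by (auto simp: V0_def V2_def V3_def)
        have fW: "f u \<in> phi j ` W j" if "u \<in> V0" for u
          unfolding f_def
        proof (rule phi_W_convex)
          show "B u / (A u + B u) + A u / (A u + B u) = 1"
            using pos[OF that] by (simp add: add_divide_distrib[symmetric] add.commute)
        qed (use pos[OF that] nn stW[OF that] pvW[OF that] in auto)
        \<comment> \<open>The interpolation describes the other two branches as well: for
          \<open>A u = 0\<close> or \<open>B u = 0\<close> it is one of its end points, and
          \<open>psi j\<close> inverts \<open>phi j\<close> on \<open>W j\<close>.\<close>
        have eq: "stage (Suc j) (Y u) = psi j (f u)" if "u \<in> V0" for u
        proof (cases "A u = 0 \<or> B u = 0")
          case True
          have "f u = phi j (stage j (Y u))" if "A u = 0"
            using that pos[OF \<open>u \<in> V0\<close>] by (simp add: f_def)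
          moreover have "f u = chart_vec j (Y u)" if "B u = 0"
            using that pos[OF \<open>u \<in> V0\<close>] by (simp add: f_def)
          ultimately show ?thesis
            using True psi_phi_W[OF stW[OF that]] pos[OF that] unfolding stage by auto
        next
          case False
          then show ?thesis unfolding stage f_def by simp
        qed
        have V0s: "V0 \<subseteq> ?O" "V0 \<subseteq> V1" by (auto simp: V0_def V3_def V2_def)
        have sm: "smooth_on m V0 (\<lambda>v. f v c)" if "c < d" for c
        proof -
          have "smooth_on m V0 (\<lambda>v. phi j (stage j (Y v)) c)"
            by (rule mplot_chart[OF s V0 V0s(1) chart _ that]) (use stW W_subset in blast)
          moreover have "smooth_on m V0 (\<lambda>v. chart_vec j (Y v) c)" by (rule smooth_on_subset[OF pvs V1 V0s(2)])
          moreover have "smooth_on m V0 A" "smooth_on m V0 B" using AB V V0V by (auto intro: smooth_on_subset)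
          ultimately show ?thesis unfolding f_def
            using pos by (intro smooth_on_add smooth_on_mult smooth_on_divide V0) (auto simp: less_imp_neq[symmetric])
        qed
        have "mplot m V0 (\<lambda>v. psi j (f v))" unfolding psi_def
          by (rule mplot_chart_inv[OF chart V0 phi_W_U[OF fW] sm])
        then show ?thesis using mplot_cong[OF eq V0] by simp
      qed
      ultimately show ?thesis using V0 by blast
    next
      case low: False
      define V0 where "V0 = {v \<in> V. \<forall>i<j. Y v i 0 < ?t} \<inter> {v \<in> V. Y v j 0 \<in> {?t<..}} \<inter> V2"
      have V0: "eopen m V0" unfolding V0_def
        by (intro openin_Int V2 eopen_all_less eopen_preimage V Yc) simp
      have B0: "B u = 0" if "\<forall>i<j. Y u i 0 < ?t" for u
        unfolding B_def using that by (intro sum.neutral) (auto intro: less_imp_le)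
      \<comment> \<open>The earlier indices contribute nothing, so positivity of the total weight
        forces entry \<open>j\<close> strictly above the threshold.\<close>
      have "B v = 0" using low by (intro B0) auto
      then have "A v > 0" using v(2) weight by simp
      then have "v \<in> V0" using low v(1) vV2 by (auto simp: V0_def A_def)
      moreover have "V0 \<subseteq> stage_dom (Suc j) V Y"
      proof
        fix u assume u: "u \<in> V0"
        then have "\<not> (\<exists>i<j. ?t \<le> Y u i 0)" by (auto simp: V0_def)
        moreover have "0 < weight (Suc j) (Y u)" using u by (auto simp: V0_def weight_pos_iff)
        ultimately show "u \<in> stage_dom (Suc j) V Y"
          using u by (auto simp: V0_def V2_def)
      qed
      moreover have "mplot m V0 (\<lambda>v. stage (Suc j) (Y v))"
      proof -
        have "mplot m V0 (\<lambda>v. psi j (chart_vec j (Y v)))" unfolding psi_def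
        proof (rule mplot_chart_inv[OF chart V0])
          show "smooth_on m V0 (\<lambda>v. chart_vec j (Y v) c)" for c
            by (rule smooth_on_subset[OF pvs V1]) (auto simp: V0_def V2_def)
        qed (auto simp: V0_def V2_def intro: phi_W_U)
        moreover have "stage (Suc j) (Y u) = psi j (chart_vec j (Y u))" if "u \<in> V0" for u
          using that B0[of u] unfolding stage by (auto simp: V0_def A_def)
        ultimately show ?thesis by (rule mplot_cong_imp[OF _ V0])
      qed
      ultimately show ?thesis using V0 by blast
    qed
  next
    case False
    define V0 where "V0 = ?O \<inter> {v \<in> V. Y v j 0 \<in> {..<?t}} \<inter> {v \<in> V. A v + B v \<in> {0<..}}"
    have V0: "eopen m V0" unfolding V0_def
      by (intro openin_Int O eopen_preimage[OF V Yc] Vw) simp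
    have "\<exists>i<j. ?t \<le> Y v i 0"
    proof -
      obtain i where i: "i < Suc j" "?t < Y v i 0" using v(2) unfolding weight_pos_iff by blast
      then have "i \<noteq> j" using False by auto
      then show ?thesis using i by (intro exI[of _ i]) auto
    qed
    then have "v \<in> V0" using v False B_pos weight by (auto simp: V0_def)
    moreover have "V0 \<subseteq> stage_dom (Suc j) V Y"
      by (auto simp: V0_def weight)
    moreover have "mplot m V0 (\<lambda>v. stage (Suc j) (Y v))"
    proof -
      have "mplot m V0 (\<lambda>v. stage j (Y v))" by (rule mplot_subset[OF s V0 _ O]) (auto simp: V0_def)
      moreover have "stage (Suc j) (Y u) = stage j (Y u)" if "u \<in> V0" for u
        using that unfolding stage by (auto simp: V0_def A_def)
      ultimately show ?thesis by (rule mplot_cong_imp[OF _ V0])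
    qed
    ultimately show ?thesis using V0 by blast
  qed
qed

text \<open>At stage 0 the weight is an empty sum, so the domain is empty and the value
  \<open>undefined\<close> is never met.\<close>

lemma stage_smooth:
  assumes V: "eopen m V" and Y: "smooth_seq m V Y"
  shows "eopen m (stage_dom j V Y) \<and>
    mplot m (stage_dom j V Y) (\<lambda>v. stage j (Y v))"
proof (induction j)
  case 0
  then show ?case by (simp add: weight_def mplot_def)
next
  case (Suc j)
  let ?O = "stage_dom (Suc j) V Y"
  have "\<exists>V0. nbhd m ?O v V0 \<and> mplot m V0 (\<lambda>v. stage (Suc j) (Y v))" if "v \<in> ?O" for v
    using stage_smooth_step[OF V Y conjunct1[OF Suc.IH] conjunct2[OF Suc.IH]] that by blast
  then show ?case
    by (intro conjI mplot_local) (subst openin_subopen, blast, blast)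
qed

section \<open>The embedding and its smooth left inverse\<close>

definition embed :: "'b \<Rightarrow> nat \<Rightarrow> nat \<Rightarrow> real" where
  "embed b j c = (case c of 0 \<Rightarrow> lam j b | Suc c \<Rightarrow> lam j b * phi j b c)"

text \<open>Validity and value are proved together: validity at \<open>Suc j\<close> may ask that
  stage \<open>j\<close> lie in \<open>W j\<close>, which holds because stage \<open>j\<close>
  returns \<open>b\<close> and \<open>lam j b > 0\<close> puts \<open>b\<close> into
  \<open>W j\<close>.\<close>

lemma stage_embed: "valid j (embed b) \<and> (0 < weight j (embed b) \<longrightarrow> stage j (embed b) = b)"
proof (induction j)
  case 0
  then show ?case by (simp add: weight_def)
next
  case (Suc j)
  let ?t = "thr (Suc j)"
  let ?A = "bump (embed b j 0 - ?t)"
  let ?B = "\<Sum>i<j. bump (embed b i 0 - ?t)"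
  have low: "stage j (embed b) = b" if "\<exists>i<j. ?t \<le> embed b i 0"
    using that Suc thr_Suc[of j] unfolding weight_pos_iff by (meson less_le_trans)
  have top: "b \<in> W j" "chart_vec j (embed b) = phi j b" if "?t \<le> embed b j 0"
  proof -
    have pos: "lam j b > 0" using that thr_pos[of "Suc j"] by (simp add: embed_def)
    then show bW: "b \<in> W j" by (rule lam_supp)
    then have "phi j b \<in> Esp d" using chart_Esp[OF chart] W_subset by blast
    then show "chart_vec j (embed b) = phi j b" using pos by (auto simp: chart_vec_def embed_def Esp_iff)
  qed
  have val: "valid (Suc j) (embed b)" using Suc low top by simp
  have "stage (Suc j) (embed b) = b" if weight: "0 < weight (Suc j) (embed b)"
  proof -
    have AB: "0 < ?A + ?B" using weight by (simp add: weight_def)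
    have nB: "stage j (embed b) = b" if "?B \<noteq> 0"
    proof (rule low, rule ccontr)
      assume "\<not> (\<exists>i<j. ?t \<le> embed b i 0)"
      then have "?B = 0" by (intro sum.neutral) auto
      with that show False by simp
    qed
    have nA: "b \<in> W j" "chart_vec j (embed b) = phi j b" if "?A \<noteq> 0" using that top by auto
    consider "?A = 0" | "?A \<noteq> 0" "?B = 0" | "?A \<noteq> 0" "?B \<noteq> 0" by blast
    then show ?thesis
    proof cases
      case 1
      have "?B \<noteq> 0" using AB unfolding 1 by linarith
      from nB[OF this] 1 show ?thesis by simp
    next
      case 2
      then show ?thesis using nA psi_phi_W[OF nA(1)] by (auto simp: Let_def)
    next
      case 3
      have "(\<lambda>c. ?B / (?A + ?B) * phi j (stage j (embed b)) c + ?A / (?A + ?B) * chart_vec j (embed b) c) = phi j b"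
        using AB nA[OF 3(1)] nB[OF 3(2)]
        by (simp add: fun_eq_iff distrib_right[symmetric] add_divide_distrib[symmetric] add.commute)
      then show ?thesis using 3 psi_phi_W[OF nA(1)[OF 3(1)]] by (simp only: stage.simps Let_def if_False)
    qed
  qed
  with val show ?case by blast
qed

text \<open>The bound 2 is the supremum of the thresholds: an entry above it keeps the weight
  positive at every later stage, however large \<open>J\<close> has to be taken.\<close>

definition retr_dom :: "(nat \<Rightarrow> nat \<Rightarrow> real) \<Rightarrow> bool" where
  "retr_dom y \<longleftrightarrow> (\<exists>J. zero_from J y \<and> (\<exists>i<J. y i 0 > 2) \<and> valid J y)"

text \<open>By \<open>stage_stable\<close> every \<open>J\<close> with \<open>zero_from J y\<close>
  gives the same value; the least one is just a canonical choice.\<close>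

definition retr :: "(nat \<Rightarrow> nat \<Rightarrow> real) \<Rightarrow> 'b" where
  "retr y = stage (LEAST J. zero_from J y) y"

lemma stage_stable:
  assumes "zero_from J y"
  shows "J \<le> J' \<Longrightarrow> stage J' y = stage J y"
proof (induction J' rule: dec_induct)
  case (step j)
  then have "y j 0 = 0" using assms by (simp add: zero_from_def)
  then show ?case using step thr_pos[of "Suc j"] by simp
qed simp

text \<open>\<open>valid (Suc j)\<close> refers back to \<open>valid j\<close> only if an earlier
  entry reaches the threshold, and an entry above 2 always does.\<close>

lemma valid_stable:
  assumes "zero_from J y" "i < J" "y i 0 > 2"
  shows "J \<le> J' \<Longrightarrow> valid J' y \<longleftrightarrow> valid J y"
proof (induction J' rule: dec_induct)
  case (step j)
  have "y j 0 = 0" using assms(1) step by (simp add: zero_from_def)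
  moreover have "\<exists>i<j. thr (Suc j) \<le> y i 0"
    using assms step thr_less_2[of "Suc j"] by (intro exI[of _ i]) auto
  ultimately show ?case using step thr_pos[of "Suc j"] by (auto simp: not_le)
qed simp

lemma retr_eq: "zero_from J y \<Longrightarrow> retr y = stage J y"
  unfolding retr_def by (metis LeastI Least_le stage_stable)

lemma retr_embed:
  assumes "b \<in> topspace T"
  shows "retr_dom (embed b)" "retr (embed b) = b"
proof -
  obtain i where i: "lam i b > 2" using lam_cover[OF assms] by blast
  obtain J where J: "\<forall>j\<ge>J. lam j b = 0" using lam_locally_finite[OF assms] by blast
  have "i < J" using i J by (metis less_eq_real_def not_le not_less numeral_eq_one_iff zero_less_numeral)
  have zero_from: "zero_from J (embed b)" using J by (simp add: zero_from_def embed_def)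
  have "\<exists>i<J. embed b i 0 > 2" using i \<open>i < J\<close> by (auto simp: embed_def)
  then show "retr_dom (embed b)" using zero_from stage_embed[of J b] unfolding retr_dom_def by blast
  have "0 < weight J (embed b)" unfolding weight_pos_iff
    using \<open>i < J\<close> i thr_less_2[of J] by (intro exI[of _ i]) (simp add: embed_def)
  then show "retr (embed b) = b" using stage_embed[of J b] retr_eq[OF zero_from] by simp
qed

text \<open>By local finiteness one number \<open>J\<close> of stages serves a whole neighbourhood,
  and there \<open>retr\<close> is \<open>stage J\<close>, whose smoothness is known. The open
  condition \<open>Y u i 0 > 2\<close> carries the witness \<open>i\<close> over to nearby
  points.\<close>

lemma retr_smooth:
  assumes V: "eopen m V" and Y: "smooth_seq m V Y"
    and lf: "\<And>v. v \<in> V \<Longrightarrow> \<exists>V0 J. nbhd m V v V0 \<and> (\<forall>u\<in>V0. zero_from J (Y u))"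
  shows "eopen m {v \<in> V. retr_dom (Y v)} \<and> mplot m {v \<in> V. retr_dom (Y v)} (\<lambda>v. retr (Y v))"
proof -
  have "\<exists>V1. nbhd m {v \<in> V. retr_dom (Y v)} v V1 \<and> mplot m V1 (\<lambda>v. retr (Y v))"
    if v: "v \<in> V" "retr_dom (Y v)" for v
  proof -
    obtain V0 J0 where V0: "eopen m V0" "v \<in> V0" "V0 \<subseteq> V" "\<And>u. u \<in> V0 \<Longrightarrow> zero_from J0 (Y u)"
      using lf[OF v(1)] by blast
    obtain J1 i where J1: "zero_from J1 (Y v)" "i < J1" "Y v i 0 > 2" "valid J1 (Y v)"
      using v(2) unfolding retr_dom_def by blast
    \<comment> \<open>\<open>J0\<close> works on a neighbourhood of \<open>v\<close>, while
      \<open>J1\<close> witnesses that \<open>v\<close> is in the domain;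
      \<open>valid_stable\<close> carries validity up to the larger of the two.\<close>
    define J where "J = max J0 J1"
    have zero_from: "zero_from J (Y u)" if "u \<in> V0" for u
      using V0(4)[OF that] by (simp add: zero_from_def J_def)
    have val: "valid J (Y v)" using valid_stable[OF J1(1-3), of J] J1(4) by (simp add: J_def)
    have Y0: "smooth_seq m V0 Y" using Y V V0 unfolding smooth_seq_def by (blast intro: smooth_on_subset)
    let ?O = "stage_dom J V0 Y"
    define V1 where "V1 = ?O \<inter> {u \<in> V0. Y u i 0 \<in> {2<..}}"
    have st: "eopen m ?O" "mplot m ?O (\<lambda>v. stage J (Y v))" using stage_smooth[OF V0(1) Y0, of J] by auto
    have V1: "eopen m V1" unfolding V1_def
      by (intro openin_Int st eopen_preimage V0 smooth_on_continuous) (use Y0 V0(1) in \<open>auto simp: smooth_seq_def\<close>)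
    have "i < J" using J1(2) by (simp add: J_def)
    have "thr J < Y v i 0" using J1(3) thr_less_2[of J] by simp
    then have "0 < weight J (Y v)" unfolding weight_pos_iff using \<open>i < J\<close> by blast
    then have "v \<in> V1" using V0(2) val J1(3) by (simp add: V1_def)
    moreover have "V1 \<subseteq> {v \<in> V. retr_dom (Y v)}"
      using V0(3) zero_from \<open>i < J\<close> by (auto simp: V1_def retr_dom_def)
    moreover have "mplot m V1 (\<lambda>v. retr (Y v))"
    proof -
      have "mplot m V1 (\<lambda>v. stage J (Y v))" by (rule mplot_subset[OF st(2) V1 _ st(1)]) (auto simp: V1_def)
      moreover have "retr (Y u) = stage J (Y u)" if "u \<in> V1" for u
        using that zero_from by (intro retr_eq) (auto simp: V1_def)
      ultimately show ?thesis by (rule mplot_cong_imp[OF _ V1])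
    qed
    ultimately show ?thesis using V1 by blast
  qed
  then show ?thesis by (intro conjI mplot_local) (subst openin_subopen, blast, blast)
qed

lemma embed_smooth_seq: "eopen m V \<Longrightarrow> mplot m V p \<Longrightarrow> smooth_seq m V (\<lambda>v. embed (p v))"
  unfolding smooth_seq_def
proof (intro allI)
  fix j c assume "eopen m V" "mplot m V p"
  then show "smooth_on m V (\<lambda>v. embed (p v) j c)"
    by (cases c) (simp_all add: embed_def smooth_funD[OF lam_smooth] smooth_funD[OF lam_phi_smooth])
qed

lemma embed_locally_finite:
  assumes p: "mplot m V p" and v: "v \<in> V"
  shows "\<exists>V0 J. nbhd m V v V0 \<and> (\<forall>u\<in>V0. zero_from J (embed (p u)))"
proof -
  obtain S J where S: "openin T S" "p v \<in> S" "\<forall>b'\<in>S. \<forall>j\<ge>J. lam j b' = 0"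
    using lam_locally_finite[OF mplot_topspace[OF p v]] by blast
  show ?thesis
    using mplot_open_preimage[OF p S(1)] v S(2,3)
    by (intro exI[of _ "{u \<in> V. p u \<in> S}"] exI[of _ J]) (auto simp: zero_from_def embed_def)
qed

end

section \<open>Families parametrized by a compact diffeological space\<close>

text \<open>A plot of the product of R^m and \<open>X\<close>, given by its two components.
  Smoothness of families over R^m with a parameter in \<open>X\<close> is tested on these
  pairs.\<close>

definition test_plot :: "'a diffeology \<Rightarrow> nat \<Rightarrow> nat \<Rightarrow> (nat \<Rightarrow> real) set
    \<Rightarrow> ((nat \<Rightarrow> real) \<Rightarrow> nat \<Rightarrow> real) \<Rightarrow> ((nat \<Rightarrow> real) \<Rightarrow> 'a) \<Rightarrow> bool" where
  "test_plot X m q V u \<xi> \<longleftrightarrow> eopen q V \<and> (\<forall>v\<in>V. u v \<in> Esp m) \<and> (\<forall>j. smooth_on q V (\<lambda>v. u v j))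
     \<and> \<xi> \<in> plots X q V"

lemma Esp_comp_zero:
  assumes "eopen q V" "\<And>v. v \<in> V \<Longrightarrow> u v \<in> Esp m" "\<And>j. j < m \<Longrightarrow> smooth_on q V (\<lambda>v. u v j)"
  shows "smooth_on q V (\<lambda>v. u v j)"
proof (cases "j < m")
  case False
  have "u v j = 0" if "v \<in> V" for v using assms(2)[OF that] False by (simp add: Esp_iff)
  then show ?thesis using smooth_on_cong[OF assms(1), of "\<lambda>v. u v j" "\<lambda>v. 0"] smooth_on_const[OF assms(1)]
    by simp
qed (rule assms(3))

lemma eopen_Esp [simp]: "eopen m (Esp m)"
  by (rule openin_topspace)

lemma continuous_on_fst_coord: "continuous_on S (\<lambda>x. fst x i :: real)"
  by (rule continuous_on_product_then_coordinatewise[OF continuous_on_fst[OF continuous_on_id]])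

lemma continuous_on_snd_coord: "continuous_on S (\<lambda>x. snd x i :: real)"
  by (rule continuous_on_product_then_coordinatewise[OF continuous_on_snd[OF continuous_on_id]])

text \<open>Such a \<open>P\<close> is an open set for the D-topology of the product of R^m and
  \<open>X\<close>. That topology may be finer than the product topology, so a tube argument has to
  go through plots.\<close>

definition Dopen :: "'a diffeology \<Rightarrow> nat \<Rightarrow> ((nat \<Rightarrow> real) \<Rightarrow> 'a \<Rightarrow> bool) \<Rightarrow> bool" where
  "Dopen X m P \<longleftrightarrow> (\<forall>q V u \<xi>. test_plot X m q V u \<xi> \<longrightarrow> eopen q {v \<in> V. P (u v) (\<xi> v)})"

section \<open>Tube lemma and neighbourhoods that are uniform over a compact
  \<open>X\<close>\<close>

context diffeological_space
begin

lemma plot_in: "eopen n U \<Longrightarrow> p \<in> plots X n U \<Longrightarrow> u \<in> U \<Longrightarrow> p u \<in> points X"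
  using plots_subset by blast

lemma test_plot_const:
  "z \<in> points X \<Longrightarrow> test_plot X m m (Esp m) (\<lambda>v. v) (\<lambda>v\<in>Esp m. z)"
  unfolding test_plot_def using const_plot smooth_on_coord by simp

lemma topspace_D_topology: "topspace (D_topology X) = points X"
proof
  show "topspace (D_topology X) \<subseteq> points X"
    using openin_topspace[of "D_topology X"] unfolding openin_D_topology by blast
  have "{u \<in> U. p u \<in> points X} = U" if "eopen n U" "p \<in> plots X n U" for n U p
    using plot_in[OF that] by blast
  then have "openin (D_topology X) (points X)" unfolding openin_D_topology by simp
  then show "points X \<subseteq> topspace (D_topology X)" by (rule openin_subset)
qed

text \<open>Pulling back along a plot of \<open>X\<close> turns \<open>P\<close> into an open subset
  of a product of Euclidean sets, where the ordinary tube lemma applies to the compact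
  \<open>K\<close>. Openness in the D-topology means openness after each such pullback.\<close>

lemma Dopen_tube:
  assumes P: "Dopen X m P" and K: "compact K" "K \<subseteq> Esp m"
  shows "openin (D_topology X) {z \<in> points X. \<forall>y\<in>K. P y z}"
  unfolding openin_D_topology
proof (intro conjI allI impI ballI)
  fix n U p assume U: "eopen n U" and p: "p \<in> plots X n U"
  \<comment> \<open>The product of R^m and R^n is coded as R^(m+n): the first \<open>m\<close>
    coordinates give the point at which \<open>P\<close> is tested, the other \<open>n\<close> the
    argument of the plot \<open>p\<close>.\<close>
  define snd' where "snd' w = (\<lambda>i. w (i + m))" for w :: "nat \<Rightarrow> real"
  define fst' where "fst' w = (\<lambda>i. if i < m then w i else 0)" for w :: "nat \<Rightarrow> real"
  define V where "V = {w \<in> Esp (m + n). snd' w \<in> U}"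
  have V: "eopen (m + n) V" unfolding V_def
    by (rule eopen_preimage_Esp[OF eopen_Esp _ _ U]) (auto simp: snd'_def Esp_iff intro: continuous_on_coord)
  have "smooth_map (m + n) V n U snd'"
    unfolding smooth_map_iff snd'_def using smooth_on_coord[OF V] by (auto simp: V_def snd'_def)
  then have \<xi>: "compose V p snd' \<in> plots X (m + n) V" by (rule plot_compose[OF U V p])
  have "smooth_on (m + n) V (\<lambda>v. fst' v j)" for j
    unfolding fst'_def using smooth_on_coord[OF V] smooth_on_const[OF V] by (cases "j < m") auto
  then have "test_plot X m (m + n) V fst' (compose V p snd')"
    unfolding test_plot_def using V \<xi> by (auto simp: fst'_def Esp_iff)
  then have O: "eopen (m + n) {w \<in> V. P (fst' w) (compose V p snd' w)}" (is "eopen _ ?O")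
    using P unfolding Dopen_def by blast
  obtain S where S: "open S" "?O = Esp (m + n) \<inter> S" using O unfolding eopen_open by blast
  \<comment> \<open>The inverse of the splitting by \<open>fst'\<close> and \<open>snd'\<close>,
    with the compact factor second, as in the tube lemma.\<close>
  define h where "h = (\<lambda>(u, y) i. if i < m then y i else u (i - m) :: real)"
  have "continuous_on UNIV h"
  proof (rule continuous_on_coordinatewise_then_product)
    fix i show "continuous_on UNIV (\<lambda>x. h x i)"
      using continuous_on_fst_coord[of UNIV "i - m"] continuous_on_snd_coord[of UNIV i]
      unfolding h_def case_prod_beta by (cases "i < m") simp_all
  qed
  then have oh: "open (h -` S)" using S(1) by (rule open_vimage[rotated])
  have hE: "h (u, y) \<in> Esp (m + n)" if "u \<in> U" "y \<in> Esp m" for u y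
    using that subsetD[OF eopen_subset[OF U] that(1)] by (auto simp: h_def Esp_iff)
  have sf: "snd' (h (u, y)) = u" for u y by (auto simp: snd'_def h_def)
  have ff: "fst' (h (u, y)) = y" if "y \<in> Esp m" for u y using that by (auto simp: fst'_def h_def Esp_iff)
  have iff: "h (u, y) \<in> S \<longleftrightarrow> P y (p u)" if "u \<in> U" "y \<in> Esp m" for u y
  proof -
    have "h (u, y) \<in> V" using hE[OF that] sf that(1) by (simp add: V_def)
    then have "h (u, y) \<in> ?O \<longleftrightarrow> P y (p u)" using sf ff that by (simp add: compose_def)
    then show ?thesis using S(2) hE[OF that] by blast
  qed
  let ?A = "{u \<in> U. p u \<in> {z \<in> points X. \<forall>y\<in>K. P y z}}"
  show "eopen n ?A"
  proof (subst openin_subopen, intro ballI)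
    fix u0 assume u0: "u0 \<in> ?A"
    have "{u0} \<times> K \<subseteq> h -` S" using u0 iff K(2) by auto
    from Elementary_Topology.tube_lemma[OF K(1) oh this]
    obtain X0 where X0: "u0 \<in> X0" "open X0" "X0 \<times> K \<subseteq> h -` S" by (elim exE conjE)
    have "eopen n (U \<inter> X0)" using U X0(2) unfolding eopen_open by (metis inf.assoc open_Int)
    moreover have "u0 \<in> U \<inter> X0" using u0 X0(1) by blast
    moreover have "U \<inter> X0 \<subseteq> ?A"
    proof
      fix u assume u: "u \<in> U \<inter> X0"
      have "P y (p u)" if "y \<in> K" for y
      proof -
        have "(u, y) \<in> h -` S" using X0(3) u that by blast
        then show ?thesis using iff[of u y] u that K(2) by auto
      qed
      then show "u \<in> ?A" using u plot_in[OF U p] by blast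
    qed
    ultimately show "\<exists>T. nbhd n ?A u0 T" by blast
  qed
qed blast

text \<open>For fixed \<open>z\<close> the tube lemma on [0,1] thickens the segment from 0 to
  \<open>x0\<close> to a cone over a cube on which \<open>P\<close> still holds. The
  \<open>z\<close> for which the \<open>k\<close>-th cube works form a D-open set by
  \<open>Dopen_tube\<close>. These sets increase with \<open>k\<close> and cover \<open>X\<close>,
  so compactness yields one cube for all \<open>z\<close>.\<close>

lemma star_neighbourhood:
  assumes comp: "compact_space (D_topology X)" and P: "Dopen X m P" and x0: "x0 \<in> Esp m"
    and Px0: "\<And>z t. z \<in> points X \<Longrightarrow> t \<in> {0..1} \<Longrightarrow> P (\<lambda>i. t * x0 i) z"
  shows "\<exists>e>0. \<forall>x\<in>Esp m. (\<forall>i<m. \<bar>x i - x0 i\<bar> \<le> e) \<longrightarrow>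
    (\<forall>t\<in>{0..1}. \<forall>z\<in>points X. P (\<lambda>i. t * x i) z)"
proof -
  define sc where "sc = (\<lambda>(x, t :: real) i :: nat. t * x i :: real)"
  have sc: "continuous_on UNIV sc"
  proof (rule continuous_on_coordinatewise_then_product)
    fix i show "continuous_on UNIV (\<lambda>x. sc x i)"
      unfolding sc_def case_prod_beta
      by (intro continuous_on_mult continuous_on_fst_coord continuous_on_snd continuous_on_id)
  qed
  define box where "box k = {x \<in> Esp m. \<forall>i<m. \<bar>x i - x0 i\<bar> \<le> 1 / real (Suc k)}" for k
  define K where "K k = sc ` (box k \<times> {0..1})" for k
  have "compact (box k)" for k
  proof -
    have eq: "{y. \<forall>i. y i \<in> {(if i < m then x0 i - 1 / real (Suc k) else 0)..(if i < m then x0 i + 1 / real (Suc k) else 0)}} = box k"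
      (is "?B = _")
    proof (rule set_eqI)
      fix y
      have "y i \<in> {(if i < m then x0 i - 1 / real (Suc k) else 0)..(if i < m then x0 i + 1 / real (Suc k) else 0)} \<longleftrightarrow>
        (if i < m then \<bar>y i - x0 i\<bar> \<le> 1 / real (Suc k) else y i = 0)" for i
        unfolding atLeastAtMost_iff by (simp only: split: if_split) linarith
      then have "y \<in> ?B \<longleftrightarrow> (\<forall>i. if i < m then \<bar>y i - x0 i\<bar> \<le> 1 / real (Suc k) else y i = 0)"
        by (simp only: mem_Collect_eq)
      also have "\<dots> \<longleftrightarrow> y \<in> box k" unfolding box_def mem_Collect_eq Esp_iff by (metis not_le)
      finally show "y \<in> ?B \<longleftrightarrow> y \<in> box k" .
    qed
    show ?thesis unfolding eq[symmetric] by (rule compact_box)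
  qed
  then have Kc: "compact (K k)" for k unfolding K_def
    by (intro compact_continuous_image compact_Times) (auto intro: continuous_on_subset[OF sc])
  have KE: "K k \<subseteq> Esp m" for k by (auto simp: K_def box_def sc_def Esp_iff)
  define C where "C k = {z \<in> points X. \<forall>y\<in>K k. P y z}" for k
  have Co: "openin (D_topology X) (C k)" for k unfolding C_def by (rule Dopen_tube[OF P Kc KE])
  have K_mono: "K l \<subseteq> K k" if "k \<le> l" for k l
  proof -
    have "1 / real (Suc l) \<le> 1 / real (Suc k)" using that by (simp add: field_simps)
    then have "box l \<subseteq> box k" unfolding box_def by force
    then show ?thesis unfolding K_def by blast
  qed
  have cover: "\<exists>k. z \<in> C k" if z: "z \<in> points X" for z
  proof -
    \<comment> \<open>Pairing the identity of R^m with the constant plot at \<open>z\<close> shows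
      that the slice of \<open>P\<close> at \<open>z\<close> is open.\<close>
    have "eopen m {v \<in> Esp m. P v ((\<lambda>v\<in>Esp m. z) v)}"
      using P test_plot_const[OF z, of m] unfolding Dopen_def by blast
    moreover have "{v \<in> Esp m. P v ((\<lambda>v\<in>Esp m. z) v)} = {v \<in> Esp m. P v z}" by auto
    ultimately have "eopen m {v \<in> Esp m. P v z}" by simp
    then obtain S where S: "open S" "{v \<in> Esp m. P v z} = Esp m \<inter> S" unfolding eopen_open by blast
    have oh: "open (sc -` S)" using S(1) sc by (rule open_vimage)
    have "{x0} \<times> {0..1} \<subseteq> sc -` S"
    proof
      fix w assume "w \<in> {x0} \<times> {0..1::real}"
      then obtain t where w: "w = (x0, t)" "t \<in> {0..1}" by blast
      have "(\<lambda>i. t * x0 i) \<in> {v \<in> Esp m. P v z}" using Px0[OF z w(2)] x0 by (simp add: Esp_iff)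
      then show "w \<in> sc -` S" using S(2) w(1) by (auto simp: sc_def)
    qed
    from Elementary_Topology.tube_lemma[OF compact_Icc oh this]
    obtain X0 where X0: "x0 \<in> X0" "open X0" "X0 \<times> {0..1} \<subseteq> sc -` S" by (elim exE conjE)
    have "eopen m (Esp m \<inter> X0)" using X0(2) unfolding eopen_open by blast
    then obtain e where e: "e > 0" "\<And>y. y \<in> Esp m \<Longrightarrow> (\<And>i. i < m \<Longrightarrow> \<bar>y i - x0 i\<bar> < e) \<Longrightarrow> y \<in> Esp m \<inter> X0"
      using eopenE[of m "Esp m \<inter> X0" x0] x0 X0(1) by blast
    obtain k where k: "inverse (real (Suc k)) < e" using reals_Archimedean[OF e(1)] by blast
    have "P y z" if "y \<in> K k" for y
    proof -
      obtain x t where xt: "x \<in> box k" "t \<in> {0..1}" "y = sc (x, t)"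
        using \<open>y \<in> K k\<close> unfolding K_def by blast
      have "x \<in> X0"
      proof -
        have "\<bar>x i - x0 i\<bar> < e" if "i < m" for i
          using xt(1) that k by (auto simp: box_def inverse_eq_divide intro: le_less_trans)
        then show ?thesis using e(2)[of x] xt(1) by (auto simp: box_def)
      qed
      then have "y \<in> S" using X0(3) xt(2,3) by blast
      then show ?thesis using S(2) \<open>y \<in> K k\<close> KE by blast
    qed
    then show ?thesis using z unfolding C_def by blast
  qed
  have "compactin (D_topology X) (points X)" using comp by (simp add: compact_space_def topspace_D_topology)
  moreover have "points X \<subseteq> \<Union>(range C)" using cover by blast
  ultimately obtain F where F: "finite F" "F \<subseteq> range C" "points X \<subseteq> \<Union>F"
    using compactinD[of "D_topology X" "points X" "range C"] Co by blast
  obtain L where L: "finite L" "F = C ` L" using finite_subset_image[OF F(1,2)] by blast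
  define k where "k = Max (insert 0 L)"
  have "points X \<subseteq> C k"
  proof
    fix z assume z: "z \<in> points X"
    then obtain l where l: "l \<in> L" "z \<in> C l" using F(3) L(2) by blast
    have "l \<le> k" unfolding k_def using l(1) L(1) by (intro Max_ge) auto
    then show "z \<in> C k" using l(2) K_mono unfolding C_def by blast
  qed
  then have "P (\<lambda>i. t * x i) z" if "x \<in> box k" "t \<in> {0..1}" "z \<in> points X" for x t z
  proof -
    have "sc (x, t) \<in> K k" using that unfolding K_def by blast
    then have "P (sc (x, t)) z" using \<open>points X \<subseteq> C k\<close> that(3) unfolding C_def by blast
    then show ?thesis by (simp add: sc_def)
  qed
  then show ?thesis by (intro exI[of _ "1 / real (Suc k)"]) (auto simp: box_def)
qed

end

section \<open>Retracting Euclidean space towards the coordinate hyperplanes\<close>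

text \<open>For nonnegative \<open>c\<close> this is a smooth function of \<open>t\<close> that is
  at least \<open>c k * bump 1\<close> for every \<open>k \<le> t + 2\<close>. Terms with
  \<open>k \<ge> t + 3\<close> vanish, so the number of summands may depend on \<open>t\<close>, and
  \<open>dominate_eq\<close> freezes it near a given point.\<close>

definition dominate :: "(nat \<Rightarrow> real) \<Rightarrow> real \<Rightarrow> real" where
  "dominate c t = (\<Sum>k<nat \<lceil>t + 3\<rceil>. c k * bump (t - real k + 3))"

lemma dominate_eq:
  assumes "t + 3 \<le> real K"
  shows "dominate c t = (\<Sum>k<K. c k * bump (t - real k + 3))"
  unfolding dominate_def
proof (rule sum.mono_neutral_left)
  show "{..<nat \<lceil>t + 3\<rceil>} \<subseteq> {..<K}"
  proof (rule subsetI)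
    fix k assume "k \<in> {..<nat \<lceil>t + 3\<rceil>}"
    then have "int k < \<lceil>t + 3\<rceil>" by (simp only: lessThan_iff zless_nat_eq_int_zless)
    then have k: "real k < t + 3" by (simp only: less_ceiling_iff of_int_of_nat_eq)
    show "k \<in> {..<K}" using assms k by simp
  qed
  show "\<forall>i\<in>{..<K} - {..<nat \<lceil>t + 3\<rceil>}. c i * bump (t - real i + 3) = 0"
  proof
    fix i assume "i \<in> {..<K} - {..<nat \<lceil>t + 3\<rceil>}"
    then have "\<lceil>t + 3\<rceil> \<le> int i" by (simp only: Diff_iff lessThan_iff not_less nat_le_iff)
    then have "t + 3 \<le> real i" by (simp only: ceiling_le_iff of_int_of_nat_eq)
    then show "c i * bump (t - real i + 3) = 0" by simp
  qed
qed simp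

lemma dominate_nonneg: "(\<And>k. c k \<ge> 0) \<Longrightarrow> dominate c t \<ge> 0"
  unfolding dominate_def by (intro sum_nonneg mult_nonneg_nonneg) auto

lemma dominate_ge:
  assumes "\<And>k. c k \<ge> 0" "real k \<le> t + 2"
  shows "c k * bump 1 \<le> dominate c t"
proof -
  have "real k < t + 3" using assms(2) by simp
  then have k: "k < nat \<lceil>t + 3\<rceil>" by linarith
  have "c k * bump 1 \<le> c k * bump (t - real k + 3)"
    using assms by (intro mult_left_mono bump_mono) auto
  also have "\<dots> \<le> dominate c t"
    unfolding dominate_def using k assms(1) by (intro member_le_sum) auto
  finally show ?thesis .
qed

lemma smooth_on_dominate:
  assumes V: "eopen m V" and f: "smooth_on m V f"
  shows "smooth_on m V (\<lambda>x. dominate c (f x))"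
proof (rule smooth_on_local[OF V])
  fix x assume x: "x \<in> V"
  define K where "K = nat \<lceil>f x + 4\<rceil>"
  define V0 where "V0 = {v \<in> V. f v \<in> {..<real K - 3}}"
  have V0: "eopen m V0" unfolding V0_def by (rule eopen_preimage[OF V smooth_on_continuous[OF f V]]) simp
  have V0V: "V0 \<subseteq> V" by (auto simp: V0_def)
  have "smooth_on m V0 (\<lambda>v. \<Sum>k<K. c k * bump (f v - real k + 3))"
    by (intro smooth_on_sum smooth_on_mult smooth_on_bump smooth_on_add smooth_on_diff smooth_on_const V0
        smooth_on_subset[OF f V V0V]) simp
  moreover have "dominate c (f v) = (\<Sum>k<K. c k * bump (f v - real k + 3))" if "v \<in> V0" for v
    using that by (intro dominate_eq) (simp add: V0_def)
  ultimately have "smooth_on m V0 (\<lambda>x. dominate c (f x))"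
    using smooth_on_cong[OF V0, of "\<lambda>x. dominate c (f x)" "\<lambda>v. \<Sum>k<K. c k * bump (f v - real k + 3)"] by simp
  moreover have "x \<in> V0"
  proof -
    have "f x + 4 \<le> real K" unfolding K_def by linarith
    then show ?thesis using x by (simp add: V0_def)
  qed
  ultimately show "\<exists>V0. nbhd m V x V0 \<and> smooth_on m V0 (\<lambda>x. dominate c (f x))"
    using V0 V0V by blast
qed

text \<open>On the part of a box that lies outside \<open>V\<close>, compactness bounds the square
  of the coordinate product from below. A \<open>dominate\<close> sum over all boxes then makes
  \<open>g x\<close> so small at such points that they move into a small cube about 0 inside
  \<open>V\<close>. Points of \<open>V\<close> stay in \<open>V\<close>, because \<open>g\<close>
  has values in [0,1].\<close>

lemma hyperplane_shrink:
  assumes I: "finite I" "I \<noteq> {}"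
    and V: "\<And>x s. x \<in> V \<Longrightarrow> s \<in> {0..1} \<Longrightarrow> (\<lambda>i. s * x i) \<in> V"
    and H: "\<And>x0. x0 \<in> Esp m \<Longrightarrow> \<exists>i\<in>I. x0 i = 0 \<Longrightarrow>
      \<exists>e>0. \<forall>x\<in>Esp m. (\<forall>i<m. \<bar>x i - x0 i\<bar> \<le> e) \<longrightarrow> x \<in> V"
  obtains g where "smooth_on m (Esp m) g" "\<And>x. x \<in> Esp m \<Longrightarrow> \<exists>i\<in>I. x i = 0 \<Longrightarrow> g x = 1"
    "\<And>x. x \<in> Esp m \<Longrightarrow> (\<lambda>i. g x * x i) \<in> V"
proof -
  define p where "p x = (\<Prod>i\<in>I. x i)" for x :: "nat \<Rightarrow> real"
  define s where "s x = (\<Sum>i<m. (x i)\<^sup>2)" for x :: "nat \<Rightarrow> real"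
  have p0: "p x = 0 \<longleftrightarrow> (\<exists>i\<in>I. x i = 0)" for x unfolding p_def using I(1) by simp
  have "(\<lambda>i. 0) \<in> Esp m" "\<exists>i\<in>I. (\<lambda>i. 0::real) i = 0" using I(2) by (auto simp: Esp_iff)
  \<comment> \<open>The origin lies on every hyperplane, so \<open>V\<close> contains a cube about
    it; the points outside \<open>V\<close> will be moved into this cube.\<close>
  from H[OF this] obtain e0 where e0: "e0 > 0" "\<And>x. x \<in> Esp m \<Longrightarrow> (\<forall>i<m. \<bar>x i\<bar> \<le> e0) \<Longrightarrow> x \<in> V"
    by auto
  have "\<exists>M\<ge>0. \<forall>x\<in>Esp m. (\<forall>i<m. \<bar>x i\<bar> \<le> real k) \<longrightarrow> x \<notin> V \<longrightarrow> 1 \<le> M * (p x)\<^sup>2" for k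
  proof -
    \<comment> \<open>\<open>V\<close> is not assumed open. \<open>S\<close> is an open union of
      cubes around points of the hyperplanes, and its trace on \<open>Esp m\<close> lies in
      \<open>V\<close>.\<close>
    define S where "S = (\<Union>x0\<in>{x0 \<in> Esp m. \<exists>i\<in>I. x0 i = 0}. \<Union>e\<in>{e. \<forall>x\<in>Esp m. (\<forall>i<m. \<bar>x i - x0 i\<bar> \<le> e) \<longrightarrow> x \<in> V}.
        {y. \<forall>i\<in>{..<m}. y i \<in> ball (x0 i) e})"
    have S: "open S" unfolding S_def by (intro open_UN ballI product_topology_basis') auto
    have SV: "x \<in> V" if "x \<in> S" "x \<in> Esp m" for x
      using that unfolding S_def by (auto simp: dist_real_def abs_minus_commute intro: less_imp_le)
    have HS: "x \<in> S" if x: "x \<in> Esp m" "p x = 0" for x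
    proof -
      have h: "\<exists>i\<in>I. x i = 0" using x(2) p0 by simp
      obtain e where e: "e > 0" "\<forall>y\<in>Esp m. (\<forall>i<m. \<bar>y i - x i\<bar> \<le> e) \<longrightarrow> y \<in> V" using H[OF x(1) h] by blast
      show ?thesis unfolding S_def using x(1) h e by (intro UN_I[of x] UN_I[of e]) auto
    qed
    define K where "K = {y. \<forall>i. y i \<in> {(if i < m then - real k else 0)..(if i < m then real k else 0)}} - S"
    have K: "compact K" unfolding K_def by (rule compact_diff[OF compact_box S])
    have KE: "y \<in> Esp m" if "y \<in> K" for y
    proof -
      have "y i = 0" if "i \<ge> m" for i
        using \<open>y \<in> K\<close> that unfolding K_def by (auto dest: spec[of _ i])
      then show ?thesis by (simp add: Esp_iff)
    qed
    have Kmem: "x \<in> K" if "x \<in> Esp m" "\<forall>i<m. \<bar>x i\<bar> \<le> real k" "x \<notin> V" for x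
      using that SV by (auto simp: K_def Esp_iff abs_le_iff)
    show ?thesis
    proof (cases "K = {}")
      case True
      then show ?thesis using Kmem by (intro exI[of _ 0]) auto
    next
      case False
      have "continuous_on K (\<lambda>x. (p x)\<^sup>2)" unfolding p_def by (intro continuous_intros)
      from continuous_attains_inf[OF K False this]
      obtain y where y: "y \<in> K" "\<And>x. x \<in> K \<Longrightarrow> (p y)\<^sup>2 \<le> (p x)\<^sup>2" by blast
      have "p y \<noteq> 0" using HS[OF KE[OF y(1)]] y(1) by (auto simp: K_def)
      then have py: "(p y)\<^sup>2 > 0" by simp
      have "1 \<le> 1 / (p y)\<^sup>2 * (p x)\<^sup>2" if "x \<in> Esp m" "\<forall>i<m. \<bar>x i\<bar> \<le> real k" "x \<notin> V" for x
        using y(2)[OF Kmem[OF that]] py by (simp add: field_simps)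
      then show ?thesis using py by (intro exI[of _ "1 / (p y)\<^sup>2"]) auto
    qed
  qed
  then obtain M where M: "\<And>k. M k \<ge> 0"
    "\<And>k x. x \<in> Esp m \<Longrightarrow> (\<forall>i<m. \<bar>x i\<bar> \<le> real k) \<Longrightarrow> x \<notin> V \<Longrightarrow> 1 \<le> M k * (p x)\<^sup>2" by metis
  \<comment> \<open>Chosen so that \<open>(p x)^2 * (c k * bump 1)\<close> is at least
    \<open>k / e0\<close> at points of the \<open>k\<close>-th box outside \<open>V\<close>.\<close>
  define c where "c k = real k / e0 * M k / bump 1" for k
  have b1: "bump 1 > 0" by simp
  have c: "c k \<ge> 0" for k unfolding c_def using e0(1) M(1) b1 by (intro divide_nonneg_nonneg mult_nonneg_nonneg) auto
  define g where "g x = 1 / (1 + (p x)\<^sup>2 * dominate c (s x))" for x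
  have den: "1 + (p x)\<^sup>2 * dominate c (s x) \<ge> 1" for x using dominate_nonneg[OF c] by simp
  have "smooth_on m (Esp m) s" unfolding s_def
    by (intro smooth_on_sum smooth_on_power smooth_on_coord eopen_Esp) simp
  then have gs: "smooth_on m (Esp m) g" unfolding g_def p_def
    using den[unfolded p_def]
    by (intro smooth_on_divide smooth_on_add smooth_on_mult smooth_on_dominate smooth_on_power smooth_on_prod
        smooth_on_coord smooth_on_const eopen_Esp I) (auto simp: less_imp_neq[OF less_le_trans[OF zero_less_one], symmetric])
  have g1: "g x = 1" if "\<exists>i\<in>I. x i = 0" for x
    using that unfolding p0[symmetric] by (simp add: g_def)
  have g01: "g x \<in> {0..1}" for x using den[of x] by (simp add: g_def)
  have gV: "(\<lambda>i. g x * x i) \<in> V" if x: "x \<in> Esp m" for x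
  proof (cases "x \<in> V")
    case False
    \<comment> \<open>The bound \<open>s x + 1 \<le> k\<close> puts \<open>x\<close> into the
      \<open>k\<close>-th box, since the absolute value of a number is at most its square plus 1;
      the bound \<open>k \<le> s x + 2\<close> is the range of \<open>dominate_ge\<close>.\<close>
    define k where "k = nat \<lceil>s x + 1\<rceil>"
    have s0: "s x \<ge> 0" unfolding s_def by (intro sum_nonneg) simp
    then have k: "s x + 1 \<le> real k" "real k \<le> s x + 2" unfolding k_def by linarith+
    have xk: "\<bar>x i\<bar> \<le> real k" if "i < m" for i
    proof -
      have "(x i)\<^sup>2 \<le> s x" unfolding s_def using that by (intro member_le_sum) auto
      moreover have "\<bar>x i\<bar> \<le> (x i)\<^sup>2 + 1"
      proof -
        have "0 \<le> (\<bar>x i\<bar> - 1)\<^sup>2" by simp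
        then have "2 * \<bar>x i\<bar> \<le> (x i)\<^sup>2 + 1" by (simp add: power2_diff)
        then show ?thesis by simp
      qed
      ultimately show ?thesis using k(1) by linarith
    qed
    have "1 \<le> M k * (p x)\<^sup>2" by (rule M(2)[OF x _ False]) (use xk in blast)
    then have "real k / e0 * 1 \<le> real k / e0 * (M k * (p x)\<^sup>2)"
      using e0(1) by (intro mult_left_mono) auto
    also have "\<dots> = (p x)\<^sup>2 * (c k * bump 1)" using b1 by (simp add: c_def)
    also have "\<dots> \<le> (p x)\<^sup>2 * dominate c (s x)"
      by (intro mult_left_mono dominate_ge c k) simp
    finally have le: "1 + real k / e0 \<le> 1 + (p x)\<^sup>2 * dominate c (s x)" by simp
    have kp: "real k > 0" using k(1) s0 by simp
    have "g x \<le> 1 / (1 + real k / e0)"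
      unfolding g_def using le e0(1) kp by (intro divide_left_mono mult_pos_pos add_pos_nonneg) (use den[of x] in auto)
    also have "\<dots> \<le> e0 / real k" using e0(1) kp by (simp add: field_simps)
    finally have gx: "g x \<le> e0 / real k" .
    have "\<bar>g x * x i\<bar> \<le> e0" if "i < m" for i
    proof -
      have "\<bar>g x * x i\<bar> = g x * \<bar>x i\<bar>" using g01[of x] by (simp add: abs_mult)
      also have "\<dots> \<le> e0 / real k * real k" using gx xk[OF that] g01[of x] e0(1) kp by (intro mult_mono) auto
      finally show ?thesis using kp by simp
    qed
    then show ?thesis using x by (intro e0(2)) (auto simp: Esp_iff)
  qed (rule V[OF _ g01])
  show ?thesis by (rule that[OF gs _ gV]) (simp add: g1)
qed

section \<open>Extending families from the coordinate hyperplanes\<close>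

lemma test_plot_upd:
  assumes "test_plot X m q V u \<xi>"
  shows "test_plot X m q V (\<lambda>v. (u v)(i := 0)) \<xi>"
proof -
  have V: "eopen q V" using assms by (simp add: test_plot_def)
  have "smooth_on q V (\<lambda>v. ((u v)(i := 0)) j)" for j
    using assms smooth_on_const[OF V, of 0] by (cases "j = i") (simp_all add: test_plot_def)
  then show ?thesis using assms unfolding test_plot_def by (auto simp: Esp_iff)
qed

definition loc_finite :: "nat \<Rightarrow> (nat \<Rightarrow> real) set \<Rightarrow> ((nat \<Rightarrow> real) \<Rightarrow> nat \<Rightarrow> nat \<Rightarrow> real) \<Rightarrow> bool" where
  "loc_finite q V Y \<longleftrightarrow> (\<forall>v\<in>V. \<exists>V0 J. nbhd q V v V0 \<and> (\<forall>w\<in>V0. zero_from J (Y w)))"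

lemma loc_finite_combine:
  assumes "loc_finite q V A" "loc_finite q V B" "loc_finite q V C"
  shows "loc_finite q V (\<lambda>v j c. A v j c + (B v j c - C v j c))"
  unfolding loc_finite_def
proof
  fix v assume v: "v \<in> V"
  obtain V1 J1 where 1: "eopen q V1" "v \<in> V1" "V1 \<subseteq> V" "\<forall>w\<in>V1. zero_from J1 (A w)"
    using assms(1) v unfolding loc_finite_def by meson
  obtain V2 J2 where 2: "eopen q V2" "v \<in> V2" "V2 \<subseteq> V" "\<forall>w\<in>V2. zero_from J2 (B w)"
    using assms(2) v unfolding loc_finite_def by meson
  obtain V3 J3 where 3: "eopen q V3" "v \<in> V3" "V3 \<subseteq> V" "\<forall>w\<in>V3. zero_from J3 (C w)"
    using assms(3) v unfolding loc_finite_def by meson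
  let ?J = "max J1 (max J2 J3)"
  have "zero_from ?J (\<lambda>j c. A w j c + (B w j c - C w j c))" if "w \<in> V1 \<inter> V2 \<inter> V3" for w
  proof -
    have "zero_from J1 (A w)" "zero_from J2 (B w)" "zero_from J3 (C w)" using that 1(4) 2(4) 3(4) by auto
    then show ?thesis by (simp add: zero_from_def)
  qed
  moreover have "eopen q (V1 \<inter> V2 \<inter> V3)" using 1 2 3 by (intro openin_Int)
  ultimately show "\<exists>V0 J. nbhd q V v V0 \<and> (\<forall>w\<in>V0. zero_from J (\<lambda>j c. A w j c + (B w j c - C w j c)))"
    using 1(2,3) 2(2) 3(2) by (intro exI[of _ "V1 \<inter> V2 \<inter> V3"] exI[of _ ?J]) auto
qed

lemma smooth_seq_combine:
  "eopen q V \<Longrightarrow> smooth_seq q V A \<Longrightarrow> smooth_seq q V B \<Longrightarrow> smooth_seq q V C \<Longrightarrow> smooth_seq q V (\<lambda>v j c. A v j c + (B v j c - C v j c))"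
  unfolding smooth_seq_def by (intro allI smooth_on_add smooth_on_diff) auto

text \<open>Local finiteness is demanded along with smoothness: entrywise smoothness in R^infinity
  would not bound the number of stages of the retraction near a point.\<close>

definition smooth_embedded :: "'a diffeology \<Rightarrow> nat \<Rightarrow> ((nat \<Rightarrow> real) \<Rightarrow> 'a \<Rightarrow> nat \<Rightarrow> nat \<Rightarrow> real) \<Rightarrow> bool" where
  "smooth_embedded X m G \<longleftrightarrow> (\<forall>q V u \<xi>. test_plot X m q V u \<xi> \<longrightarrow>
     smooth_seq q V (\<lambda>v. G (u v) (\<xi> v)) \<and> loc_finite q V (\<lambda>v. G (u v) (\<xi> v)))"

definition (in smooth_manifold) smooth_param :: "'a diffeology \<Rightarrow> nat \<Rightarrow> ((nat \<Rightarrow> real) \<Rightarrow> 'a \<Rightarrow> 'b) \<Rightarrow> bool" where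
  "smooth_param X m F \<longleftrightarrow> (\<forall>q V u \<xi>. test_plot X m q V u \<xi> \<longrightarrow> mplot q V (\<lambda>v. F (u v) (\<xi> v)))"

text \<open>The last clause, for one parameter \<open>z\<close> at a time, is what preserves base
  points: taken at the chosen point of \<open>X\<close>, it makes the extension of pointed families
  pointed.\<close>

definition (in smooth_manifold) extends_faces :: "'a diffeology \<Rightarrow> nat \<Rightarrow> (nat \<Rightarrow> (nat \<Rightarrow> real) \<Rightarrow> 'a \<Rightarrow> 'b)
    \<Rightarrow> nat set \<Rightarrow> ((nat \<Rightarrow> real) \<Rightarrow> 'a \<Rightarrow> 'b) \<Rightarrow> bool" where
  "extends_faces X m f I F \<longleftrightarrow> smooth_param X m F \<and>
    (\<forall>i\<in>I. \<forall>x\<in>Esp m. \<forall>z\<in>points X. x i = 0 \<longrightarrow> F x z = f i x z) \<and>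
    (\<forall>z\<in>points X. \<forall>b. (\<forall>i\<in>I. \<forall>x\<in>Esp m. f i x z = b) \<longrightarrow> (\<forall>x\<in>Esp m. F x z = b))"

lemma (in smooth_manifold) smooth_param_topspace:
  assumes "diffeological_space X" "smooth_param X m F" "x \<in> Esp m" "z \<in> points X"
  shows "F x z \<in> topspace T"
proof -
  have "mplot m (Esp m) (\<lambda>v. F v ((\<lambda>v\<in>Esp m. z) v))"
    using assms(2) diffeological_space.test_plot_const[OF assms(1,4), of m] unfolding smooth_param_def by blast
  from mplot_topspace[OF this assms(3)] show ?thesis using assms(3) by simp
qed

context chart_family
begin

text \<open>The induction starts from the zero family, which is not the image of a point, so
  constancy can be claimed only for \<open>I \<noteq> {}\<close>. Recording that the start is zero
  makes the family for a single hyperplane equal to \<open>embed b\<close> when its face is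
  constantly \<open>b\<close>.\<close>

definition linear_extends :: "'a diffeology \<Rightarrow> nat \<Rightarrow> (nat \<Rightarrow> (nat \<Rightarrow> real) \<Rightarrow> 'a \<Rightarrow> 'b) \<Rightarrow> nat set
    \<Rightarrow> ((nat \<Rightarrow> real) \<Rightarrow> 'a \<Rightarrow> nat \<Rightarrow> nat \<Rightarrow> real) \<Rightarrow> bool" where
  "linear_extends X m f I G \<longleftrightarrow> smooth_embedded X m G \<and>
    (\<forall>i\<in>I. \<forall>x\<in>Esp m. \<forall>z\<in>points X. x i = 0 \<longrightarrow> G x z = embed (f i x z)) \<and>
    (I = {} \<longrightarrow> G = (\<lambda>x z j c. 0)) \<and>
    (\<forall>z b. I \<noteq> {} \<longrightarrow> (\<forall>i\<in>I. \<forall>x\<in>Esp m. f i x z = b) \<longrightarrow> (\<forall>x\<in>Esp m. G x z = embed b))"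

text \<open>At \<open>x i = 0\<close> the correction replaces \<open>G x\<close> by the new face
  value. At \<open>x j = 0\<close> for an earlier \<open>j\<close>, the point
  \<open>x(i := 0)\<close> lies on both hyperplanes, so the correction is zero by compatibility and
  the old value persists.\<close>

lemma linear_extension:
  assumes "finite I"
    and "\<And>i. i \<in> I \<Longrightarrow> smooth_param X m (f i)"
    and "\<And>i j x z. i \<in> I \<Longrightarrow> j \<in> I \<Longrightarrow> x \<in> Esp m \<Longrightarrow> z \<in> points X \<Longrightarrow> x i = 0 \<Longrightarrow> x j = 0 \<Longrightarrow> f i x z = f j x z"
  shows "\<exists>G. linear_extends X m f I G"
  using assms
proof (induction I)
  case empty
  have "smooth_embedded X m (\<lambda>x z j c. 0)"
    unfolding smooth_embedded_def smooth_seq_def loc_finite_def test_plot_def zero_from_def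
    using smooth_on_const by blast
  then show ?case unfolding linear_extends_def by (intro exI[of _ "\<lambda>x z j c. 0"]) simp
next
  case (insert i I)
  have "\<exists>G. linear_extends X m f I G"
    by (rule insert.IH) (use insert.prems in blast)+
  then obtain G where G0: "linear_extends X m f I G"
    by (rule exE)
  note G0 = G0[unfolded linear_extends_def]
  have G1: "smooth_embedded X m G" by (rule G0[THEN conjunct1])
  have G2: "\<And>j x z. j \<in> I \<Longrightarrow> x \<in> Esp m \<Longrightarrow> z \<in> points X \<Longrightarrow> x j = 0 \<Longrightarrow> G x z = embed (f j x z)"
    by (rule G0[THEN conjunct2, THEN conjunct1, rule_format])
  have G3: "I = {} \<Longrightarrow> G = (\<lambda>x z j c. 0)"
    by (rule G0[THEN conjunct2, THEN conjunct2, THEN conjunct1, THEN mp])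
  have G4: "\<And>z b x. I \<noteq> {} \<Longrightarrow> (\<forall>i\<in>I. \<forall>x\<in>Esp m. f i x z = b) \<Longrightarrow> x \<in> Esp m \<Longrightarrow> G x z = embed b"
    using G0[THEN conjunct2, THEN conjunct2, THEN conjunct2] by blast
  define G' where "G' x z j c = G x z j c + (embed (f i (x(i := 0)) z) j c - G (x(i := 0)) z j c)" for x z j c
  have upd: "x(i := 0) \<in> Esp m" if "x \<in> Esp m" for x using that by (simp add: Esp_iff)
  show ?case
    unfolding linear_extends_def
  proof (intro exI[of _ G'] conjI impI allI ballI)
    show "smooth_embedded X m G'"
      unfolding smooth_embedded_def
    proof (intro allI impI)
      fix q V u \<xi> assume t: "test_plot X m q V u \<xi>"
      have V: "eopen q V" using t by (simp add: test_plot_def)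
      have t': "test_plot X m q V (\<lambda>v. (u v)(i := 0)) \<xi>" by (rule test_plot_upd[OF t])
      have A: "smooth_seq q V (\<lambda>v. G (u v) (\<xi> v))" "loc_finite q V (\<lambda>v. G (u v) (\<xi> v))"
        using G1 t unfolding smooth_embedded_def by blast+
      have C: "smooth_seq q V (\<lambda>v. G ((u v)(i := 0)) (\<xi> v))" "loc_finite q V (\<lambda>v. G ((u v)(i := 0)) (\<xi> v))"
        using G1 t' unfolding smooth_embedded_def by blast+
      have "smooth_param X m (f i)" by (rule insert.prems(1)) simp
      then have p: "mplot q V (\<lambda>v. f i ((u v)(i := 0)) (\<xi> v))" using t' unfolding smooth_param_def by blast
      have B: "smooth_seq q V (\<lambda>v. embed (f i ((u v)(i := 0)) (\<xi> v)))" by (rule embed_smooth_seq[OF V p])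
      have B': "loc_finite q V (\<lambda>v. embed (f i ((u v)(i := 0)) (\<xi> v)))"
        unfolding loc_finite_def using embed_locally_finite[OF p] by blast
      show "smooth_seq q V (\<lambda>v. G' (u v) (\<xi> v)) \<and> loc_finite q V (\<lambda>v. G' (u v) (\<xi> v))"
        using smooth_seq_combine[OF V A(1) B C(1)] loc_finite_combine[OF A(2) B' C(2)]
        unfolding G'_def by blast
    qed
    fix j x z assume j: "j \<in> insert i I" and x: "x \<in> Esp m" and z: "z \<in> points X" and xj: "x j = 0"
    show "G' x z = embed (f j x z)"
    proof (cases "j = i")
      case True
      then have xx: "x(i := 0) = x" using xj by auto
      show ?thesis unfolding True by (intro ext) (simp only: G'_def xx)
    next
      case False
      then have jI: "j \<in> I" using j by simp
      have xu: "(x(i := 0)) j = 0" "(x(i := 0)) i = 0" using xj by simp_all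
      have ij: "f i (x(i := 0)) z = f j (x(i := 0)) z"
        by (rule insert.prems(2)[OF _ _ upd[OF x] z xu(2,1)]) (use jI in auto)
      have "embed (f i (x(i := 0)) z) = G (x(i := 0)) z"
        unfolding ij by (rule G2[OF jI upd[OF x] z xu(1), symmetric])
      then show ?thesis using G2[OF jI x z xj] by (simp add: G'_def fun_eq_iff)
    qed
  next
    fix z b x assume b: "\<forall>j\<in>insert i I. \<forall>x\<in>Esp m. f j x z = b" and x: "x \<in> Esp m"
    have fi: "f i (x(i := 0)) z = b" using b upd[OF x] by simp
    show "G' x z = embed b"
    proof (cases "I = {}")
      case True
      then show ?thesis using fi G3 by (simp add: G'_def fun_eq_iff)
    next
      case False
      have "G x z = embed b" "G (x(i := 0)) z = embed b" using G4[OF False] b x upd[OF x] by auto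
      then show ?thesis using fi by (simp add: G'_def fun_eq_iff)
    qed
  qed simp
qed

lemma compact_extension:
  assumes X: "diffeological_space X" "compact_space (D_topology X)"
    and I: "finite I" "I \<noteq> {}"
    and f: "\<And>i. i \<in> I \<Longrightarrow> smooth_param X m (f i)"
    and compat: "\<And>i j x z. i \<in> I \<Longrightarrow> j \<in> I \<Longrightarrow> x \<in> Esp m \<Longrightarrow> z \<in> points X \<Longrightarrow> x i = 0 \<Longrightarrow> x j = 0 \<Longrightarrow> f i x z = f j x z"
  shows "\<exists>F. extends_faces X m f I F"
proof -
  obtain G where G0: "linear_extends X m f I G"
    using linear_extension[OF I(1) f compat] by (rule exE)
  note G0 = G0[unfolded linear_extends_def]
  have G1: "smooth_embedded X m G" by (rule G0[THEN conjunct1])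
  have G2: "\<And>i x z. i \<in> I \<Longrightarrow> x \<in> Esp m \<Longrightarrow> z \<in> points X \<Longrightarrow> x i = 0 \<Longrightarrow> G x z = embed (f i x z)"
    by (rule G0[THEN conjunct2, THEN conjunct1, rule_format])
  have G3: "\<And>z b x. (\<forall>i\<in>I. \<forall>x\<in>Esp m. f i x z = b) \<Longrightarrow> x \<in> Esp m \<Longrightarrow> G x z = embed b"
    using G0[THEN conjunct2, THEN conjunct2, THEN conjunct2] I(2) by blast
  define P where "P x z \<longleftrightarrow> retr_dom (G x z)" for x z
  have retr: "eopen q {v \<in> V. P (u v) (\<xi> v)} \<and> mplot q {v \<in> V. P (u v) (\<xi> v)} (\<lambda>v. retr (G (u v) (\<xi> v)))"
    if t: "test_plot X m q V u \<xi>" for q V u \<xi>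
    unfolding P_def
  proof (rule retr_smooth)
    show "eopen q V" using t by (simp add: test_plot_def)
    show "smooth_seq q V (\<lambda>v. G (u v) (\<xi> v))" using G1 t unfolding smooth_embedded_def by blast
    have "loc_finite q V (\<lambda>v. G (u v) (\<xi> v))" using G1 t unfolding smooth_embedded_def by blast
    then show "\<exists>V0 J. nbhd q V v V0 \<and> (\<forall>w\<in>V0. zero_from J (G (u w) (\<xi> w)))" if "v \<in> V" for v
      using that unfolding loc_finite_def by blast
  qed
  have DP: "Dopen X m P" unfolding Dopen_def using retr by blast
  have fT: "f i x z \<in> topspace T" if "i \<in> I" "x \<in> Esp m" "z \<in> points X" for i x z
    by (rule smooth_param_topspace[OF X(1) f[OF that(1)] that(2,3)])
  have PH: "P x z" if "i \<in> I" "x i = 0" "x \<in> Esp m" "z \<in> points X" for i x z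
    using G2[OF that(1,3,4,2)] retr_embed(1)[OF fT[OF that(1,3,4)]] by (simp add: P_def)
  \<comment> \<open>Quantifying over the whole segment makes \<open>V\<close> closed under scaling
    by [0,1]; the set of \<open>x\<close> with \<open>P x z\<close> for all \<open>z\<close> need
    not be.\<close>
  define V where "V = {x \<in> Esp m. \<forall>t\<in>{0..1}. \<forall>z\<in>points X. P (\<lambda>i. t * x i) z}"
  obtain g where g: "smooth_on m (Esp m) g" "\<And>x. x \<in> Esp m \<Longrightarrow> \<exists>i\<in>I. x i = 0 \<Longrightarrow> g x = 1"
    "\<And>x. x \<in> Esp m \<Longrightarrow> (\<lambda>i. g x * x i) \<in> V"
  proof (rule hyperplane_shrink[OF I, of V m])
    fix x :: "nat \<Rightarrow> real" and s :: real assume x: "x \<in> V" and s: "s \<in> {0..1}"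
    have "P (\<lambda>i. t * (s * x i)) z" if t: "t \<in> {0..1}" and z: "z \<in> points X" for t z
    proof -
      have "t * s \<in> {0..1}" using s t by (auto intro: mult_le_one)
      then have "P (\<lambda>i. (t * s) * x i) z" using x z unfolding V_def by blast
      then show ?thesis by (simp add: mult.assoc)
    qed
    then show "(\<lambda>i. s * x i) \<in> V" using x by (simp add: V_def Esp_iff)
  next
    fix x0 assume x0: "x0 \<in> Esp m" and "\<exists>i\<in>I. x0 i = 0"
    then obtain i where i: "i \<in> I" "x0 i = 0" by blast
    have "P (\<lambda>i. t * x0 i) z" if "z \<in> points X" "t \<in> {0..1}" for z t
      by (rule PH[OF i(1) _ _ that(1)]) (use i(2) x0 in \<open>auto simp: Esp_iff\<close>)
    from diffeological_space.star_neighbourhood[OF X DP x0 this]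
    show "\<exists>e>0. \<forall>x\<in>Esp m. (\<forall>i<m. \<bar>x i - x0 i\<bar> \<le> e) \<longrightarrow> x \<in> V" unfolding V_def by blast
  qed (rule that)
  define h where "h x = (\<lambda>i. g x * x i)" for x :: "nat \<Rightarrow> real"
  have hE: "h x \<in> Esp m" if "x \<in> Esp m" for x using that by (simp add: h_def Esp_iff)
  have hP: "P (h x) z" if "x \<in> Esp m" "z \<in> points X" for x z
  proof -
    have "P (\<lambda>i. 1 * h x i) z" using g(3)[OF that(1)] that(2) unfolding V_def h_def by fastforce
    then show ?thesis by simp
  qed
  show ?thesis
    unfolding extends_faces_def
  proof (intro exI[of _ "\<lambda>x z. retr (G (h x) z)"] conjI ballI allI impI)
    show "smooth_param X m (\<lambda>x z. retr (G (h x) z))"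
      unfolding smooth_param_def
    proof (intro allI impI)
      fix q V u \<xi> assume t: "test_plot X m q V u \<xi>"
      have V: "eopen q V" and u: "\<And>v. v \<in> V \<Longrightarrow> u v \<in> Esp m" "\<And>j. smooth_on q V (\<lambda>v. u v j)"
        and \<xi>: "\<xi> \<in> plots X q V" using t by (auto simp: test_plot_def)
      have gu: "smooth_on q V (\<lambda>v. g (u v))" by (rule smooth_on_comp[OF V eopen_Esp u(1) g(1) u(2)])
      have "smooth_on q V (\<lambda>v. h (u v) j)" for j
        unfolding h_def by (rule smooth_on_mult[OF V gu u(2)])
      then have t': "test_plot X m q V (\<lambda>v. h (u v)) \<xi>"
        using V \<xi> hE u(1) by (simp add: test_plot_def)
      have "{v \<in> V. P (h (u v)) (\<xi> v)} = V"
        using hP u(1) diffeological_space.plot_in[OF X(1) V \<xi>] by blast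
      then show "mplot q V (\<lambda>v. retr (G (h (u v)) (\<xi> v)))" using retr[OF t'] by simp
    qed
  next
    fix i x z assume i: "i \<in> I" and x: "x \<in> Esp m" and z: "z \<in> points X" and xi: "x i = 0"
    have "g x = 1" by (rule g(2)[OF x]) (use i xi in blast)
    then have "h x = x" by (simp add: h_def)
    then show "retr (G (h x) z) = f i x z"
      using G2[OF i x z xi] retr_embed(2)[OF fT[OF i x z]] by simp
  next
    fix z b x assume z: "z \<in> points X" and b: "\<forall>i\<in>I. \<forall>x\<in>Esp m. f i x z = b" and x: "x \<in> Esp m"
    obtain i where i: "i \<in> I" using I(2) by blast
    have "b \<in> topspace T" using fT[OF i x z] b i x by simp
    then show "retr (G (h x) z) = b" using G3[OF b hE[OF x]] retr_embed(2) by simp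
  qed
qed

end

text \<open>A \<open>chart_family\<close> has a chart with a bump function at every index, so the
  empty manifold is treated apart. Then \<open>X\<close> is empty too, because the face families
  take values in \<open>T\<close>.\<close>

lemma (in smooth_manifold) extension:
  assumes X: "diffeological_space X" "compact_space (D_topology X)"
    and I: "finite I" "I \<noteq> {}"
    and f: "\<And>i. i \<in> I \<Longrightarrow> smooth_param X m (f i)"
    and compat: "\<And>i j x z. i \<in> I \<Longrightarrow> j \<in> I \<Longrightarrow> x \<in> Esp m \<Longrightarrow> z \<in> points X \<Longrightarrow> x i = 0 \<Longrightarrow> x j = 0 \<Longrightarrow> f i x z = f j x z"
  shows "\<exists>F. extends_faces X m f I F"
proof (cases "topspace T = {}")
  case True
  obtain i where i: "i \<in> I" using I(2) by blast
  have "(\<lambda>i. 0) \<in> Esp m" by (simp add: Esp_iff)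
  then have "points X = {}" using smooth_param_topspace[OF X(1) f[OF i]] True by blast
  then have "smooth_param X m (\<lambda>x z. undefined)"
    unfolding smooth_param_def test_plot_def mplot_def
    using diffeological_space.plot_in[OF X(1)] by blast
  with \<open>points X = {}\<close> show ?thesis unfolding extends_faces_def by blast
next
  case False
  then obtain U W phi lam where "chart_family d T \<A> U W phi lam" using ex_chart_family by blast
  from chart_family.compact_extension[OF this X I, of m f] f compat show ?thesis by blast
qed

section \<open>Mapping spaces\<close>

lemma smooth_map_cong:
  "eopen m V \<Longrightarrow> (\<And>v. v \<in> V \<Longrightarrow> f v = g v) \<Longrightarrow> smooth_map m V n U f \<longleftrightarrow> smooth_map m V n U g"
  unfolding smooth_map_iff using smooth_on_cong[of m V "\<lambda>v. f v _" "\<lambda>v. g v _"] by (simp add: Pi_iff)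

lemma smooth_map_restrict: "eopen m V \<Longrightarrow> smooth_map m V n U (restrict f V) \<longleftrightarrow> smooth_map m V n U f"
  by (rule smooth_map_cong) (simp_all add: restrict_def)

lemma smooth_map_id: "eopen m V \<Longrightarrow> V \<subseteq> U \<Longrightarrow> smooth_map m V m U (\<lambda>v. v)"
  unfolding smooth_map_iff using smooth_on_coord by auto

lemma smooth_map_const: "eopen m V \<Longrightarrow> a \<in> U \<Longrightarrow> smooth_map m V n U (\<lambda>v. a)"
  unfolding smooth_map_iff using smooth_on_const by auto

lemma smooth_map_comp:
  assumes "eopen m V" "eopen n U" "smooth_map m V n U f" "smooth_map n U k W g"
  shows "smooth_map m V k W (\<lambda>v. g (f v))"
  unfolding smooth_map_iff
proof (intro conjI allI impI)
  show "(\<lambda>v. g (f v)) \<in> V \<rightarrow> W" using assms(3,4) by (auto simp: smooth_map_iff)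
  fix j assume "j < k"
  then show "smooth_on m V (\<lambda>v. g (f v) j)"
    using assms by (intro smooth_on_comp[OF assms(1,2), of f "\<lambda>x. g x j"]) (auto simp: smooth_map_iff)
qed

lemma smooth_map_subset: "smooth_map m V n U f \<Longrightarrow> eopen m V \<Longrightarrow> V' \<subseteq> V \<Longrightarrow> f \<in> V' \<rightarrow> U' \<Longrightarrow> smooth_map m V' n U' f"
  unfolding smooth_map_iff using smooth_on_subset by blast

lemma (in diffeological_space) plot_restrict:
  assumes "eopen n U" "p \<in> plots X n U" "eopen n V" "V \<subseteq> U"
  shows "restrict p V \<in> plots X n V"
  using plot_compose[OF assms(1,3,2) smooth_map_id[OF assms(3,4)]] by (simp add: compose_def restrict_def)

lemma points_mapping_space [simp]: "points (mapping_space X Y) = smooth_maps X Y"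
  by (simp add: mapping_space_def)

lemma smooth_mapsD:
  assumes "f \<in> smooth_maps X Y"
  shows "f \<in> points X \<rightarrow>\<^sub>E points Y" "\<And>n U p. eopen n U \<Longrightarrow> p \<in> plots X n U \<Longrightarrow> compose U f p \<in> plots Y n U"
  using assms by (auto simp: smooth_maps_def)

text \<open>A plot of the product of \<open>U\<close> and \<open>X\<close> amounts to a smooth map
  into \<open>U\<close> together with a plot of \<open>X\<close>. Quantifying over such pairs
  replaces the nested product and sub-diffeologies in what follows.\<close>

lemma mapping_space_plot_iff:
  assumes X: "diffeological_space X" and U: "eopen n U"
  shows "P \<in> plots (mapping_space X Y) n U \<longleftrightarrow> P \<in> U \<rightarrow>\<^sub>E smooth_maps X Y \<and>
    (\<forall>q V u \<xi>. eopen q V \<longrightarrow> smooth_map q V n U u \<longrightarrow> \<xi> \<in> plots X q V \<longrightarrow> (\<lambda>v\<in>V. P (u v) (\<xi> v)) \<in> plots Y q V)"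
    (is "?L \<longleftrightarrow> ?M \<and> ?R")
proof -
  let ?E = "sub_diffeology (euclidean_diffeology n) U"
  define A where "A = restrict (\<lambda>(u, x). P u x) (U \<times> points X)"
  have pE: "points ?E = U" using eopen_subset[OF U] by (auto simp: sub_diffeology_def euclidean_diffeology_def)
  have plE: "w \<in> plots ?E q V \<longleftrightarrow> w \<in> extensional V \<and> smooth_map q V n U w" for q V w
    using eopen_subset[OF U]
    by (auto simp: sub_diffeology_def euclidean_diffeology_def smooth_map_iff PiE_def)
  have L: "?L \<longleftrightarrow> ?M \<and> A \<in> smooth_maps (prod_diffeology ?E X) Y"
    by (simp add: mapping_space_def A_def)
  have "A \<in> smooth_maps (prod_diffeology ?E X) Y \<longleftrightarrow> ?R" if M: "?M"
  proof
    assume A: "A \<in> smooth_maps (prod_diffeology ?E X) Y"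
    show ?R
    proof (intro allI impI)
      fix q V u \<xi> assume V: "eopen q V" and u: "smooth_map q V n U u" and \<xi>: "\<xi> \<in> plots X q V"
      have uU: "u v \<in> U" if "v \<in> V" for v using u that by (auto simp: smooth_map_iff)
      have \<xi>X: "\<xi> \<in> V \<rightarrow>\<^sub>E points X" using diffeological_space.plots_subset[OF X V] \<xi> by blast
      define w where "w = (\<lambda>v\<in>V. (u v, \<xi> v))"
      have "compose V fst w = restrict u V" by (auto simp: compose_def w_def)
      moreover have "compose V snd w = \<xi>" using \<xi>X by (auto simp: compose_def w_def fun_eq_iff PiE_def extensional_def)
      moreover have "restrict u V \<in> plots ?E q V" using u V by (simp add: plE smooth_map_restrict)
      ultimately have "w \<in> plots (prod_diffeology ?E X) q V"
        using \<xi> uU \<xi>X by (auto simp: prod_diffeology_def pE w_def PiE_iff)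
      from smooth_mapsD(2)[OF A V this] have "compose V A w \<in> plots Y q V" .
      moreover have "compose V A w = (\<lambda>v\<in>V. P (u v) (\<xi> v))"
        using uU \<xi>X by (auto simp: compose_def w_def A_def fun_eq_iff)
      ultimately show "(\<lambda>v\<in>V. P (u v) (\<xi> v)) \<in> plots Y q V" by simp
    qed
  next
    assume R: ?R
    show "A \<in> smooth_maps (prod_diffeology ?E X) Y"
      unfolding smooth_maps_def
    proof (intro CollectI conjI allI impI ballI)
      have "P u x \<in> points Y" if "u \<in> U" "x \<in> points X" for u x
        using M that smooth_mapsD(1)[of "P u" X Y] by blast
      then show "A \<in> points (prod_diffeology ?E X) \<rightarrow>\<^sub>E points Y"
        unfolding A_def by (auto simp: prod_diffeology_def pE)
      fix q V w assume V: "eopen q V" and w: "w \<in> plots (prod_diffeology ?E X) q V"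
      have wp: "w \<in> V \<rightarrow>\<^sub>E U \<times> points X" "compose V fst w \<in> plots ?E q V" "compose V snd w \<in> plots X q V"
        using w unfolding prod_diffeology_def pE by auto
      have "smooth_map q V n U (compose V fst w)" using wp(2) unfolding plE by blast
      from R[rule_format, OF V this wp(3)]
      have "(\<lambda>v\<in>V. P (compose V fst w v) (compose V snd w v)) \<in> plots Y q V" .
      moreover have "(\<lambda>v\<in>V. P (compose V fst w v) (compose V snd w v)) = compose V A w"
      proof
        fix v show "(\<lambda>v\<in>V. P (compose V fst w v) (compose V snd w v)) v = compose V A w v"
        proof (cases "v \<in> V")
          case True
          then have "w v \<in> U \<times> points X" using wp(1) by blast
          then show ?thesis using True by (auto simp: compose_def A_def split: prod.split)
        qed (simp add: compose_def)
      qed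
      ultimately show "compose V A w \<in> plots Y q V" by simp
    qed
  qed
  with L show ?thesis by blast
qed

lemma diffeological_mapping_space:
  assumes X: "diffeological_space X" and Y: "diffeological_space Y"
  shows "diffeological_space (mapping_space X Y)"
proof
  fix n U assume U: "eopen n U"
  show "plots (mapping_space X Y) n U \<subseteq> U \<rightarrow>\<^sub>E points (mapping_space X Y)"
    using mapping_space_plot_iff[OF X U] by auto
  fix f assume "f \<in> points (mapping_space X Y)"
  then have f: "f \<in> smooth_maps X Y" by simp
  show "(\<lambda>u\<in>U. f) \<in> plots (mapping_space X Y) n U"
    unfolding mapping_space_plot_iff[OF X U]
  proof (intro conjI allI impI)
    show "(\<lambda>u\<in>U. f) \<in> U \<rightarrow>\<^sub>E smooth_maps X Y" using f by auto
    fix q V u \<xi> assume V: "eopen q V" and u: "smooth_map q V n U u" and \<xi>: "\<xi> \<in> plots X q V"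
    have "compose V f \<xi> \<in> plots Y q V" by (rule smooth_mapsD(2)[OF f V \<xi>])
    moreover have "compose V f \<xi> = (\<lambda>v\<in>V. (\<lambda>u\<in>U. f) (u v) (\<xi> v))"
      using u by (auto simp: compose_def smooth_map_iff fun_eq_iff)
    ultimately show "(\<lambda>v\<in>V. (\<lambda>u\<in>U. f) (u v) (\<xi> v)) \<in> plots Y q V" by simp
  qed
next
  fix n U m V P g
  assume U: "eopen n U" and V: "eopen m V" and P: "P \<in> plots (mapping_space X Y) n U" and g: "smooth_map m V n U g"
  have gU: "g v \<in> U" if "v \<in> V" for v using g that by (auto simp: smooth_map_iff)
  note P' = P[unfolded mapping_space_plot_iff[OF X U]]
  show "compose V P g \<in> plots (mapping_space X Y) m V"
    unfolding mapping_space_plot_iff[OF X V]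
  proof (intro conjI allI impI)
    show "compose V P g \<in> V \<rightarrow>\<^sub>E smooth_maps X Y" using P' gU by (auto simp: compose_def)
    fix q S u \<xi> assume S: "eopen q S" and u: "smooth_map q S m V u" and \<xi>: "\<xi> \<in> plots X q S"
    have "(\<lambda>v\<in>S. P (g (u v)) (\<xi> v)) \<in> plots Y q S"
      using P' S \<xi> smooth_map_comp[OF S V u g] by blast
    moreover have "(\<lambda>v\<in>S. P (g (u v)) (\<xi> v)) = (\<lambda>v\<in>S. compose V P g (u v) (\<xi> v))"
      using u by (auto simp: compose_def smooth_map_iff fun_eq_iff)
    ultimately show "(\<lambda>v\<in>S. compose V P g (u v) (\<xi> v)) \<in> plots Y q S" by simp
  qed
next
  fix n U P \<V>
  assume U: "eopen n U" and P: "P \<in> U \<rightarrow>\<^sub>E points (mapping_space X Y)"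
    and \<V>: "\<And>V. V \<in> \<V> \<Longrightarrow> eopen n V" "\<Union>\<V> = U" "\<And>V. V \<in> \<V> \<Longrightarrow> restrict P V \<in> plots (mapping_space X Y) n V"
  show "P \<in> plots (mapping_space X Y) n U"
    unfolding mapping_space_plot_iff[OF X U]
  proof (intro conjI allI impI)
    show "P \<in> U \<rightarrow>\<^sub>E smooth_maps X Y" using P by simp
    fix q V u \<xi> assume V: "eopen q V" and u: "smooth_map q V n U u" and \<xi>: "\<xi> \<in> plots X q V"
    have uU: "u v \<in> U" if "v \<in> V" for v using u that by (auto simp: smooth_map_iff)
    have \<xi>X: "\<xi> v \<in> points X" if "v \<in> V" for v by (rule diffeological_space.plot_in[OF X V \<xi> that])
    \<comment> \<open>The cover of \<open>U\<close> is pulled back along \<open>u\<close> to a cover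
      of \<open>V\<close>, on which the locality axiom of \<open>Y\<close> applies.\<close>
    define S where "S W = {v \<in> V. u v \<in> W}" for W
    have S: "eopen q (S W)" if "W \<in> \<V>" for W
      unfolding S_def
    proof (rule eopen_preimage_Esp[OF V _ _ \<V>(1)[OF that]])
      show "u v \<in> Esp n" if "v \<in> V" for v using uU[OF that] eopen_subset[OF U] by blast
      show "continuous_on V (\<lambda>v. u v j)" if "j < n" for j
        using u that by (intro smooth_on_continuous[OF _ V]) (simp add: smooth_map_iff)
    qed
    show "(\<lambda>v\<in>V. P (u v) (\<xi> v)) \<in> plots Y q V"
    proof (rule diffeological_space.plot_local[OF Y V, where \<V> = "S ` \<V>"])
      have "P (u v) (\<xi> v) \<in> points Y" if "v \<in> V" for v
        using smooth_mapsD(1)[of "P (u v)" X Y] P uU[OF that] \<xi>X[OF that] by auto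
      then show "(\<lambda>v\<in>V. P (u v) (\<xi> v)) \<in> V \<rightarrow>\<^sub>E points Y" by auto
      show "\<Union> (S ` \<V>) = V" unfolding S_def using uU \<V>(2) by blast
      fix W' assume "W' \<in> S ` \<V>"
      then obtain W where W: "W \<in> \<V>" "W' = S W" by blast
      show "eopen q W'" using W S by simp
      have SV: "S W \<subseteq> V" by (auto simp: S_def)
      have 1: "smooth_map q (S W) n W u" by (rule smooth_map_subset[OF u V SV]) (auto simp: S_def)
      have 2: "restrict \<xi> (S W) \<in> plots X q (S W)"
        by (rule diffeological_space.plot_restrict[OF X V \<xi> S[OF W(1)] SV])
      have "(\<lambda>v\<in>S W. restrict P W (u v) (restrict \<xi> (S W) v)) \<in> plots Y q (S W)"
        using \<V>(3)[OF W(1), unfolded mapping_space_plot_iff[OF X \<V>(1)[OF W(1)]]] S[OF W(1)] 1 2 by blast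
      moreover have "(\<lambda>v\<in>S W. restrict P W (u v) (restrict \<xi> (S W) v)) = restrict (\<lambda>v\<in>V. P (u v) (\<xi> v)) W'"
        using SV W(2) by (auto simp: S_def fun_eq_iff)
      ultimately show "restrict (\<lambda>v\<in>V. P (u v) (\<xi> v)) W' \<in> plots Y q W'" using W(2) by simp
    qed
  qed
qed

lemma diffeological_sub:
  assumes X: "diffeological_space X"
  shows "diffeological_space (sub_diffeology X A)"
proof
  fix n U assume U: "eopen n U"
  show "plots (sub_diffeology X A) n U \<subseteq> U \<rightarrow>\<^sub>E points (sub_diffeology X A)"
  proof
    fix p assume p: "p \<in> plots (sub_diffeology X A) n U"
    then have "p \<in> plots X n U" "p ` U \<subseteq> A" by (simp_all add: sub_diffeology_def)
    moreover from this(1) have "p \<in> U \<rightarrow>\<^sub>E points X" using diffeological_space.plots_subset[OF X U] by blast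
    ultimately show "p \<in> U \<rightarrow>\<^sub>E points (sub_diffeology X A)" by (auto simp: sub_diffeology_def)
  qed
  fix x assume "x \<in> points (sub_diffeology X A)"
  then have "x \<in> points X" "x \<in> A" by (simp_all add: sub_diffeology_def)
  then show "(\<lambda>u\<in>U. x) \<in> plots (sub_diffeology X A) n U"
    using diffeological_space.const_plot[OF X U] by (auto simp: sub_diffeology_def)
next
  fix n U m V p f assume U: "eopen n U" and V: "eopen m V" and p: "p \<in> plots (sub_diffeology X A) n U"
    and f: "smooth_map m V n U f"
  have "p \<in> plots X n U" using p by (simp add: sub_diffeology_def)
  then have "compose V p f \<in> plots X m V" by (rule diffeological_space.plot_compose[OF X U V _ f])
  moreover have "compose V p f ` V \<subseteq> A"
    using p f by (auto simp: sub_diffeology_def smooth_map_iff compose_def)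
  ultimately show "compose V p f \<in> plots (sub_diffeology X A) m V" by (simp add: sub_diffeology_def)
next
  fix n U p \<V> assume U: "eopen n U" and p: "p \<in> U \<rightarrow>\<^sub>E points (sub_diffeology X A)"
    and \<V>: "\<And>V. V \<in> \<V> \<Longrightarrow> eopen n V" "\<Union>\<V> = U" "\<And>V. V \<in> \<V> \<Longrightarrow> restrict p V \<in> plots (sub_diffeology X A) n V"
  have "p \<in> plots X n U"
  proof (rule diffeological_space.plot_local[OF X U _ \<V>(1,2)])
    show "p \<in> U \<rightarrow>\<^sub>E points X" using p by (auto simp: sub_diffeology_def)
    show "restrict p V \<in> plots X n V" if "V \<in> \<V>" for V using \<V>(3)[OF that] by (simp add: sub_diffeology_def)
  qed
  moreover have "p ` U \<subseteq> A" using p by (auto simp: sub_diffeology_def)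
  ultimately show "p \<in> plots (sub_diffeology X A) n U" by (simp add: sub_diffeology_def)
qed

section \<open>Affine simplices\<close>

definition aff :: "nat \<Rightarrow> (nat \<Rightarrow> real) set" where
  "aff n = {x \<in> Esp (Suc n). (\<Sum>i\<le>n. x i) = 1}"

lemma points_affine_simplex [simp]: "points (affine_simplex n) = aff n"
  by (auto simp: affine_simplex_def sub_diffeology_def euclidean_diffeology_def aff_def)

lemma plots_affine_simplex:
  "p \<in> plots (affine_simplex n) q V \<longleftrightarrow> p \<in> extensional V \<and> smooth_map q V (Suc n) (aff n) p"
  by (auto simp: affine_simplex_def sub_diffeology_def euclidean_diffeology_def aff_def smooth_map_iff PiE_def Pi_iff image_subset_iff)

text \<open>Exponential law: a simplex of the mapping space is a smooth map on the product of the
  affine simplex and \<open>X\<close>. Smoothness of each single value is recovered by testing with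
  constant \<open>u\<close>.\<close>

lemma smooth_maps_affine_iff:
  assumes X: "diffeological_space X" and Y: "diffeological_space Y"
  shows "\<sigma> \<in> smooth_maps (affine_simplex n) (mapping_space X Y) \<longleftrightarrow>
    \<sigma> \<in> aff n \<rightarrow>\<^sub>E (points X \<rightarrow>\<^sub>E points Y) \<and>
    (\<forall>q V u \<xi>. eopen q V \<longrightarrow> smooth_map q V (Suc n) (aff n) u \<longrightarrow> \<xi> \<in> plots X q V \<longrightarrow>
      (\<lambda>v\<in>V. \<sigma> (u v) (\<xi> v)) \<in> plots Y q V)"
proof (intro iffI conjI allI impI)
  assume \<sigma>: "\<sigma> \<in> smooth_maps (affine_simplex n) (mapping_space X Y)"
  have s1: "\<sigma> \<in> aff n \<rightarrow>\<^sub>E smooth_maps X Y" using smooth_mapsD(1)[OF \<sigma>] by simp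
  then show "\<sigma> \<in> aff n \<rightarrow>\<^sub>E (points X \<rightarrow>\<^sub>E points Y)"
    using smooth_mapsD(1)[where X = X and Y = Y] by (auto simp: PiE_iff)
  fix q V u \<xi> assume V: "eopen q V" and u: "smooth_map q V (Suc n) (aff n) u" and \<xi>: "\<xi> \<in> plots X q V"
  have "restrict u V \<in> plots (affine_simplex n) q V" using u V by (simp add: plots_affine_simplex smooth_map_restrict)
  from smooth_mapsD(2)[OF \<sigma> V this] have c: "compose V \<sigma> (restrict u V) \<in> plots (mapping_space X Y) q V" .
  \<comment> \<open>The plot of maps is tested on the pair of the identity of \<open>V\<close> and
    \<open>\<xi>\<close>.\<close>
  have "(\<lambda>v\<in>V. compose V \<sigma> (restrict u V) v (\<xi> v)) \<in> plots Y q V"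
    using c[unfolded mapping_space_plot_iff[OF X V]] V \<xi> smooth_map_id[OF V order_refl] by blast
  moreover have "(\<lambda>v\<in>V. compose V \<sigma> (restrict u V) v (\<xi> v)) = (\<lambda>v\<in>V. \<sigma> (u v) (\<xi> v))"
    by (auto simp: compose_def fun_eq_iff)
  ultimately show "(\<lambda>v\<in>V. \<sigma> (u v) (\<xi> v)) \<in> plots Y q V" by simp
next
  assume R: "\<sigma> \<in> aff n \<rightarrow>\<^sub>E (points X \<rightarrow>\<^sub>E points Y) \<and>
    (\<forall>q V u \<xi>. eopen q V \<longrightarrow> smooth_map q V (Suc n) (aff n) u \<longrightarrow> \<xi> \<in> plots X q V \<longrightarrow>
      (\<lambda>v\<in>V. \<sigma> (u v) (\<xi> v)) \<in> plots Y q V)"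
  have sm: "\<sigma> a \<in> smooth_maps X Y" if a: "a \<in> aff n" for a
    unfolding smooth_maps_def
  proof (intro CollectI conjI allI impI ballI)
    show "\<sigma> a \<in> points X \<rightarrow>\<^sub>E points Y" using R a by blast
    fix q V \<xi> assume V: "eopen q V" and \<xi>: "\<xi> \<in> plots X q V"
    have "(\<lambda>v\<in>V. \<sigma> a (\<xi> v)) \<in> plots Y q V" using R V \<xi> smooth_map_const[OF V a, of "Suc n"] by blast
    then show "compose V (\<sigma> a) \<xi> \<in> plots Y q V" by (simp add: compose_def)
  qed
  show "\<sigma> \<in> smooth_maps (affine_simplex n) (mapping_space X Y)"
    unfolding smooth_maps_def
  proof (intro CollectI conjI allI impI ballI)
    show "\<sigma> \<in> points (affine_simplex n) \<rightarrow>\<^sub>E points (mapping_space X Y)"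
      using sm R by (auto simp: PiE_iff)
    fix m U p assume U: "eopen m U" and p: "p \<in> plots (affine_simplex n) m U"
    then have p: "smooth_map m U (Suc n) (aff n) p" by (simp add: plots_affine_simplex)
    have pA: "p x \<in> aff n" if "x \<in> U" for x using p that by (auto simp: smooth_map_iff)
    show "compose U \<sigma> p \<in> plots (mapping_space X Y) m U"
      unfolding mapping_space_plot_iff[OF X U]
    proof (intro conjI allI impI)
      show "compose U \<sigma> p \<in> U \<rightarrow>\<^sub>E smooth_maps X Y" using sm pA by (auto simp: compose_def)
      fix q V u \<xi> assume V: "eopen q V" and u: "smooth_map q V m U u" and \<xi>: "\<xi> \<in> plots X q V"
      have "(\<lambda>v\<in>V. \<sigma> (p (u v)) (\<xi> v)) \<in> plots Y q V"
        using R V \<xi> smooth_map_comp[OF V U u p] by blast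
      moreover have "(\<lambda>v\<in>V. \<sigma> (p (u v)) (\<xi> v)) = (\<lambda>v\<in>V. compose U \<sigma> p (u v) (\<xi> v))"
        using u by (auto simp: compose_def smooth_map_iff fun_eq_iff)
      ultimately show "(\<lambda>v\<in>V. compose U \<sigma> p (u v) (\<xi> v)) \<in> plots Y q V" by simp
    qed
  qed
qed

lemma smooth_maps_sub_iff:
  "\<sigma> \<in> smooth_maps (affine_simplex n) (sub_diffeology M B) \<longleftrightarrow>
    \<sigma> \<in> smooth_maps (affine_simplex n) M \<and> \<sigma> ` aff n \<subseteq> B"
proof
  assume \<sigma>: "\<sigma> \<in> smooth_maps (affine_simplex n) (sub_diffeology M B)"
  then show "\<sigma> \<in> smooth_maps (affine_simplex n) M \<and> \<sigma> ` aff n \<subseteq> B"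
    by (auto simp: smooth_maps_def sub_diffeology_def PiE_iff)
next
  assume \<sigma>: "\<sigma> \<in> smooth_maps (affine_simplex n) M \<and> \<sigma> ` aff n \<subseteq> B"
  show "\<sigma> \<in> smooth_maps (affine_simplex n) (sub_diffeology M B)"
    unfolding smooth_maps_def
  proof (intro CollectI conjI allI impI ballI)
    show "\<sigma> \<in> points (affine_simplex n) \<rightarrow>\<^sub>E points (sub_diffeology M B)"
      using \<sigma> by (auto simp: smooth_maps_def sub_diffeology_def PiE_iff)
    fix q V p assume V: "eopen q V" and p: "p \<in> plots (affine_simplex n) q V"
    have "compose V \<sigma> p \<in> plots M q V" using \<sigma> smooth_mapsD(2)[OF _ V p] by blast
    moreover have "compose V \<sigma> p ` V \<subseteq> B"
      using \<sigma> p by (auto simp: plots_affine_simplex smooth_map_iff compose_def)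
    ultimately show "compose V \<sigma> p \<in> plots (sub_diffeology M B) q V" by (simp add: sub_diffeology_def)
  qed
qed

section \<open>Horns in the smooth singular simplicial set\<close>

lemma \<Delta>_le: "f \<in> \<Delta> n m \<Longrightarrow> i \<le> n \<Longrightarrow> f i \<le> m"
  by (auto simp: \<Delta>_def)

lemma affine_push_compose:
  assumes f: "f \<in> \<Delta> l n"
  shows "affine_push n g (affine_push l f x) = affine_push l (compose {..l} g f) x"
proof
  fix j
  let ?S = "{a. a \<le> l \<and> g (f a) = j}" and ?T = "{i. i \<le> n \<and> g i = j}"
  have "affine_push n g (affine_push l f x) j = (\<Sum>i\<in>?T. sum x {a \<in> ?S. f a = i})"
    unfolding affine_push_def by (intro sum.cong refl) auto
  also have "\<dots> = sum x ?S"
    by (rule sum.group) (use \<Delta>_le[OF f] in auto)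
  also have "?S = {a. a \<le> l \<and> compose {..l} g f a = j}" by (auto simp: compose_def)
  finally show "affine_push n g (affine_push l f x) j = affine_push l (compose {..l} g f) x j"
    by (simp add: affine_push_def)
qed

lemma affine_push_aff:
  assumes f: "f \<in> \<Delta> l n" and x: "x \<in> aff l"
  shows "affine_push l f x \<in> aff n"
proof -
  have "affine_push l f x j = 0" if "j \<ge> Suc n" for j
  proof -
    have "{i. i \<le> l \<and> f i = j} = {}" using \<Delta>_le[OF f] that by fastforce
    then show ?thesis unfolding affine_push_def by (simp only: sum.empty)
  qed
  moreover have "(\<Sum>j\<le>n. affine_push l f x j) = 1"
  proof -
    have "(\<Sum>j\<le>n. affine_push l f x j) = (\<Sum>j\<in>{..n}. sum x {i \<in> {..l}. f i = j})"
      unfolding affine_push_def by (intro sum.cong refl) auto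
    also have "\<dots> = sum x {..l}" by (rule sum.group) (use \<Delta>_le[OF f] in auto)
    finally show ?thesis using x by (simp add: aff_def)
  qed
  ultimately show ?thesis by (simp add: aff_def Esp_iff)
qed

lemma affine_push_id: "x \<in> aff n \<Longrightarrow> affine_push n (\<lambda>i\<in>{..n}. i) x = x"
proof
  fix j assume x: "x \<in> aff n"
  have "{i. i \<le> n \<and> (\<lambda>i\<in>{..n}. i) i = j} = (if j \<le> n then {j} else {})" by auto
  then show "affine_push n (\<lambda>i\<in>{..n}. i) x j = x j"
    using x unfolding affine_push_def by (auto simp: aff_def Esp_iff not_le)
qed

lemma affine_push_smooth:
  assumes V: "eopen q V" and p: "smooth_map q V (Suc l) (aff l) p" and f: "f \<in> \<Delta> l n"
  shows "smooth_map q V (Suc n) (aff n) (\<lambda>v. affine_push l f (p v))"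
  unfolding smooth_map_iff
proof (intro conjI allI impI)
  show "(\<lambda>v. affine_push l f (p v)) \<in> V \<rightarrow> aff n"
    using p affine_push_aff[OF f] by (auto simp: smooth_map_iff)
  fix j show "smooth_on q V (\<lambda>v. affine_push l f (p v) j)"
    unfolding affine_push_def
    by (rule smooth_on_sum[OF V]) (use p in \<open>auto simp: smooth_map_iff\<close>)
qed

lemma simplices_smooth_singular [simp]: "simplices (smooth_singular M) n = smooth_maps (affine_simplex n) M"
  by (simp add: smooth_singular_def)

lemma act_smooth_singular: "act (smooth_singular M) n m f \<sigma> = compose (aff n) \<sigma> (affine_push n f)"
  by (simp add: smooth_singular_def)

lemma simplicial_set_smooth_singular: "simplicial_set (smooth_singular M)"
proof
  fix f n m \<sigma> assume f: "f \<in> \<Delta> n m" and "\<sigma> \<in> simplices (smooth_singular M) m"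
  then have \<sigma>: "\<sigma> \<in> smooth_maps (affine_simplex m) M" by simp
  have "compose (aff n) \<sigma> (affine_push n f) \<in> smooth_maps (affine_simplex n) M"
    unfolding smooth_maps_def
  proof (intro CollectI conjI allI impI ballI)
    show "compose (aff n) \<sigma> (affine_push n f) \<in> points (affine_simplex n) \<rightarrow>\<^sub>E points M"
      using smooth_mapsD(1)[OF \<sigma>] affine_push_aff[OF f] by (auto simp: compose_def)
    fix q V p assume V: "eopen q V" and p: "p \<in> plots (affine_simplex n) q V"
    then have p: "smooth_map q V (Suc n) (aff n) p" by (simp add: plots_affine_simplex)
    have "restrict (\<lambda>v. affine_push n f (p v)) V \<in> plots (affine_simplex m) q V"
      using affine_push_smooth[OF V p f] V by (simp add: plots_affine_simplex smooth_map_restrict)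
    from smooth_mapsD(2)[OF \<sigma> V this]
    have "compose V \<sigma> (restrict (\<lambda>v. affine_push n f (p v)) V) \<in> plots M q V" .
    moreover have "compose V \<sigma> (restrict (\<lambda>v. affine_push n f (p v)) V)
        = compose V (compose (aff n) \<sigma> (affine_push n f)) p"
      using p by (auto simp: compose_def smooth_map_iff fun_eq_iff)
    ultimately show "compose V (compose (aff n) \<sigma> (affine_push n f)) p \<in> plots M q V" by simp
  qed
  then show "act (smooth_singular M) n m f \<sigma> \<in> simplices (smooth_singular M) n"
    by (simp add: act_smooth_singular)
next
  fix \<sigma> n assume "\<sigma> \<in> simplices (smooth_singular M) n"
  then have "\<sigma> \<in> aff n \<rightarrow>\<^sub>E points M" using smooth_mapsD(1) by fastforce
  then have ext: "\<sigma> x = undefined" if "x \<notin> aff n" for x using that by (rule PiE_arb)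
  show "act (smooth_singular M) n n (\<lambda>i\<in>{..n}. i) \<sigma> = \<sigma>"
    unfolding act_smooth_singular
  proof
    fix x show "compose (aff n) \<sigma> (affine_push n (\<lambda>i\<in>{..n}. i)) x = \<sigma> x"
    proof (cases "x \<in> aff n")
      case True
      then show ?thesis by (simp only: compose_eq affine_push_id[OF True])
    next
      case False
      then show ?thesis using ext by (simp add: compose_def)
    qed
  qed
next
  fix f l n g m \<sigma> assume f: "f \<in> \<Delta> l n" and g: "g \<in> \<Delta> n m" and "\<sigma> \<in> simplices (smooth_singular M) m"
  show "act (smooth_singular M) l m (compose {..l} g f) \<sigma> =
      act (smooth_singular M) l n f (act (smooth_singular M) n m g \<sigma>)"
    unfolding act_smooth_singular
    using affine_push_aff[OF f] by (auto simp: compose_def affine_push_compose[OF f, unfolded compose_def] fun_eq_iff)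
qed

section \<open>Faces of affine simplices and the filling of horns\<close>

definition face :: "nat \<Rightarrow> nat \<Rightarrow> nat \<Rightarrow> nat" where
  "face n i = (\<lambda>l\<in>{..n}. if l < i then l else Suc l)"

text \<open>On the hyperplane \<open>x i = 0\<close> this inverts the push along
  \<open>face n i\<close>: points of a face become points of a simplex of one dimension
  less.\<close>

definition omit :: "nat \<Rightarrow> (nat \<Rightarrow> real) \<Rightarrow> nat \<Rightarrow> real" where
  "omit i x = (\<lambda>l. if l < i then x l else x (Suc l))"

lemma face_\<Delta>: "face n i \<in> \<Delta> n (Suc n)"
  by (auto simp: face_def \<Delta>_def mono_on_def)

lemma affine_push_face:
  assumes w: "w \<in> Esp (Suc n)" and i: "i \<le> Suc n"
  shows "affine_push n (face n i) w j = (if j < i then w j else if j = i then 0 else w (j - 1))"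
proof -
  have "{l. l \<le> n \<and> face n i l = j} = (if j < i then {j} else if j = i then {} else if j - 1 \<le> n then {j - 1} else {})"
    using i by (auto simp: face_def)
  moreover have "w (j - 1) = 0" if "\<not> j - 1 \<le> n" using w that by (simp add: Esp_iff)
  ultimately show ?thesis unfolding affine_push_def by auto
qed

lemma omit_aff:
  assumes x: "x \<in> aff (Suc n)" and i: "i \<le> Suc n" "x i = 0"
  shows "omit i x \<in> aff n"
proof -
  have "bij_betw (\<lambda>l. if l < i then l else Suc l) {..n} ({..Suc n} - {i})"
    by (rule bij_betw_byWitness[where f' = "\<lambda>l. if l < i then l else l - 1"]) (use i in auto)
  then have "(\<Sum>l\<le>n. x (if l < i then l else Suc l)) = sum x ({..Suc n} - {i})"
    by (rule sum.reindex_bij_betw)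
  also have "\<dots> = (\<Sum>l\<le>Suc n. x l)" using i by (simp add: sum_diff1 del: sum.atMost_Suc)
  finally have "(\<Sum>l\<le>n. omit i x l) = 1" using x by (simp add: aff_def omit_def if_distrib del: sum.atMost_Suc)
  then show ?thesis using x i by (auto simp: aff_def Esp_iff omit_def)
qed

lemma affine_push_face_omit:
  assumes x: "x \<in> aff (Suc n)" and i: "i \<le> Suc n" "x i = 0"
  shows "affine_push n (face n i) (omit i x) = x"
proof
  fix j
  have "omit i x \<in> Esp (Suc n)" using omit_aff[OF assms] by (simp add: aff_def)
  then show "affine_push n (face n i) (omit i x) j = x j"
    using i by (auto simp: affine_push_face omit_def)
qed

lemma omit_affine_push_face:
  assumes w: "w \<in> aff n" and i: "i \<le> Suc n"
  shows "omit i (affine_push n (face n i) w) = w" "affine_push n (face n i) w i = 0"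
  using w i by (auto simp: affine_push_face omit_def aff_def fun_eq_iff)

lemma simplices_horn: "s \<in> simplices (horn n k) m \<longleftrightarrow> s \<in> \<Delta> m n \<and> (\<exists>i\<le>n. i \<noteq> k \<and> i \<notin> s ` {..m})"
  by (simp add: horn_def)

lemma act_horn: "act (horn n k) l m f s = compose {..l} s f"
  by (simp add: horn_def standard_simplex_def)

text \<open>A map out of a horn, recorded by its faces. Compatibility is stated pointwise on
  intersections of hyperplanes, which is the form the extension argument needs, in place of
  simplicial identities.\<close>

definition horn_faces :: "'a diffeology \<Rightarrow> nat \<Rightarrow> nat \<Rightarrow> (nat \<Rightarrow> (nat \<Rightarrow> real) \<Rightarrow> 'a) \<Rightarrow> bool" where
  "horn_faces M n k \<sigma> \<longleftrightarrow> (\<forall>i\<le>Suc n. i \<noteq> k \<longrightarrow> \<sigma> i \<in> smooth_maps (affine_simplex n) M) \<and>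
    (\<forall>i\<le>Suc n. \<forall>j\<le>Suc n. i \<noteq> k \<longrightarrow> j \<noteq> k \<longrightarrow>
      (\<forall>x\<in>aff (Suc n). x i = 0 \<longrightarrow> x j = 0 \<longrightarrow> \<sigma> i (omit i x) = \<sigma> j (omit j x)))"

definition fills_horn :: "'a diffeology \<Rightarrow> nat \<Rightarrow> nat \<Rightarrow> (nat \<Rightarrow> (nat \<Rightarrow> real) \<Rightarrow> 'a)
    \<Rightarrow> ((nat \<Rightarrow> real) \<Rightarrow> 'a) \<Rightarrow> bool" where
  "fills_horn M n k \<sigma> F \<longleftrightarrow> F \<in> smooth_maps (affine_simplex (Suc n)) M \<and>
    (\<forall>i\<le>Suc n. i \<noteq> k \<longrightarrow> (\<forall>x\<in>aff (Suc n). x i = 0 \<longrightarrow> F x = \<sigma> i (omit i x)))"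

text \<open>By the Yoneda correspondence a filler determines a map out of the standard simplex. It
  agrees with the given map on the horn, because every simplex of the horn factors through the face
  opposite to some vertex \<open>i\<close> other than \<open>k\<close>.\<close>

lemma Kan_complex_smooth_singularI:
  assumes fill: "\<And>n k \<sigma>. k \<le> Suc n \<Longrightarrow> horn_faces M n k \<sigma> \<Longrightarrow> \<exists>F. fills_horn M n k \<sigma> F"
  shows "Kan_complex (smooth_singular M)"
  unfolding Kan_complex_def
proof (intro conjI allI impI ballI simplicial_set_smooth_singular)
  fix N k \<phi> assume N: "1 \<le> N" and k: "k \<le> N" and \<phi>: "\<phi> \<in> simplicial_maps (horn N k) (smooth_singular M)"
  obtain n where n: "N = Suc n" using N by (cases N) auto
  have \<phi>s: "\<phi> m s \<in> smooth_maps (affine_simplex m) M" if "s \<in> simplices (horn N k) m" for m s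
    using \<phi> that by (auto simp: simplicial_maps_def)
  have \<phi>a: "\<phi> l (compose {..l} s f) = compose (aff l) (\<phi> m s) (affine_push l f)"
    if "f \<in> \<Delta> l m" "s \<in> simplices (horn N k) m" for l m f s
    using \<phi> that unfolding simplicial_maps_def by (simp add: act_horn act_smooth_singular)
  define \<sigma> where "\<sigma> i = \<phi> n (face n i)" for i
  have fh: "face n i \<in> simplices (horn N k) n" if "i \<le> N" "i \<noteq> k" for i
    unfolding simplices_horn n using that n face_\<Delta>[of n i] by (auto simp: face_def intro!: exI[of _ i])
  have compat: "\<sigma> i (omit i x) = \<sigma> j (omit j x)"
    if ij: "i < j" "i \<noteq> k" "j \<le> N" "j \<noteq> k" and x: "x \<in> aff N" "x i = 0" "x j = 0" for i j x
  proof -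
    \<comment> \<open>\<open>i\<close>, \<open>j\<close> and \<open>k\<close> are three distinct
      vertices, so the dimension is at least 2 and faces of faces exist.\<close>
    obtain n' where n': "n = Suc n'" using ij k n by (cases n) auto
    define y where "y = omit i (omit j x)"
    have dj: "omit j x \<in> aff (Suc n')" "omit i x \<in> aff (Suc n')"
      using omit_aff[of x n] x ij n n' by auto
    have dz: "omit j x i = 0" "omit i x (j - 1) = 0" using ij x by (auto simp: omit_def)
    have y2: "y = omit (j - 1) (omit i x)" using ij by (auto simp: y_def omit_def fun_eq_iff)
    have i': "i \<le> Suc n'" "j - 1 \<le> Suc n'" using ij n n' by auto
    have yA: "y \<in> aff n'" unfolding y_def by (rule omit_aff[OF dj(1) i'(1) dz(1)])
    have e1: "affine_push n' (face n' i) y = omit j x"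
      unfolding y_def by (rule affine_push_face_omit[OF dj(1) i'(1) dz(1)])
    have e2: "affine_push n' (face n' (j - 1)) y = omit i x"
      unfolding y2 by (rule affine_push_face_omit[OF dj(2) i'(2) dz(2)])
    have f1: "face n' i \<in> \<Delta> n' n" "face n' (j - 1) \<in> \<Delta> n' n" using face_\<Delta> n' by auto
    \<comment> \<open>The cosimplicial identity for \<open>i < j\<close>: both composites skip
      exactly \<open>i\<close> and \<open>j\<close>.\<close>
    have "compose {..n'} (face n j) (face n' i) = compose {..n'} (face n i) (face n' (j - 1))"
      using ij n' by (auto simp: compose_def face_def fun_eq_iff)
    moreover have "\<phi> n' (compose {..n'} (face n j) (face n' i)) y = \<sigma> j (omit j x)"
      unfolding \<phi>a[OF f1(1) fh[OF ij(3,4)]] \<sigma>_def using yA e1 by (simp add: compose_def)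
    moreover have "\<phi> n' (compose {..n'} (face n i) (face n' (j - 1))) y = \<sigma> i (omit i x)"
    proof -
      have "i \<le> N" using ij by simp
      from \<phi>a[OF f1(2) fh[OF this ij(2)]] show ?thesis unfolding \<sigma>_def using yA e2 by (simp add: compose_def)
    qed
    ultimately show ?thesis by simp
  qed
  have "horn_faces M n k \<sigma>"
    unfolding horn_faces_def
  proof (intro conjI allI impI ballI)
    show "\<sigma> i \<in> smooth_maps (affine_simplex n) M" if "i \<le> Suc n" "i \<noteq> k" for i
      unfolding \<sigma>_def by (rule \<phi>s[OF fh]) (use that n in auto)
    show "\<sigma> i (omit i x) = \<sigma> j (omit j x)"
      if "i \<le> Suc n" "j \<le> Suc n" "i \<noteq> k" "j \<noteq> k" "x \<in> aff (Suc n)" "x i = 0" "x j = 0" for i j x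
    proof (cases i j rule: linorder_cases)
      case less
      show ?thesis by (rule compat[OF less]) (use that n in simp_all)
    next
      case greater
      show ?thesis by (rule compat[OF greater, symmetric]) (use that n in simp_all)
    qed simp
  qed
  then obtain F where "fills_horn M n k \<sigma> F" using fill[of k n \<sigma>] k n by auto
  then have F: "F \<in> smooth_maps (affine_simplex N) M"
    "\<And>i x. i \<le> N \<Longrightarrow> i \<noteq> k \<Longrightarrow> x \<in> aff N \<Longrightarrow> x i = 0 \<Longrightarrow> F x = \<sigma> i (omit i x)"
    unfolding fills_horn_def n by blast+
  define \<psi> where "\<psi> m s = act (smooth_singular M) m N s F" for m s
  show "\<exists>\<psi>\<in>simplicial_maps (standard_simplex N) (smooth_singular M).
      \<forall>m. \<forall>s\<in>simplices (horn N k) m. \<psi> m s = \<phi> m s"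
  proof (intro bexI[of _ \<psi>] allI ballI)
    interpret S: simplicial_set "smooth_singular M" by (rule simplicial_set_smooth_singular)
    show "\<psi> \<in> simplicial_maps (standard_simplex N) (smooth_singular M)"
      unfolding simplicial_maps_def
    proof (intro CollectI conjI allI ballI)
      show "\<psi> m \<in> simplices (standard_simplex N) m \<rightarrow> simplices (smooth_singular M) m" for m
        unfolding \<psi>_def standard_simplex_def using S.act_closed F(1) by auto
      show "\<psi> l (act (standard_simplex N) l m f s) = act (smooth_singular M) l m f (\<psi> m s)"
        if "f \<in> \<Delta> l m" "s \<in> simplices (standard_simplex N) m" for l m f s
        unfolding \<psi>_def using S.act_compose[of f l m s N F] that F(1) by (simp add: standard_simplex_def)
    qed
    fix m s assume "s \<in> simplices (horn N k) m"
    then obtain i where s: "s \<in> \<Delta> m N" and i: "i \<le> N" "i \<noteq> k" "i \<notin> s ` {..m}" unfolding simplices_horn by blast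
    \<comment> \<open>Since \<open>s\<close> misses \<open>i\<close>, closing the gap at
      \<open>i\<close> gives a \<open>t\<close> such that \<open>s\<close> is
      \<open>face n i\<close> after \<open>t\<close>.\<close>
    define t where "t = (\<lambda>l\<in>{..m}. if s l < i then s l else s l - 1)"
    have si: "s l \<noteq> i" if "l \<le> m" for l using i(3) that by blast
    have t: "t \<in> \<Delta> m n"
      unfolding \<Delta>_def
    proof (intro CollectI conjI)
      have "(if s l < i then s l else s l - 1) \<le> n" if "l \<le> m" for l
        using \<Delta>_le[OF s that] si[OF that] i(1) n by auto
      then show "t \<in> {..m} \<rightarrow>\<^sub>E {..n}" unfolding t_def by auto
      have "s a \<le> s b" if "a \<le> b" "b \<le> m" for a b
        using s that by (auto simp: \<Delta>_def mono_on_def)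
      then show "mono_on {..m} t" unfolding mono_on_def t_def by (fastforce intro: diff_le_mono)
    qed
    have st: "compose {..m} (face n i) t = s"
    proof
      fix l show "compose {..m} (face n i) t l = s l"
      proof (cases "l \<le> m")
        case True
        have "t l \<le> n" by (rule \<Delta>_le[OF t True])
        then show ?thesis using True si[OF True] by (auto simp: compose_def face_def t_def split: if_splits)
      next
        case False
        then show ?thesis using s by (auto simp: compose_def \<Delta>_def PiE_iff extensional_def)
      qed
    qed
    have "\<phi> m s = compose (aff m) (\<sigma> i) (affine_push m t)"
      using \<phi>a[OF t fh[OF i(1,2)]] st by (simp add: \<sigma>_def)
    also have "\<dots> = compose (aff m) F (affine_push m s)"
    proof
      fix y show "compose (aff m) (\<sigma> i) (affine_push m t) y = compose (aff m) F (affine_push m s) y"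
      proof (cases "y \<in> aff m")
        case True
        have tA: "affine_push m t y \<in> aff n" by (rule affine_push_aff[OF t True])
        have eq: "affine_push m s y = affine_push n (face n i) (affine_push m t y)"
          using affine_push_compose[OF t, of "face n i" y] st by simp
        have sA: "affine_push m s y \<in> aff N" by (rule affine_push_aff[OF s True])
        have i': "i \<le> Suc n" using i(1) n by simp
        have "F (affine_push m s y) = \<sigma> i (omit i (affine_push m s y))"
          by (rule F(2)[OF i(1,2) sA]) (simp add: eq omit_affine_push_face(2)[OF tA i'])
        also have "omit i (affine_push m s y) = affine_push m t y"
          unfolding eq by (rule omit_affine_push_face(1)[OF tA i'])
        finally show ?thesis using True by (simp add: compose_def)
      qed (simp add: compose_def)
    qed
    finally show "\<psi> m s = \<phi> m s" by (simp add: \<psi>_def act_smooth_singular)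
  qed
qed

context smooth_manifold
begin

text \<open>The coordinates other than coordinate \<open>k\<close> are free on the affine simplex.
  The faces are therefore spread out to families on all of R^(n+2) by means of \<open>\<pi>\<close>,
  extended there across the coordinate hyperplanes, and the result is restricted to the
  simplex.\<close>

lemma mapping_space_horn_filler:
  assumes X: "diffeological_space X" "compact_space (D_topology X)"
    and k: "k \<le> Suc n" and faces: "horn_faces (mapping_space X \<N>) n k \<sigma>"
  shows "\<exists>F. fills_horn (mapping_space X \<N>) n k \<sigma> F \<and>
    (\<forall>z\<in>points X. \<forall>b. (\<forall>i\<le>Suc n. i \<noteq> k \<longrightarrow> (\<forall>x\<in>aff n. \<sigma> i x z = b)) \<longrightarrow> (\<forall>x\<in>aff (Suc n). F x z = b))"
proof -
  define I where "I = {..Suc n} - {k}"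
  define m where "m = Suc (Suc n)"
  \<comment> \<open>Overwriting coordinate \<open>k\<close> makes the sum 1 and leaves the other
    coordinates alone, so each hyperplane \<open>x i = 0\<close> with \<open>i\<close> in
    \<open>I\<close> is mapped into itself.\<close>
  define \<pi> where "\<pi> x = x(k := 1 - (\<Sum>l\<in>I. x l))" for x :: "nat \<Rightarrow> real"
  have I: "finite I" "I \<noteq> {}"
  proof -
    have "(if k = 0 then 1 else 0) \<in> I" by (auto simp: I_def)
    then show "I \<noteq> {}" by blast
  qed (simp add: I_def)
  have Imem: "i \<in> I \<longleftrightarrow> i \<le> Suc n \<and> i \<noteq> k" for i by (auto simp: I_def)
  have sumI: "(\<Sum>l\<le>Suc n. x l) = x k + (\<Sum>l\<in>I. x l)" for x :: "nat \<Rightarrow> real"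
    unfolding I_def using k by (intro sum.remove) auto
  have \<pi>I: "(\<Sum>l\<in>I. \<pi> x l) = (\<Sum>l\<in>I. x l)" for x
    by (intro sum.cong) (auto simp: \<pi>_def I_def)
  have \<pi>A: "\<pi> x \<in> aff (Suc n)" if "x \<in> Esp m" for x
  proof -
    have "(\<Sum>l\<le>Suc n. \<pi> x l) = 1" unfolding sumI \<pi>I by (simp add: \<pi>_def)
    moreover have "\<pi> x \<in> Esp m" using that k by (auto simp: \<pi>_def m_def Esp_iff)
    ultimately show ?thesis unfolding aff_def m_def by blast
  qed
  have \<pi>id: "\<pi> x = x" if "x \<in> aff (Suc n)" for x
  proof -
    have "x k + (\<Sum>l\<in>I. x l) = 1" using that unfolding sumI[symmetric] aff_def by blast
    then have "1 - (\<Sum>l\<in>I. x l) = x k" by simp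
    then show ?thesis unfolding \<pi>_def by simp
  qed
  have \<pi>i: "\<pi> x i = x i" if "i \<in> I" for x i using that by (simp add: \<pi>_def I_def)
  \<comment> \<open>Setting coordinate \<open>i\<close> to 0 turns the face into a family on the
    whole space, as \<open>smooth_param\<close> requires, and changes nothing on the hyperplane
    \<open>x i = 0\<close>.\<close>
  define a where "a i x = omit i (\<pi> (x(i := 0)))" for i x
  have aA: "a i x \<in> aff n" if "i \<in> I" "x \<in> Esp m" for i x
    unfolding a_def
    by (rule omit_aff[OF \<pi>A]) (use that \<pi>i[OF that(1)] Imem in \<open>auto simp: Esp_iff\<close>)
  define f where "f i x = \<sigma> i (a i x)" for i x
  note N = diffeological_manifold
  have \<sigma>': "\<sigma> i \<in> aff n \<rightarrow>\<^sub>E (points X \<rightarrow>\<^sub>E topspace T)"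
    "\<And>q V u \<xi>. eopen q V \<Longrightarrow> smooth_map q V (Suc n) (aff n) u \<Longrightarrow> \<xi> \<in> plots X q V \<Longrightarrow>
      (\<lambda>v\<in>V. \<sigma> i (u v) (\<xi> v)) \<in> plots \<N> q V" if "i \<in> I" for i
    using faces[unfolded horn_faces_def, THEN conjunct1, rule_format, of i] that unfolding Imem smooth_maps_affine_iff[OF X(1) N] points_manifold by blast+
  have fs: "smooth_param X m (f i)" if i: "i \<in> I" for i
    unfolding smooth_param_def
  proof (intro allI impI)
    fix q V u \<xi> assume t: "test_plot X m q V u \<xi>"
    have V: "eopen q V" and \<xi>: "\<xi> \<in> plots X q V" and u: "\<And>v. v \<in> V \<Longrightarrow> u v \<in> Esp m"
      using t by (auto simp: test_plot_def)
    have us: "smooth_on q V (\<lambda>v. ((u v)(i := 0)) j)" for j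
      using test_plot_upd[OF t, of i] unfolding test_plot_def by blast
    have \<pi>s: "smooth_on q V (\<lambda>v. \<pi> ((u v)(i := 0)) j)" for j
    proof (cases "j = k")
      case True
      have "smooth_on q V (\<lambda>v. 1 - (\<Sum>l\<in>I. ((u v)(i := 0)) l))"
        by (intro smooth_on_diff smooth_on_const smooth_on_sum V I us)
      then show ?thesis using True by (simp add: \<pi>_def)
    next
      case False
      then show ?thesis using us[of j] by (simp add: \<pi>_def)
    qed
    have "smooth_on q V (\<lambda>v. a i (u v) j)" for j
      unfolding a_def omit_def using \<pi>s by (cases "j < i") simp_all
    then have "smooth_map q V (Suc n) (aff n) (\<lambda>v. a i (u v))"
      using aA[OF i u] by (auto simp: smooth_map_iff)
    from \<sigma>'(2)[OF i V this \<xi>] have "mplot q V (\<lambda>v\<in>V. f i (u v) (\<xi> v))"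
      unfolding f_def plots_manifold[OF V] by blast
    then show "mplot q V (\<lambda>v. f i (u v) (\<xi> v))" by (rule mplot_cong_imp[OF _ V]) simp
  qed
  have fc: "f i x z = f j x z" if "i \<in> I" "j \<in> I" "x \<in> Esp m" "z \<in> points X" "x i = 0" "x j = 0" for i j x z
  proof -
    have "x(i := 0) = x" "x(j := 0) = x" using that by (auto simp: fun_eq_iff)
    moreover have "\<sigma> i (omit i (\<pi> x)) = \<sigma> j (omit j (\<pi> x))"
      by (rule faces[unfolded horn_faces_def, THEN conjunct2, rule_format]) (use that \<pi>A \<pi>i Imem in auto)
    ultimately show ?thesis by (simp only: f_def a_def)
  qed
  obtain E where E0: "extends_faces X m f I E" by (rule exE[OF extension[OF X I fs fc]])
  note E0 = E0[unfolded extends_faces_def]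
  have E1: "smooth_param X m E" by (rule E0[THEN conjunct1])
  have E2: "\<And>i x z. i \<in> I \<Longrightarrow> x \<in> Esp m \<Longrightarrow> z \<in> points X \<Longrightarrow> x i = 0 \<Longrightarrow> E x z = f i x z"
    by (rule E0[THEN conjunct2, THEN conjunct1, rule_format])
  have E3: "\<And>z b x. z \<in> points X \<Longrightarrow> \<forall>i\<in>I. \<forall>x\<in>Esp m. f i x z = b \<Longrightarrow> x \<in> Esp m \<Longrightarrow> E x z = b"
    using E0[THEN conjunct2, THEN conjunct2] by blast
  define F where "F = (\<lambda>x\<in>aff (Suc n). \<lambda>z\<in>points X. E x z)"
  have AE: "x \<in> Esp m" if "x \<in> aff (Suc n)" for x using that by (simp add: aff_def m_def)
  show ?thesis
    unfolding fills_horn_def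
  proof (intro exI[of _ F] conjI allI impI ballI)
    show "F \<in> smooth_maps (affine_simplex (Suc n)) (mapping_space X \<N>)"
      unfolding smooth_maps_affine_iff[OF X(1) N]
    proof (intro conjI allI impI)
      show "F \<in> aff (Suc n) \<rightarrow>\<^sub>E (points X \<rightarrow>\<^sub>E points \<N>)"
        unfolding F_def using smooth_param_topspace[OF X(1) E1 AE] by auto
      fix q V u \<xi> assume V: "eopen q V" and u: "smooth_map q V (Suc (Suc n)) (aff (Suc n)) u" and \<xi>: "\<xi> \<in> plots X q V"
      have uA: "u v \<in> aff (Suc n)" if "v \<in> V" for v using u that by (auto simp: smooth_map_iff)
      have "smooth_on q V (\<lambda>v. u v j)" for j
        by (rule Esp_comp_zero[OF V AE[OF uA]]) (use u in \<open>auto simp: smooth_map_iff m_def\<close>)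
      then have "test_plot X m q V u \<xi>" using V \<xi> AE[OF uA] by (simp add: test_plot_def)
      then have "mplot q V (\<lambda>v. E (u v) (\<xi> v))" using E1 unfolding smooth_param_def by blast
      then have "mplot q V (\<lambda>v\<in>V. F (u v) (\<xi> v))"
        by (rule mplot_cong_imp[OF _ V]) (use uA diffeological_space.plot_in[OF X(1) V \<xi>] in \<open>simp add: F_def\<close>)
      then show "(\<lambda>v\<in>V. F (u v) (\<xi> v)) \<in> plots \<N> q V" unfolding plots_manifold[OF V] by simp
    qed
    fix i x assume i: "i \<le> Suc n" "i \<noteq> k" and x: "x \<in> aff (Suc n)" "x i = 0"
    have iI: "i \<in> I" using i Imem by simp
    have "x(i := 0) = x" using x(2) by (auto simp: fun_eq_iff)
    then have ax: "a i x = omit i x" unfolding a_def using \<pi>id[OF x(1)] by (simp only:)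
    have "\<sigma> i (a i x) \<in> points X \<rightarrow>\<^sub>E topspace T" using \<sigma>'(1)[OF iI] aA[OF iI AE[OF x(1)]] by blast
    \<comment> \<open>\<open>F x\<close> and the face value are extensional functions on
      \<open>points X\<close>, so they have to be compared outside that set too.\<close>
    then have out: "\<sigma> i (a i x) z = undefined" if "z \<notin> points X" for z using that by (rule PiE_arb)
    show "F x = \<sigma> i (omit i x)"
      unfolding ax[symmetric]
    proof
      fix z show "F x z = \<sigma> i (a i x) z"
      proof (cases "z \<in> points X")
        case True
        from E2[OF iI AE[OF x(1)] True x(2)] show ?thesis using True x(1) by (simp add: F_def f_def)
      next
        case False
        then show ?thesis using out x(1) by (simp add: F_def)
      qed
    qed
  next
    fix z b x assume z: "z \<in> points X" and b: "\<forall>i\<le>Suc n. i \<noteq> k \<longrightarrow> (\<forall>x\<in>aff n. \<sigma> i x z = b)" and x: "x \<in> aff (Suc n)"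
    have "\<forall>i\<in>I. \<forall>x\<in>Esp m. f i x z = b"
    proof (intro ballI)
      fix i y assume i: "i \<in> I" and y: "y \<in> Esp m"
      then have "i \<le> Suc n" "i \<noteq> k" by (simp_all add: Imem)
      then show "f i y z = b" unfolding f_def using b aA[OF i y] by simp
    qed
    from E3[OF z this AE[OF x]] show "F x z = b" using x z by (simp add: F_def)
  qed
qed

end

theorem corollary4p41:
  fixes X :: "'a diffeology"
    and d :: nat
    and T :: "'b topology"
    and \<A> :: "('b set \<times> ('b \<Rightarrow> nat \<Rightarrow> real)) set"
  assumes "diffeological_space X"
    and "compact_space (D_topology X)"
    and "smooth_manifold d T \<A>"
  shows "fibrant (mapping_space X (manifold_diffeology d T \<A>)) \<and>
    (\<forall>x\<^sub>0 \<in> points X. \<forall>n\<^sub>0 \<in> topspace T.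
       fibrant (sub_diffeology (mapping_space X (manifold_diffeology d T \<A>))
         {f \<in> smooth_maps X (manifold_diffeology d T \<A>). f x\<^sub>0 = n\<^sub>0}))"
proof (intro conjI ballI)
  interpret smooth_manifold d T \<A> by (rule assms(3))
  let ?M = "mapping_space X \<N>"
  have M: "diffeological_space ?M" by (rule diffeological_mapping_space[OF assms(1) diffeological_manifold])
  have "Kan_complex (smooth_singular ?M)"
    by (rule Kan_complex_smooth_singularI) (use mapping_space_horn_filler[OF assms(1,2)] in blast)
  with M show "fibrant ?M" by (simp add: fibrant_def)
  fix x0 n0 assume x0: "x0 \<in> points X" and n0: "n0 \<in> topspace T"
  let ?B = "{f \<in> smooth_maps X \<N>. f x0 = n0}"
  have "Kan_complex (smooth_singular (sub_diffeology ?M ?B))"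
  proof (rule Kan_complex_smooth_singularI)
    fix n k \<sigma>
    assume k: "k \<le> Suc n" and \<sigma>: "horn_faces (sub_diffeology ?M ?B) n k \<sigma>"
    have \<sigma>M: "horn_faces ?M n k \<sigma>"
      using \<sigma> unfolding horn_faces_def smooth_maps_sub_iff by blast
    have \<sigma>0: "\<sigma> i x x0 = n0" if "i \<le> Suc n" "i \<noteq> k" "x \<in> aff n" for i x
      using \<sigma>[unfolded horn_faces_def smooth_maps_sub_iff, THEN conjunct1, rule_format, OF that(1,2)] that(3) by blast
    obtain F where F: "fills_horn ?M n k \<sigma> F \<and>
       (\<forall>z\<in>points X. \<forall>b. (\<forall>i\<le>Suc n. i \<noteq> k \<longrightarrow> (\<forall>x\<in>aff n. \<sigma> i x z = b)) \<longrightarrow> (\<forall>x\<in>aff (Suc n). F x z = b))"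
      by (rule exE[OF mapping_space_horn_filler[OF assms(1,2) k \<sigma>M]])
    \<comment> \<open>Every face takes the value \<open>n0\<close> at \<open>x0\<close>, so the
      constancy clause of the filler applies with \<open>x0\<close> for \<open>z\<close> and
      \<open>n0\<close> for \<open>b\<close>.\<close>
    have F3: "\<forall>x\<in>aff (Suc n). F x x0 = n0"
      by (rule F[THEN conjunct2, THEN bspec, OF x0, THEN spec, THEN mp]) (simp add: \<sigma>0)
    note F1 = F[THEN conjunct1, unfolded fills_horn_def]
    have "F ` aff (Suc n) \<subseteq> ?B" using smooth_mapsD(1)[OF F1[THEN conjunct1]] F3 by auto
    then show "\<exists>F. fills_horn (sub_diffeology ?M ?B) n k \<sigma> F"
      using F1 unfolding fills_horn_def smooth_maps_sub_iff by blast
  qed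
  with diffeological_sub[OF M] show "fibrant (sub_diffeology ?M ?B)" by (simp add: fibrant_def)
qed

end
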